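(* Let $\Omega,p,h,\gamma$ satisfy the standing assumptions listed in the context, and fix $\varepsilon>0$ and $m>0$. Then for every $\mu\ge0$ and every $0<\delta\le1$ the functional $I_{\mu,\delta}$ attains its minimum on $\mathcal M_m^+$.
   Context: Standing assumptions: $N\ge2$ and $\Omega\subset\mathbb R^N$ is a bounded domain with Lipschitz boundary. The exponent $p:\overline\Omega\to(1,\infty)$ satisfies $1<p^-\le p(x)\le p^+<\infty$, where $p^-=\min_{\overline\Omega}p$ and $p^+=\max_{\overline\Omega}p$, and is log-Hölder continuous: there is $C_{\log}>0$ with $|p(x)-p(y)|\le C_{\log}/\log(e+1/|x-y|)$ for all $x\ne y$ in $\overline\Omega$. Further $h\in L^\infty(\Omega)$, $h\ge0$ a.e., $h\not\equiv0$; and $\gamma\in C(\overline\Omega)$ with $0<\gamma^-\le\gamma(x)\le\gamma^+<1$ for all $x\in\overline\Omega$. Spaces: $L^{p(\cdot)}(\Omega)$ is the space of measurable $u$ with $\int_\Omega|u|^{p(x)}dx<\infty$, with the Luxemburg norm $\|u\|_{p(\cdot)}=\inf\{\tau>0:\int_\Omega|u/\tau|^{p(x)}dx\le1\}$. $W^{1,p(\cdot)}(\Omega)=\{u\in L^{p(\cdot)}(\Omega):|\nabla u|\in L^{p(\cdot)}(\Omega)\}$ with norm $\|u\|_{p(\cdot)}+\|\nabla u\|_{p(\cdot)}$; $X=W^{1,p(\cdot)}_0(\Omega)$ is the closure of $C_0^\infty(\Omega)$ in $W^{1,p(\cdot)}(\Omega)$, with the equivalent norm $\|u\|=\|\nabla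 u\|_{p(\cdot)}$. $X_+=\{u\in X:u\ge0\text{ a.e. in }\Omega\}$. Functionals: $\Phi_\varepsilon(x,\xi)=\frac{(\varepsilon^2+|\xi|^2)^{p(x)/2}-\varepsilon^{p(x)}}{p(x)}$ for $\xi\in\mathbb R^N$; $E_\varepsilon(u)=\int_\Omega\Phi_\varepsilon(x,\nabla u)\,dx$; $J(u)=\int_\Omega\frac{|u|^{p(x)}}{p(x)}dx$; $\mathcal M_m^+=\{u\in X_+:J(u)=m\}$. For $0<\delta\le1$ and $s\ge0$, $G_\delta(x,s)=\frac{(s+\delta)^{1-\gamma(x)}-\delta^{1-\gamma(x)}}{1-\gamma(x)}$, and $I_{\mu,\delta}(u)=E_\varepsilon(u)-\mu\int_\Omega h(x)G_\delta(x,u)\,dx$ for $u\in X_+$. *)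

theory Defs
  imports "HOL-Analysis.Analysis"
begin

text \<open>The space $\mathbb R^N$ is the type \<open>real ^ 'n\<close> with $N = $ \<open>CARD('n)\<close>.  Elements of the
  function spaces are represented by total functions on \<open>real ^ 'n\<close>, of which only the values
  almost everywhere on \<open>\<Omega>\<close> matter; two functions equal a.e. on \<open>\<Omega>\<close> represent the same element.\<close>

subsection \<open>Domains and exponents\<close>

text \<open>Locally the domain is the strict epigraph of a Lipschitz function, in a rotated
  coordinate system whose last axis points in the direction \<open>e\<close>; the hyperplane orthogonal to \<open>e\<close>
  plays the role of $\mathbb R^{N-1}$, and \<open>x - (x \<bullet> e) *\<^sub>R e\<close> is the projection of \<open>x\<close> to it.\<close>

definition lipschitz_boundary :: "(real ^ 'n) set \<Rightarrow> bool" where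
  "lipschitz_boundary \<Omega> \<longleftrightarrow>
    (\<forall>z \<in> frontier \<Omega>. \<exists>r>0. \<exists>e. \<exists>g :: real ^ 'n \<Rightarrow> real. \<exists>C.
       norm e = 1 \<and> C-lipschitz_on {y. y \<bullet> e = 0} g \<and>
       \<Omega> \<inter> ball z r = {x \<in> ball z r. x \<bullet> e > g (x - (x \<bullet> e) *\<^sub>R e)})"

definition bounded_lipschitz_domain :: "(real ^ 'n) set \<Rightarrow> bool" where
  "bounded_lipschitz_domain \<Omega> \<longleftrightarrow>
    \<Omega> \<noteq> {} \<and> open \<Omega> \<and> connected \<Omega> \<and> bounded \<Omega> \<and> lipschitz_boundary \<Omega>"

definition log_holder_on :: "(real ^ 'n) set \<Rightarrow> (real ^ 'n \<Rightarrow> real) \<Rightarrow> bool" where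
  "log_holder_on S p \<longleftrightarrow>
    (\<exists>C>0. \<forall>x\<in>S. \<forall>y\<in>S. x \<noteq> y \<longrightarrow> \<bar>p x - p y\<bar> \<le> C / ln (exp 1 + 1 / dist x y))"

text \<open>The points \<open>a\<close> and \<open>b\<close> are those where the minimum $p^-$ and the maximum $p^+$ are attained.\<close>

definition admissible_exponent :: "(real ^ 'n) set \<Rightarrow> (real ^ 'n \<Rightarrow> real) \<Rightarrow> bool" where
  "admissible_exponent \<Omega> p \<longleftrightarrow>
    (\<exists>a\<in>closure \<Omega>. \<exists>b\<in>closure \<Omega>. 1 < p a \<and> (\<forall>x\<in>closure \<Omega>. p a \<le> p x \<and> p x \<le> p b)) \<and>
    log_holder_on (closure \<Omega>) p"

definition essentially_bounded :: "(real ^ 'n) set \<Rightarrow> (real ^ 'n \<Rightarrow> real) \<Rightarrow> bool" where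
  "essentially_bounded \<Omega> h \<longleftrightarrow>
    h \<in> borel_measurable (lebesgue_on \<Omega>) \<and> (\<exists>C. AE x in lebesgue_on \<Omega>. \<bar>h x\<bar> \<le> C)"

subsection \<open>Variable exponent Lebesgue spaces\<close>

definition modular :: "(real ^ 'n) set \<Rightarrow> (real ^ 'n \<Rightarrow> real) \<Rightarrow> (real ^ 'n \<Rightarrow> real) \<Rightarrow> ennreal" where
  "modular \<Omega> p u = (\<integral>\<^sup>+ x. ennreal (\<bar>u x\<bar> powr p x) \<partial>lebesgue_on \<Omega>)"

definition Lp_var :: "(real ^ 'n) set \<Rightarrow> (real ^ 'n \<Rightarrow> real) \<Rightarrow> (real ^ 'n \<Rightarrow> real) set" where
  "Lp_var \<Omega> p = {u \<in> borel_measurable (lebesgue_on \<Omega>). modular \<Omega> p u < \<infinity>}"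

definition luxemburg_norm :: "(real ^ 'n) set \<Rightarrow> (real ^ 'n \<Rightarrow> real) \<Rightarrow> (real ^ 'n \<Rightarrow> real) \<Rightarrow> real" where
  "luxemburg_norm \<Omega> p u = Inf {\<tau>. \<tau> > 0 \<and> modular \<Omega> p (\<lambda>x. u x / \<tau>) \<le> 1}"

subsection \<open>Test functions and weak gradients\<close>

definition partial_deriv :: "'n \<Rightarrow> (real ^ 'n \<Rightarrow> real) \<Rightarrow> real ^ 'n \<Rightarrow> real" where
  "partial_deriv i f x = frechet_derivative f (at x) (axis i 1)"

primrec C_k :: "nat \<Rightarrow> (real ^ 'n \<Rightarrow> real) \<Rightarrow> bool" where
  "C_k 0 f \<longleftrightarrow> continuous_on UNIV f"
| "C_k (Suc k) f \<longleftrightarrow> f differentiable_on UNIV \<and> (\<forall>i. C_k k (partial_deriv i f))"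

text \<open>$C_0^\infty(\Omega)$, with its elements extended by zero outside \<open>\<Omega>\<close>.\<close>

definition test_functions :: "(real ^ 'n) set \<Rightarrow> (real ^ 'n \<Rightarrow> real) set" where
  "test_functions \<Omega> =
    {\<phi>. (\<forall>k. C_k k \<phi>) \<and> compact (closure {x. \<phi> x \<noteq> 0}) \<and> closure {x. \<phi> x \<noteq> 0} \<subseteq> \<Omega>}"

definition locally_integrable ::
    "(real ^ 'n) set \<Rightarrow> (real ^ 'n \<Rightarrow> 'b::{banach, second_countable_topology}) \<Rightarrow> bool" where
  "locally_integrable \<Omega> f \<longleftrightarrow>
    f \<in> borel_measurable (lebesgue_on \<Omega>) \<and>
    (\<forall>K. compact K \<and> K \<subseteq> \<Omega> \<longrightarrow> set_integrable lebesgue K f)"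

definition has_weak_gradient ::
    "(real ^ 'n) set \<Rightarrow> (real ^ 'n \<Rightarrow> real) \<Rightarrow> (real ^ 'n \<Rightarrow> real ^ 'n) \<Rightarrow> bool" where
  "has_weak_gradient \<Omega> u g \<longleftrightarrow>
    locally_integrable \<Omega> u \<and> locally_integrable \<Omega> g \<and>
    (\<forall>\<phi>\<in>test_functions \<Omega>. \<forall>i.
       (LINT x|lebesgue_on \<Omega>. u x * partial_deriv i \<phi> x) = - (LINT x|lebesgue_on \<Omega>. g x $ i * \<phi> x))"

text \<open>A representative of the weak gradient, which is unique up to null sets when it exists.\<close>

definition weak_gradient :: "(real ^ 'n) set \<Rightarrow> (real ^ 'n \<Rightarrow> real) \<Rightarrow> real ^ 'n \<Rightarrow> real ^ 'n" where
  "weak_gradient \<Omega> u = (SOME g. has_weak_gradient \<Omega> u g)"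

subsection \<open>Variable exponent Sobolev spaces\<close>

definition W1p_var :: "(real ^ 'n) set \<Rightarrow> (real ^ 'n \<Rightarrow> real) \<Rightarrow> (real ^ 'n \<Rightarrow> real) set" where
  "W1p_var \<Omega> p =
    {u \<in> Lp_var \<Omega> p. (\<exists>g. has_weak_gradient \<Omega> u g) \<and> (\<lambda>x. norm (weak_gradient \<Omega> u x)) \<in> Lp_var \<Omega> p}"

definition W1p_norm :: "(real ^ 'n) set \<Rightarrow> (real ^ 'n \<Rightarrow> real) \<Rightarrow> (real ^ 'n \<Rightarrow> real) \<Rightarrow> real" where
  "W1p_norm \<Omega> p u =
    luxemburg_norm \<Omega> p u + luxemburg_norm \<Omega> p (\<lambda>x. norm (weak_gradient \<Omega> u x))"

definition W1p0_var :: "(real ^ 'n) set \<Rightarrow> (real ^ 'n \<Rightarrow> real) \<Rightarrow> (real ^ 'n \<Rightarrow> real) set" where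
  "W1p0_var \<Omega> p =
    {u \<in> W1p_var \<Omega> p. \<forall>\<eta>>0. \<exists>\<phi>\<in>test_functions \<Omega>. W1p_norm \<Omega> p (\<lambda>x. u x - \<phi> x) < \<eta>}"

definition W1p0_nonneg :: "(real ^ 'n) set \<Rightarrow> (real ^ 'n \<Rightarrow> real) \<Rightarrow> (real ^ 'n \<Rightarrow> real) set" where
  "W1p0_nonneg \<Omega> p = {u \<in> W1p0_var \<Omega> p. AE x in lebesgue_on \<Omega>. 0 \<le> u x}"

subsection \<open>The functionals\<close>

definition Phi :: "(real ^ 'n \<Rightarrow> real) \<Rightarrow> real \<Rightarrow> real ^ 'n \<Rightarrow> real ^ 'n \<Rightarrow> real" where
  "Phi p \<epsilon> x \<xi> = ((\<epsilon>\<^sup>2 + (norm \<xi>)\<^sup>2) powr (p x / 2) - \<epsilon> powr p x) / p x"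

definition E_func :: "(real ^ 'n) set \<Rightarrow> (real ^ 'n \<Rightarrow> real) \<Rightarrow> real \<Rightarrow> (real ^ 'n \<Rightarrow> real) \<Rightarrow> real" where
  "E_func \<Omega> p \<epsilon> u = (LINT x|lebesgue_on \<Omega>. Phi p \<epsilon> x (weak_gradient \<Omega> u x))"

definition J_func :: "(real ^ 'n) set \<Rightarrow> (real ^ 'n \<Rightarrow> real) \<Rightarrow> (real ^ 'n \<Rightarrow> real) \<Rightarrow> real" where
  "J_func \<Omega> p u = (LINT x|lebesgue_on \<Omega>. \<bar>u x\<bar> powr p x / p x)"

definition M_plus :: "(real ^ 'n) set \<Rightarrow> (real ^ 'n \<Rightarrow> real) \<Rightarrow> real \<Rightarrow> (real ^ 'n \<Rightarrow> real) set" where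
  "M_plus \<Omega> p m = {u \<in> W1p0_nonneg \<Omega> p. J_func \<Omega> p u = m}"

definition G_reg :: "(real ^ 'n \<Rightarrow> real) \<Rightarrow> real \<Rightarrow> real ^ 'n \<Rightarrow> real \<Rightarrow> real" where
  "G_reg \<gamma> \<delta> x s = ((s + \<delta>) powr (1 - \<gamma> x) - \<delta> powr (1 - \<gamma> x)) / (1 - \<gamma> x)"

definition I_func :: "(real ^ 'n) set \<Rightarrow> (real ^ 'n \<Rightarrow> real) \<Rightarrow> (real ^ 'n \<Rightarrow> real) \<Rightarrow> (real ^ 'n \<Rightarrow> real) \<Rightarrow>
    real \<Rightarrow> real \<Rightarrow> real \<Rightarrow> (real ^ 'n \<Rightarrow> real) \<Rightarrow> real" where
  "I_func \<Omega> p h \<gamma> \<epsilon> \<mu> \<delta> u =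
    E_func \<Omega> p \<epsilon> u - \<mu> * (LINT x|lebesgue_on \<Omega>. h x * G_reg \<gamma> \<delta> x (u x))"

end

theory Submission
  imports Defs "HOL-Complex_Analysis.Great_Picard"
begin

text \<open>
The proof is the direct method of the calculus of variations.  Along a minimizing sequence the
constraint bounds the modular of the functions, hence their \<open>L\<^sup>1\<close> norms, hence the singular term, which
is Lipschitz because of the shift by \<open>\<delta>\<close>; so the energies are bounded.  A subsequence then converges
strongly in the modular, so that the sign condition, the constraint and the singular term pass to the
limit, and the energy is lower semicontinuous along it.

Everything is expressed through one functional, the modular \<open>rho\<close> with weight \<open>1 / p\<close>, for maps into an
arbitrary Euclidean space: \<open>J_func\<close> is \<open>rho\<close> of the function, and \<open>E_func\<close> is, up to a constant, \<open>rho\<close> of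
the gradient paired with the constant \<open>\<epsilon>\<close>.  The zero trace Sobolev space is handled through pairs
\<open>(u, g)\<close> that are modular limits of pairs \<open>(\<phi>, grad \<phi>)\<close> of test functions (\<open>sobolev_zero\<close>).  Since the
exponent is bounded, modular convergence is the same as convergence in the Luxemburg norm, and since
weak gradients are unique, these pairs are exactly the members of the space with their weak gradients
(\<open>W1p0_var_sobolev_zero\<close>, \<open>sobolev_zero_W1p0_var\<close>).

Strong convergence (\<open>test_function_compactness\<close>) has two ingredients.  Rellich's theorem in \<open>L\<^sup>1\<close> comes
from ball means.  To pass from \<open>L\<^sup>1\<close> to the modular, a slightly higher power of the functions must stay
bounded in mean: for a smooth exponent \<open>q\<close> slightly below \<open>p\<close> the function
\<open>(1 + \<phi>\<^sup>2) powr (q / 2) - 1\<close> is bounded in \<open>W\<^sup>1\<^sup>,\<^sup>1\<close>, and functions that are bounded there have a small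
gain of integrability which exceeds the loss from \<open>p\<close> to \<open>q\<close>.

Lower semicontinuity (\<open>rho_convex_lsc\<close>) needs neither weak convergence nor reflexivity.  The powers of
the norm are uniformly convex, uniformly in the exponent.  So near-minimizers of the energy among the
test functions that are close to the limit \<open>u\<close> have strongly convergent gradients, and the limit of
those is the gradient of \<open>u\<close>.
\<close>

section \<open>Uniform convexity of powers of the norm\<close>

lemma powr_convex_combination:
  fixes a b l q :: real
  assumes "0 \<le> a" "0 \<le> b" "0 \<le> l" "l \<le> 1" "1 \<le> q"
  shows "((1 - l) * a + l * b) powr q \<le> (1 - l) * a powr q + l * b powr q"
proof -
  have scale: "(s * c) powr q \<le> s * c powr q" if "0 \<le> s" "s \<le> 1" "0 \<le> c" for s c :: real
  proof -
    have "s powr q \<le> s powr 1" using that assms by (intro powr_mono') auto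
    then show ?thesis using that by (simp add: powr_mult mult_right_mono)
  qed
  consider "a = 0" | "b = 0" | "a > 0" "b > 0" using assms by linarith
  then show ?thesis
  proof cases
    case 1 then show ?thesis using scale[of l b] assms by simp
  next
    case 2 then show ?thesis using scale[of "1 - l" a] assms by simp
  next
    case 3
    then show ?thesis
      using convex_onD[OF powr_convex[OF \<open>1 \<le> q\<close>], of l a b] assms by simp
  qed
qed

text \<open>The mean value theorem on the two halves of the interval: the derivative of the power is strictly
  increasing.\<close>

lemma powr_midpoint_strict:
  fixes a b q :: real
  assumes "0 \<le> a" "a < b" "1 < q"
  shows "((a + b) / 2) powr q < (a powr q + b powr q) / 2"
proof -
  define c where "c = (a + b) / 2"
  have c: "a < c" "c < b" "c - a = b - c" using assms by (auto simp: c_def field_simps)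
  have slope: "\<exists>z. x < z \<and> z < y \<and> y powr q - x powr q = (y - x) * (q * z powr (q - 1))"
    if "0 \<le> x" "x < y" for x y :: real
  proof -
    have d: "((\<lambda>t. t powr q) has_real_derivative q * z powr (q - 1)) (at z)"
      if "x < z" for z using that \<open>0 \<le> x\<close> by (intro has_real_derivative_powr) auto
    have "\<exists>l z. x < z \<and> z < y \<and> ((\<lambda>t. t powr q) has_real_derivative l) (at z)
        \<and> y powr q - x powr q = (y - x) * l"
    proof (rule MVT[OF \<open>x < y\<close>])
      show "continuous_on {x..y} (\<lambda>t. t powr q)"
        using that assms by (intro continuous_on_powr') (auto intro: continuous_intros)
      show "(\<lambda>t. t powr q) differentiable (at z)" if "x < z" "z < y" for z
        using d[OF that(1)] real_differentiable_def by blast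
    qed
    then show ?thesis using d DERIV_unique by blast
  qed
  obtain z1 where z1: "a < z1" "z1 < c" "c powr q - a powr q = (c - a) * (q * z1 powr (q - 1))"
    using slope[of a c] assms c by auto
  obtain z2 where z2: "c < z2" "z2 < b" "b powr q - c powr q = (b - c) * (q * z2 powr (q - 1))"
    using slope[of c b] assms c by auto
  have "z1 powr (q - 1) < z2 powr (q - 1)"
    using z1 z2 assms by (intro powr_less_mono2) auto
  then have "(c - a) * (q * z1 powr (q - 1)) < (c - a) * (q * z2 powr (q - 1))"
    using assms c by auto
  then have "c powr q - a powr q < b powr q - c powr q" using z1 z2 c(3) by simp
  then show ?thesis by (simp add: c_def)
qed

lemma powr_norm_midpoint:
  fixes a b :: "'b::real_normed_vector"
  assumes "1 \<le> q"
  shows "norm ((1/2) *\<^sub>R (a + b)) powr q \<le> (norm a powr q + norm b powr q) / 2"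
proof -
  have "norm ((1/2) *\<^sub>R (a + b)) \<le> (1 - 1/2) * norm a + 1/2 * norm b"
    using norm_triangle_ineq[of a b] unfolding norm_scaleR by simp
  then have "norm ((1/2) *\<^sub>R (a + b)) powr q \<le> ((1 - 1/2) * norm a + 1/2 * norm b) powr q"
    using assms by (intro powr_mono2) auto
  also have "\<dots> \<le> (1 - 1/2) * norm a powr q + 1/2 * norm b powr q"
    using assms by (intro powr_convex_combination) auto
  finally show ?thesis by (simp add: field_simps)
qed

text \<open>If the norms differ, strict convexity of the power applies.  If they agree, equality in the
  triangle inequality would force \<open>a = b\<close>.\<close>

lemma powr_norm_midpoint_strict:
  fixes a b :: "'b::real_inner"
  assumes "1 < q" "a \<noteq> b"
  shows "norm ((1/2) *\<^sub>R (a + b)) powr q < (norm a powr q + norm b powr q) / 2"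
proof (cases "norm a = norm b")
  case True
  have "norm (a + b) \<noteq> norm a + norm b"
  proof
    assume "norm (a + b) = norm a + norm b"
    then have "norm a *\<^sub>R b = norm b *\<^sub>R a" by (simp add: norm_triangle_eq)
    then show False using True assms(2) by (cases "a = 0") auto
  qed
  then have "norm ((1/2) *\<^sub>R (a + b)) < norm a"
    using norm_triangle_ineq[of a b] True by simp
  then have "norm ((1/2) *\<^sub>R (a + b)) powr q < norm a powr q"
    using assms by (intro powr_less_mono2) auto
  then show ?thesis using True by simp
next
  case False
  have "norm ((1/2) *\<^sub>R (a + b)) \<le> (norm a + norm b) / 2"
    using norm_triangle_ineq[of a b] by simp
  then have "norm ((1/2) *\<^sub>R (a + b)) powr q \<le> ((norm a + norm b) / 2) powr q"
    using assms by (intro powr_mono2) auto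
  also have "\<dots> < (norm a powr q + norm b powr q) / 2"
    using powr_midpoint_strict[of "norm a" "norm b" q] powr_midpoint_strict[of "norm b" "norm a" q]
      False assms by (cases "norm a < norm b") (auto simp: add.commute)
  finally show ?thesis .
qed

text \<open>Convexity, applied to \<open>a\<close> as a combination of \<open>b / (1 - l)\<close> and \<open>(a - b) / l\<close>.  For \<open>l = 1/2\<close> this is a
  quasi-triangle inequality; as \<open>l\<close> tends to zero the factor of the first term tends to one, which
  gives continuity of the modular.\<close>

lemma powr_norm_split:
  fixes a b :: "'b::real_normed_vector"
  assumes "0 < l" "l < 1" "1 \<le> q" "q \<le> r"
  shows "norm a powr q \<le> (1 - l) powr (1 - r) * norm b powr q + l powr (1 - r) * norm (a - b) powr q"
proof -
  have scale: "s * (x / s) powr q \<le> s powr (1 - r) * x powr q" if "0 < s" "s < 1" "0 \<le> x" for s x :: real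
  proof -
    have "s * (x / s) powr q = s powr (1 - q) * x powr q"
      using that by (simp add: powr_divide powr_diff)
    also have "\<dots> \<le> s powr (1 - r) * x powr q"
      using that assms by (intro mult_right_mono powr_mono') auto
    finally show ?thesis .
  qed
  have "norm a \<le> norm b + norm (a - b)" by (metis norm_triangle_sub add.commute)
  then have "norm a powr q \<le> ((1 - l) * (norm b / (1 - l)) + l * (norm (a - b) / l)) powr q"
    using assms by (intro powr_mono2) auto
  also have "\<dots> \<le> (1 - l) * (norm b / (1 - l)) powr q + l * (norm (a - b) / l) powr q"
    using assms by (intro powr_convex_combination) auto
  also have "\<dots> \<le> (1 - l) powr (1 - r) * norm b powr q + l powr (1 - r) * norm (a - b) powr q"
    using assms by (intro add_mono scale) auto
  finally show ?thesis .
qed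

text \<open>Uniform convexity of all the powers at once: by homogeneity it suffices to look at pairs on
  a unit sphere, and where the pair is separated, strict convexity and compactness bound the
  convexity defect from below, uniformly in the exponent.\<close>

lemma powr_norm_uniformly_convex:
  fixes \<eta> q0 q1 :: real
  assumes "0 < \<eta>" "1 < q0"
  shows "\<exists>K\<ge>0. \<forall>q\<in>{q0..q1}. \<forall>a b :: 'b::euclidean_space.
    norm (a - b) powr q \<le> \<eta> * (norm a powr q + norm b powr q)
      + K * ((norm a powr q + norm b powr q) / 2 - norm ((1/2) *\<^sub>R (a + b)) powr q)"
proof -
  define gap where "gap = (\<lambda>(q, a, b::'b). (norm a powr q + norm b powr q) / 2 - norm ((1/2) *\<^sub>R (a + b)) powr q)"
  define far where "far = (\<lambda>(q, a, b::'b). norm (a - b) powr q - \<eta> * (norm a powr q + norm b powr q))"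
  define S where "S = {q0..q1} \<times> sphere (0::'b \<times> 'b) 1"
  \<comment> \<open>outside \<open>T\<close> the claim holds already without the convexity defect\<close>
  define T where "T = {z \<in> S. 0 \<le> far z}"
  have "compact S" unfolding S_def by (intro compact_Times) auto
  have cont: "continuous_on S (\<lambda>z. norm (f z) powr fst z)"
    if "continuous_on S f" for f :: "real \<times> 'b \<times> 'b \<Rightarrow> 'b"
    using that assms by (intro continuous_on_powr') (auto simp: S_def intro!: continuous_intros)
  have contS: "continuous_on S (\<lambda>z. norm (fst (snd z)) powr fst z)"
     "continuous_on S (\<lambda>z. norm (snd (snd z)) powr fst z)"
     "continuous_on S (\<lambda>z. norm (fst (snd z) - snd (snd z)) powr fst z)"
     "continuous_on S (\<lambda>z. norm ((1/2) *\<^sub>R (fst (snd z) + snd (snd z))) powr fst z)"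
    by (intro cont continuous_intros)+
  have cgap: "continuous_on S gap" and cfar: "continuous_on S far"
    unfolding gap_def far_def case_prod_beta by (intro continuous_intros contS; simp)+
  have "closed {z \<in> S. far z \<in> {0..}}"
    using continuous_closed_preimage[OF cfar compact_imp_closed[OF \<open>compact S\<close>], of "{0..}"]
    by (simp add: vimage_def Int_def)
  then have "compact T"
    using compact_Int_closed[OF \<open>compact S\<close>, of T] unfolding T_def by (simp add: Int_def)
  have gap_pos: "0 < gap z" if "z \<in> T" for z
  proof -
    obtain q a b where z: "z = (q, a, b)" by (cases z)
    have q: "1 < q" and ab: "norm (a, b) = 1" using that assms by (auto simp: T_def S_def z)
    have "a \<noteq> b"
    proof
      assume "a = b"
      then have "\<eta> * norm a powr q \<le> 0" using that q by (auto simp: T_def z far_def)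
      then have "norm a powr q \<le> 0" using \<open>0 < \<eta>\<close> by (simp add: mult_le_0_iff)
      then have "a = 0" using powr_gt_zero[of "norm a" q] by auto
      then show False using ab \<open>a = b\<close> by (auto simp: norm_Pair)
    qed
    then show ?thesis using powr_norm_midpoint_strict[OF q] by (auto simp: gap_def z)
  qed
  obtain d where d: "0 < d" "\<And>z. z \<in> T \<Longrightarrow> d \<le> gap z"
  proof (cases "T = {}")
    case True then show ?thesis using that[of 1] by auto
  next
    case False
    have "continuous_on T gap" using cgap by (rule continuous_on_subset) (auto simp: T_def)
    then obtain z where "z \<in> T" "\<And>y. y \<in> T \<Longrightarrow> gap z \<le> gap y"
      using continuous_attains_inf[OF \<open>compact T\<close> False] by blast
    then show ?thesis using that[of "gap z"] gap_pos by auto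
  qed
  define K where "K = 2 powr q1 / d"
  have unit: "far z \<le> K * gap z" if "z \<in> S" for z
  proof (cases "z \<in> T")
    case True
    obtain q a b where z: "z = (q, a, b)" by (cases z)
    have q: "q0 \<le> q" "q \<le> q1" and ab: "norm (a, b) = 1" using that by (auto simp: S_def z)
    have "norm a \<le> 1" "norm b \<le> 1" using ab by (metis norm_fst_le norm_snd_le)+
    then have "norm (a - b) \<le> 2" using norm_triangle_ineq4[of a b] by linarith
    then have "norm (a - b) powr q \<le> 2 powr q" using assms q by (intro powr_mono2) auto
    also have "\<dots> \<le> 2 powr q1" using q by (intro powr_mono) auto
    also have "\<dots> = K * d" using d by (simp add: K_def)
    also have "\<dots> \<le> K * gap z" using d(2)[OF True] d(1) by (intro mult_left_mono) (auto simp: K_def)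
    finally show ?thesis using \<open>0 < \<eta>\<close> by (auto simp: far_def z intro: order_trans[rotated])
  next
    case False
    obtain q a b where z: "z = (q, a, b)" by (cases z)
    have "0 \<le> gap z" using powr_norm_midpoint[of q a b] that assms by (auto simp: gap_def z S_def)
    then have "0 \<le> K * gap z" using d by (auto simp: K_def)
    moreover have "far z < 0" using False that by (auto simp: T_def)
    ultimately show ?thesis by linarith
  qed
  show ?thesis
  proof (intro exI[of _ K] conjI ballI allI)
    show "0 \<le> K" using d by (simp add: K_def)
    fix q and a b :: 'b assume q: "q \<in> {q0..q1}"
    define t where "t = norm (a, b)"
    show "norm (a - b) powr q \<le> \<eta> * (norm a powr q + norm b powr q)
      + K * ((norm a powr q + norm b powr q) / 2 - norm ((1/2) *\<^sub>R (a + b)) powr q)"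
    proof (cases "t = 0")
      case True
      then show ?thesis using q assms by (auto simp: t_def norm_Pair)
    next
      case False
      then have t: "0 < t" by (simp add: t_def)
      define a' b' where "a' = (1/t) *\<^sub>R a" and "b' = (1/t) *\<^sub>R b"
      have ab: "a = t *\<^sub>R a'" "b = t *\<^sub>R b'" using t by (auto simp: a'_def b'_def)
      have "norm (a', b') = 1"
        using t norm_scaleR[of "1/t" "(a, b)"] by (simp add: a'_def b'_def scaleR_Pair t_def)
      then have "(q, a', b') \<in> S" using q by (auto simp: S_def)
      from unit[OF this] have *: "far (q, a', b') \<le> K * gap (q, a', b')" .
      have eqs: "norm (a - b) powr q = t powr q * norm (a' - b') powr q"
        "norm a powr q = t powr q * norm a' powr q" "norm b powr q = t powr q * norm b' powr q"
        "norm ((1/2) *\<^sub>R (a + b)) powr q = t powr q * norm ((1/2) *\<^sub>R (a' + b')) powr q"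
        using t by (simp_all add: ab flip: scaleR_diff_right scaleR_add_right powr_mult)
      have "t powr q * (\<eta> * (norm a' powr q + norm b' powr q) + K * gap (q, a', b'))
        = \<eta> * (norm a powr q + norm b powr q)
          + K * ((norm a powr q + norm b powr q) / 2 - norm ((1/2) *\<^sub>R (a + b)) powr q)"
        unfolding eqs gap_def prod.case by (simp add: field_simps)
      moreover have "t powr q * norm (a' - b') powr q
          \<le> t powr q * (\<eta> * (norm a' powr q + norm b' powr q) + K * gap (q, a', b'))"
        using * by (intro mult_left_mono) (auto simp: far_def)
      ultimately show ?thesis unfolding eqs(1) by simp
    qed
  qed
qed

section \<open>The modular of a variable exponent\<close>

locale variable_exponent = finite_measure M for M :: "'a measure" +
  fixes p :: "'a \<Rightarrow> real" and pmin pmax :: real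
  assumes exponent_measurable [measurable]: "p \<in> borel_measurable M"
    and pmin_gt_1: "1 < pmin"
    and exponent_bounds: "x \<in> space M \<Longrightarrow> pmin \<le> p x \<and> p x \<le> pmax"
begin

lemma exponent_gt_1: "x \<in> space M \<Longrightarrow> 1 < p x"
  using exponent_bounds pmin_gt_1 by fastforce

lemma exponent_pos: "x \<in> space M \<Longrightarrow> 0 < p x"
  using exponent_gt_1 by fastforce

text \<open>The weight \<open>1 / p\<close> is the one that occurs in both functionals of the minimization problem.\<close>

definition rho :: "('a \<Rightarrow> 'b::euclidean_space) \<Rightarrow> ennreal" where
  "rho f = (\<integral>\<^sup>+ x. ennreal (norm (f x) powr p x / p x) \<partial>M)"

lemma rho_cong_AE: "AE x in M. norm (f x) = norm (g x) \<Longrightarrow> rho f = rho g"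
  unfolding rho_def by (intro nn_integral_cong_AE) auto

lemma rho_mono_AE:
  assumes "AE x in M. norm (f x) \<le> norm (g x)"
  shows "rho f \<le> rho g"
  unfolding rho_def
proof (rule nn_integral_mono_AE)
  show "AE x in M. ennreal (norm (f x) powr p x / p x) \<le> ennreal (norm (g x) powr p x / p x)"
    using assms AE_space
  proof eventually_elim
    case (elim x)
    then show ?case using exponent_pos[of x]
      by (intro ennreal_leI divide_right_mono powr_mono2) auto
  qed
qed

lemma rho_minus_commute: "rho (\<lambda>x. f x - g x) = rho (\<lambda>x. g x - f x)"
  by (intro rho_cong_AE) (simp add: norm_minus_commute)

lemma rho_split:
  assumes [measurable]: "f \<in> borel_measurable M" "g \<in> borel_measurable M" and "0 < l" "l < 1"
  shows "rho f \<le> ennreal ((1 - l) powr (1 - pmax)) * rho g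
      + ennreal (l powr (1 - pmax)) * rho (\<lambda>x. f x - g x)"
proof -
  define A B where "A = (1 - l) powr (1 - pmax)" and "B = l powr (1 - pmax)"
  have AB: "0 \<le> A" "0 \<le> B" by (auto simp: A_def B_def)
  have "rho f \<le> (\<integral>\<^sup>+ x. ennreal A * ennreal (norm (g x) powr p x / p x)
      + ennreal B * ennreal (norm (f x - g x) powr p x / p x) \<partial>M)"
    unfolding rho_def
  proof (rule nn_integral_mono)
    fix x assume x: "x \<in> space M"
    have "norm (f x) powr p x \<le> A * norm (g x) powr p x + B * norm (f x - g x) powr p x"
      unfolding A_def B_def using assms exponent_gt_1[OF x] exponent_bounds[OF x]
      by (intro powr_norm_split) auto
    then have "norm (f x) powr p x / p x
        \<le> A * (norm (g x) powr p x / p x) + B * (norm (f x - g x) powr p x / p x)"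
      using exponent_pos[OF x] by (simp add: field_simps)
    then show "ennreal (norm (f x) powr p x / p x) \<le> ennreal A * ennreal (norm (g x) powr p x / p x)
      + ennreal B * ennreal (norm (f x - g x) powr p x / p x)"
      using AB exponent_pos[OF x] by (simp add: ennreal_leI flip: ennreal_mult ennreal_plus)
  qed
  also have "\<dots> = ennreal A * rho g + ennreal B * rho (\<lambda>x. f x - g x)"
    unfolding rho_def by (simp add: nn_integral_add nn_integral_cmult)
  finally show ?thesis by (simp add: A_def B_def)
qed

lemma rho_triangle:
  assumes [measurable]: "f \<in> borel_measurable M" "g \<in> borel_measurable M" "h \<in> borel_measurable M"
  shows "rho (\<lambda>x. f x - h x)
    \<le> ennreal (2 powr (pmax - 1)) * (rho (\<lambda>x. f x - g x) + rho (\<lambda>x. g x - h x))"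
proof -
  have "(1/2) powr (1 - pmax) = (2::real) powr (pmax - 1)"
    by (simp add: powr_divide powr_diff)
  then show ?thesis
    using rho_split[of "\<lambda>x. f x - h x" "\<lambda>x. g x - h x" "1/2"]
    by (simp add: distrib_left add.commute)
qed

lemma rho_midpoint_le:
  assumes [measurable]: "f \<in> borel_measurable M" "g \<in> borel_measurable M"
  shows "rho (\<lambda>x. (1/2) *\<^sub>R (f x + g x)) \<le> ennreal (1/2) * (rho f + rho g)"
proof -
  have "rho (\<lambda>x. (1/2) *\<^sub>R (f x + g x)) \<le> (\<integral>\<^sup>+ x. ennreal (1/2) *
      (ennreal (norm (f x) powr p x / p x) + ennreal (norm (g x) powr p x / p x)) \<partial>M)"
    unfolding rho_def
  proof (rule nn_integral_mono)
    fix x assume x: "x \<in> space M"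
    have "norm ((1/2) *\<^sub>R (f x + g x)) powr p x \<le> (norm (f x) powr p x + norm (g x) powr p x) / 2"
      using exponent_gt_1[OF x] by (intro powr_norm_midpoint) auto
    then have "norm ((1/2) *\<^sub>R (f x + g x)) powr p x / p x
        \<le> (norm (f x) powr p x + norm (g x) powr p x) / 2 / p x"
      using exponent_pos[OF x] by (intro divide_right_mono) auto
    also have "\<dots> = 1/2 * (norm (f x) powr p x / p x + norm (g x) powr p x / p x)"
      by (simp add: add_divide_distrib)
    finally have "ennreal (norm ((1/2) *\<^sub>R (f x + g x)) powr p x / p x)
        \<le> ennreal (1/2 * (norm (f x) powr p x / p x + norm (g x) powr p x / p x))"
      by (rule ennreal_leI)
    also have "\<dots> = ennreal (1/2) *
      (ennreal (norm (f x) powr p x / p x) + ennreal (norm (g x) powr p x / p x))"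
      using exponent_pos[OF x] by (subst ennreal_mult) auto
    finally show "ennreal (norm ((1/2) *\<^sub>R (f x + g x)) powr p x / p x) \<le> ennreal (1/2) *
      (ennreal (norm (f x) powr p x / p x) + ennreal (norm (g x) powr p x / p x))" .
  qed
  also have "\<dots> = ennreal (1/2) * (rho f + rho g)"
    unfolding rho_def by (simp add: nn_integral_add nn_integral_cmult)
  finally show ?thesis .
qed

text \<open>A lower bound \<open>c\<close> stands in for the modular of the midpoint, because in the application only a
  bound by an infimum is known.\<close>

lemma rho_uniformly_convex:
  assumes "0 < \<eta>"
  shows "\<exists>K\<ge>0. \<forall>f g :: 'a \<Rightarrow> 'b::euclidean_space. \<forall>a\<ge>0. \<forall>b\<ge>0. \<forall>c\<ge>0.
    f \<in> borel_measurable M \<longrightarrow> g \<in> borel_measurable M \<longrightarrow>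
    rho f = ennreal a \<longrightarrow> rho g = ennreal b \<longrightarrow> ennreal c \<le> rho (\<lambda>x. (1/2) *\<^sub>R (f x + g x)) \<longrightarrow>
    rho (\<lambda>x. f x - g x) \<le> ennreal (\<eta> * (a + b) + K * ((a + b) / 2 - c))"
proof -
  obtain K where K: "0 \<le> K" "\<And>q a b. q \<in> {pmin..pmax} \<Longrightarrow>
    norm (a - b :: 'b) powr q \<le> \<eta> * (norm a powr q + norm b powr q)
      + K * ((norm a powr q + norm b powr q) / 2 - norm ((1/2) *\<^sub>R (a + b)) powr q)"
    using powr_norm_uniformly_convex[OF assms pmin_gt_1, of pmax, where 'b = 'b] by blast
  have "rho (\<lambda>x. f x - g x) \<le> ennreal (\<eta> * (a + b) + K * ((a + b) / 2 - c))"
    if "0 \<le> a" "0 \<le> b" "0 \<le> c" and [measurable]: "f \<in> borel_measurable M" "g \<in> borel_measurable M"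
      and f: "rho f = ennreal a" and g: "rho g = ennreal b"
      and c: "ennreal c \<le> rho (\<lambda>x. (1/2) *\<^sub>R (f x + g x))"
    for f g :: "'a \<Rightarrow> 'b" and a b c
  proof -
    define F G H D where "F = (\<lambda>x. norm (f x) powr p x / p x)" and "G = (\<lambda>x. norm (g x) powr p x / p x)"
      and "H = (\<lambda>x. norm ((1/2) *\<^sub>R (f x + g x)) powr p x / p x)"
      and "D = (\<lambda>x. norm (f x - g x) powr p x / p x)"
    have [measurable]: "F \<in> borel_measurable M" "G \<in> borel_measurable M" "H \<in> borel_measurable M"
       "D \<in> borel_measurable M"
      unfolding F_def G_def H_def D_def by measurable
    have rhoH: "rho (\<lambda>x. (1/2) *\<^sub>R (f x + g x)) = (\<integral>\<^sup>+ x. ennreal (H x) \<partial>M)"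
      unfolding rho_def H_def ..
    have "rho (\<lambda>x. f x - g x) + ennreal K * rho (\<lambda>x. (1/2) *\<^sub>R (f x + g x))
        = (\<integral>\<^sup>+ x. ennreal (D x) + ennreal K * ennreal (H x) \<partial>M)"
      unfolding rhoH unfolding rho_def D_def
      by (simp add: nn_integral_add nn_integral_cmult)
    also have "\<dots> \<le> (\<integral>\<^sup>+ x. ennreal (\<eta> + K/2) * (ennreal (F x) + ennreal (G x)) \<partial>M)"
    proof (rule nn_integral_mono)
      fix x assume x: "x \<in> space M"
      have nonneg: "0 \<le> F x" "0 \<le> G x" "0 \<le> H x" "0 \<le> D x"
        using exponent_pos[OF x] by (auto simp: F_def G_def H_def D_def)
      have "norm (f x - g x) powr p x + K * norm ((1/2) *\<^sub>R (f x + g x)) powr p x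
          \<le> (\<eta> + K/2) * (norm (f x) powr p x + norm (g x) powr p x)"
        using K(2)[of "p x" "f x" "g x"] exponent_bounds[OF x] by (simp add: field_simps)
      then have "(norm (f x - g x) powr p x + K * norm ((1/2) *\<^sub>R (f x + g x)) powr p x) / p x
          \<le> (\<eta> + K/2) * (norm (f x) powr p x + norm (g x) powr p x) / p x"
        using exponent_pos[OF x] by (intro divide_right_mono) auto
      then have "D x + K * H x \<le> (\<eta> + K/2) * (F x + G x)"
        by (simp add: F_def G_def H_def D_def add_divide_distrib distrib_left)
      then show "ennreal (D x) + ennreal K * ennreal (H x)
          \<le> ennreal (\<eta> + K/2) * (ennreal (F x) + ennreal (G x))"
        using nonneg K(1) assms by (simp add: ennreal_leI flip: ennreal_mult ennreal_plus)
    qed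
    also have "\<dots> = ennreal (\<eta> + K/2) * (rho f + rho g)"
      unfolding rho_def F_def G_def
      by (simp add: nn_integral_add nn_integral_cmult)
    also have "\<dots> = ennreal ((\<eta> + K/2) * (a + b))"
      using that K(1) assms unfolding f g by (simp add: ennreal_mult)
    finally have le: "rho (\<lambda>x. f x - g x) + ennreal K * rho (\<lambda>x. (1/2) *\<^sub>R (f x + g x))
        \<le> ennreal ((\<eta> + K/2) * (a + b))" .
    have fin: "rho (\<lambda>x. f x - g x) < \<infinity>"
      by (rule le_less_trans[OF order_trans[OF _ le]]) auto
    obtain d where d: "0 \<le> d" "rho (\<lambda>x. f x - g x) = ennreal d"
      using fin by (cases "rho (\<lambda>x. f x - g x)") auto
    have "ennreal (d + K * c) = ennreal d + ennreal K * ennreal c"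
      using d K(1) that by (simp add: ennreal_mult)
    also have "\<dots> \<le> ennreal ((\<eta> + K/2) * (a + b))"
      using order_trans[OF add_left_mono[OF mult_left_mono[OF c]] le] d by simp
    finally have "d + K * c \<le> (\<eta> + K/2) * (a + b)"
      using that K(1) assms d by (subst (asm) ennreal_le_iff) auto
    then show ?thesis unfolding d by (intro ennreal_leI) (simp add: algebra_simps)
  qed
  then show ?thesis using K(1) by blast
qed

lemma rho_fatou:
  assumes [measurable]: "\<And>n. f n \<in> borel_measurable M" "g \<in> borel_measurable M"
    and lim: "AE x in M. (\<lambda>n. f n x) \<longlonglongrightarrow> g x"
  shows "rho g \<le> liminf (\<lambda>n. rho (f n))"
proof -
  have "rho g = (\<integral>\<^sup>+ x. liminf (\<lambda>n. ennreal (norm (f n x) powr p x / p x)) \<partial>M)"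
    unfolding rho_def
  proof (rule nn_integral_cong_AE)
    show "AE x in M. ennreal (norm (g x) powr p x / p x)
        = liminf (\<lambda>n. ennreal (norm (f n x) powr p x / p x))"
      using lim AE_space
    proof eventually_elim
      case (elim x)
      have "(\<lambda>n. ennreal (norm (f n x) powr p x / p x)) \<longlonglongrightarrow> ennreal (norm (g x) powr p x / p x)"
        using elim exponent_pos[of x] by (intro tendsto_intros tendsto_ennrealI) auto
      then show ?case by (simp add: lim_imp_Liminf)
    qed
  qed
  also have "\<dots> \<le> liminf (\<lambda>n. rho (f n))"
    unfolding rho_def by (rule nn_integral_liminf) measurable
  finally show ?thesis .
qed

lemma norm_integral_le_rho:
  assumes [measurable]: "f \<in> borel_measurable M" and "0 < \<eta>" "\<eta> \<le> 1"
  shows "(\<integral>\<^sup>+ x. ennreal (norm (f x)) \<partial>M)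
    \<le> ennreal (\<eta> * measure M (space M)) + ennreal (pmax * \<eta> powr (1 - pmax)) * rho f"
proof -
  have "(\<integral>\<^sup>+ x. ennreal (norm (f x)) \<partial>M)
      \<le> (\<integral>\<^sup>+ x. ennreal \<eta> + ennreal (pmax * \<eta> powr (1 - pmax)) * ennreal (norm (f x) powr p x / p x) \<partial>M)"
  proof (rule nn_integral_mono)
    fix x assume x: "x \<in> space M"
    note px = exponent_gt_1[OF x] exponent_bounds[OF x]
    have "norm (f x) \<le> \<eta> + pmax * \<eta> powr (1 - pmax) * (norm (f x) powr p x / p x)"
    proof (cases "norm (f x) \<le> \<eta>")
      case True
      then show ?thesis using px by (simp add: add_increasing2)
    next
      case False
      then have "norm (f x) = \<eta> * (norm (f x) / \<eta>) powr 1" using assms by simp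
      also have "\<dots> \<le> \<eta> * (norm (f x) / \<eta>) powr p x"
        using False assms px by (intro mult_left_mono powr_mono) auto
      also have "\<dots> = \<eta> powr (1 - p x) * norm (f x) powr p x"
        using assms by (simp add: powr_divide powr_diff)
      also have "\<dots> \<le> \<eta> powr (1 - pmax) * norm (f x) powr p x"
        using assms px by (intro mult_right_mono powr_mono') auto
      also have "\<dots> = \<eta> powr (1 - pmax) * (p x * (norm (f x) powr p x / p x))"
        using px by simp
      also have "\<dots> \<le> \<eta> powr (1 - pmax) * (pmax * (norm (f x) powr p x / p x))"
        using px by (intro mult_left_mono mult_right_mono) auto
      finally show ?thesis using assms by (simp add: ac_simps)
    qed
    then show "ennreal (norm (f x)) \<le> ennreal \<eta> + ennreal (pmax * \<eta> powr (1 - pmax)) * ennreal (norm (f x) powr p x / p x)"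
      using px assms by (simp add: ennreal_leI flip: ennreal_mult ennreal_plus)
  qed
  also have "\<dots> = ennreal \<eta> * emeasure M (space M) + ennreal (pmax * \<eta> powr (1 - pmax)) * rho f"
    unfolding rho_def by (simp add: nn_integral_add nn_integral_cmult)
  finally show ?thesis using assms by (simp add: emeasure_eq_measure ennreal_mult)
qed

lemma rho_finite_integrable:
  assumes "f \<in> borel_measurable M" "rho f < \<infinity>"
  shows "integrable M f"
proof (rule integrableI_bounded)
  show "(\<integral>\<^sup>+ x. ennreal (norm (f x)) \<partial>M) < \<infinity>"
    by (rule le_less_trans[OF norm_integral_le_rho[OF assms(1), of 1]])
      (use assms(2) in \<open>auto simp: ennreal_mult_less_top\<close>)
qed (fact assms)

lemma norm_integral_small:
  assumes "0 < e"
  shows "\<exists>d>0. \<forall>f :: 'a \<Rightarrow> 'b::euclidean_space. f \<in> borel_measurable M \<longrightarrow> rho f \<le> ennreal d \<longrightarrow>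
    (\<integral>\<^sup>+ x. ennreal (norm (f x)) \<partial>M) \<le> ennreal e"
proof -
  define \<mu> where "\<mu> = measure M (space M)"
  define \<eta> where "\<eta> = min 1 (e / (2 * (\<mu> + 1)))"
  have mu: "0 \<le> \<mu>" by (simp add: \<mu>_def)
  have eta: "0 < \<eta>" "\<eta> \<le> 1" using assms mu by (auto simp: \<eta>_def)
  have "\<eta> * \<mu> \<le> e / (2 * (\<mu> + 1)) * (\<mu> + 1)"
    using eta mu assms by (intro mult_mono) (auto simp: \<eta>_def)
  also have "\<dots> = e / 2" using mu by (simp add: divide_simps add_eq_0_iff)
  finally have small: "\<eta> * \<mu> \<le> e / 2" .
  define C where "C = \<bar>pmax\<bar> * \<eta> powr (1 - pmax) + 1"
  have C: "0 < C" "pmax * \<eta> powr (1 - pmax) \<le> C"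
    by (auto simp: C_def add_nonneg_pos intro: order_trans[OF mult_right_mono[OF abs_ge_self]])
  show ?thesis
  proof (intro exI[of _ "e / (2 * C)"] conjI allI impI)
    show "0 < e / (2 * C)" using assms C by simp
    fix f :: "'a \<Rightarrow> 'b" assume f: "f \<in> borel_measurable M" "rho f \<le> ennreal (e / (2 * C))"
    have "(\<integral>\<^sup>+ x. ennreal (norm (f x)) \<partial>M) \<le> ennreal (\<eta> * \<mu>) + ennreal (pmax * \<eta> powr (1 - pmax)) * rho f"
      unfolding \<mu>_def by (rule norm_integral_le_rho[OF f(1) eta])
    also have "\<dots> \<le> ennreal (e / 2) + ennreal C * ennreal (e / (2 * C))"
      using small C f by (intro add_mono mult_mono ennreal_leI) auto
    also have "\<dots> = ennreal e"
      using assms C by (simp flip: ennreal_mult ennreal_plus)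
    finally show "(\<integral>\<^sup>+ x. ennreal (norm (f x)) \<partial>M) \<le> ennreal e" .
  qed
qed

section \<open>Completeness and lower semicontinuity of the modular\<close>

text \<open>On a space of finite measure a Cauchy sequence in the modular is one in \<open>L\<^sup>1\<close>, so a subsequence
  converges almost everywhere; Fatou's lemma then turns the Cauchy estimate into convergence.\<close>

lemma rho_complete:
  fixes f :: "nat \<Rightarrow> 'a \<Rightarrow> 'b::euclidean_space"
  assumes meas [measurable]: "\<And>n. f n \<in> borel_measurable M" and fin: "\<And>n. rho (f n) < \<infinity>"
    and cauchy: "\<And>\<eta>. 0 < \<eta> \<Longrightarrow> \<exists>N. \<forall>i\<ge>N. \<forall>j\<ge>N. rho (\<lambda>x. f i x - f j x) \<le> ennreal \<eta>"
  obtains g r where "g \<in> borel_measurable M" "strict_mono (r :: nat \<Rightarrow> nat)"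
    "AE x in M. (\<lambda>n. f (r n) x) \<longlonglongrightarrow> g x" "(\<lambda>n. rho (\<lambda>x. f n x - g x)) \<longlonglongrightarrow> 0"
proof -
  have int: "integrable M (f n)" for n by (intro rho_finite_integrable meas fin)
  have L1: "\<exists>N. \<forall>i\<ge>N. \<forall>j\<ge>N. (LINT x|M. norm (f i x - f j x)) < e" if "0 < e" for e
  proof -
    obtain d where d: "0 < d" "\<And>g :: 'a \<Rightarrow> 'b. g \<in> borel_measurable M \<Longrightarrow> rho g \<le> ennreal d \<Longrightarrow>
        (\<integral>\<^sup>+ x. ennreal (norm (g x)) \<partial>M) \<le> ennreal (e / 2)"
      using norm_integral_small[of "e / 2", where 'b = 'b] \<open>0 < e\<close> by (meson half_gt_zero)
    obtain N where N: "\<And>i j. i \<ge> N \<Longrightarrow> j \<ge> N \<Longrightarrow> rho (\<lambda>x. f i x - f j x) \<le> ennreal d"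
      using cauchy[OF d(1)] by blast
    have "(LINT x|M. norm (f i x - f j x)) < e" if "i \<ge> N" "j \<ge> N" for i j
    proof -
      have "ennreal (LINT x|M. norm (f i x - f j x)) = (\<integral>\<^sup>+ x. ennreal (norm (f i x - f j x)) \<partial>M)"
        using int by (intro nn_integral_eq_integral[symmetric]) auto
      also have "\<dots> \<le> ennreal (e / 2)" using N[OF that] by (intro d(2)) auto
      finally show ?thesis using \<open>0 < e\<close> by (simp add: ennreal_le_iff)
    qed
    then show ?thesis by blast
  qed
  from cauchy_L1_AE_cauchy_subseq[OF int L1]
  obtain r where r: "strict_mono r" "AE x in M. Cauchy (\<lambda>i. f (r i) x)" by blast
  define g where "g = (\<lambda>x. lim (\<lambda>i. f (r i) x))"
  have g [measurable]: "g \<in> borel_measurable M"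
    unfolding g_def by (rule borel_measurable_lim_metric) measurable
  have lim: "AE x in M. (\<lambda>n. f (r n) x) \<longlonglongrightarrow> g x"
    using r(2) by eventually_elim (auto simp: g_def convergent_LIMSEQ_iff Cauchy_convergent_iff)
  have small: "\<exists>N. \<forall>n\<ge>N. rho (\<lambda>x. f n x - g x) \<le> ennreal \<eta>" if eta: "0 < \<eta>" for \<eta>
  proof -
    obtain N where N: "\<And>i j. i \<ge> N \<Longrightarrow> j \<ge> N \<Longrightarrow> rho (\<lambda>x. f i x - f j x) \<le> ennreal \<eta>"
      using cauchy[OF eta] by blast
    have "rho (\<lambda>x. f n x - g x) \<le> ennreal \<eta>" if "n \<ge> N" for n
    proof -
      have "rho (\<lambda>x. f n x - g x) \<le> liminf (\<lambda>k. rho (\<lambda>x. f n x - f (r k) x))"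
      proof (rule rho_fatou)
        show "AE x in M. (\<lambda>k. f n x - f (r k) x) \<longlonglongrightarrow> f n x - g x"
          using lim by eventually_elim (intro tendsto_intros)
      qed measurable
      also have "\<dots> \<le> limsup (\<lambda>k. rho (\<lambda>x. f n x - f (r k) x))"
        by (rule Liminf_le_Limsup) simp
      also have "\<dots> \<le> ennreal \<eta>"
      proof (rule Limsup_bounded, rule eventually_sequentiallyI[of N])
        fix k assume "N \<le> k"
        then show "rho (\<lambda>x. f n x - f (r k) x) \<le> ennreal \<eta>"
          using seq_suble[OF r(1), of k] that by (intro N) auto
      qed
      finally show ?thesis .
    qed
    then show ?thesis by blast
  qed
  have "(\<lambda>n. rho (\<lambda>x. f n x - g x)) \<longlonglongrightarrow> 0"
  proof (rule order_tendstoI)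
    fix a :: ennreal assume "0 < a"
    then obtain z where z: "0 < z" "z < a" using dense by blast
    obtain \<eta> where "0 < \<eta>" "ennreal \<eta> < a"
      using z that by (cases z) auto
    then show "\<forall>\<^sub>F n in sequentially. rho (\<lambda>x. f n x - g x) < a"
      using small[of \<eta>] by (auto simp: eventually_sequentially intro: le_less_trans)
  qed auto
  then show ?thesis using that g r(1) lim by blast
qed

lemma rho_tendsto_triangle:
  assumes [measurable]: "\<And>n. f n \<in> borel_measurable M" "\<And>n. g n \<in> borel_measurable M" "h \<in> borel_measurable M"
    and "(\<lambda>n. rho (\<lambda>x. f n x - g n x)) \<longlonglongrightarrow> 0" "(\<lambda>n. rho (\<lambda>x. g n x - h x)) \<longlonglongrightarrow> 0"
  shows "(\<lambda>n. rho (\<lambda>x. f n x - h x)) \<longlonglongrightarrow> 0"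
proof (rule tendsto_sandwich[OF _ _ tendsto_const])
  show "\<forall>\<^sub>F n in sequentially. rho (\<lambda>x. f n x - h x)
    \<le> ennreal (2 powr (pmax - 1)) * (rho (\<lambda>x. f n x - g n x) + rho (\<lambda>x. g n x - h x))"
    by (intro always_eventually allI rho_triangle) measurable
  have "(\<lambda>n. ennreal (2 powr (pmax - 1)) * (rho (\<lambda>x. f n x - g n x) + rho (\<lambda>x. g n x - h x)))
     \<longlonglongrightarrow> ennreal (2 powr (pmax - 1)) * (0 + 0)"
    by (intro tendsto_add assms ennreal_tendsto_cmult) auto
  then show "(\<lambda>n. ennreal (2 powr (pmax - 1)) * (rho (\<lambda>x. f n x - g n x) + rho (\<lambda>x. g n x - h x))) \<longlonglongrightarrow> 0"
    by simp
qed auto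

text \<open>Uniform continuity on sets of bounded modular: choose \<open>l\<close> in \<open>rho_split\<close> so small that the factor of
  the first term is almost one.\<close>

lemma rho_near_le:
  assumes "0 \<le> a" "0 < \<eta>"
  shows "\<exists>d>0. \<forall>f g :: 'a \<Rightarrow> 'b::euclidean_space. f \<in> borel_measurable M \<longrightarrow> g \<in> borel_measurable M \<longrightarrow>
    rho g \<le> ennreal a \<longrightarrow> rho (\<lambda>x. f x - g x) \<le> ennreal d \<longrightarrow> rho f \<le> ennreal (a + \<eta>)"
proof -
  have "(\<lambda>n. (1 - 1 / real (Suc (Suc n))) powr (1 - pmax) * a) \<longlonglongrightarrow> (1 - 0) powr (1 - pmax) * a"
    by (intro tendsto_intros LIMSEQ_Suc[OF LIMSEQ_Suc[OF lim_1_over_n]]) auto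
  then have "\<forall>\<^sub>F n in sequentially. (1 - 1 / real (Suc (Suc n))) powr (1 - pmax) * a < a + \<eta> / 2"
    using assms by (intro order_tendstoD) auto
  then obtain n where n: "(1 - 1 / real (Suc (Suc n))) powr (1 - pmax) * a < a + \<eta> / 2"
    by (auto dest: eventually_happens)
  define l B where "l = 1 / real (Suc (Suc n))" and "B = l powr (1 - pmax)"
  have l: "0 < l" "l < 1" and B: "0 < B" by (auto simp: l_def B_def)
  show ?thesis
  proof (intro exI[of _ "\<eta> / (2 * B)"] conjI allI impI)
    show "0 < \<eta> / (2 * B)" using assms B by simp
    fix f g :: "'a \<Rightarrow> 'b"
    assume fg: "f \<in> borel_measurable M" "g \<in> borel_measurable M" "rho g \<le> ennreal a"
      "rho (\<lambda>x. f x - g x) \<le> ennreal (\<eta> / (2 * B))"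
    have "rho f \<le> ennreal ((1 - l) powr (1 - pmax)) * rho g + ennreal B * rho (\<lambda>x. f x - g x)"
      unfolding B_def by (intro rho_split fg l)
    also have "\<dots> \<le> ennreal ((1 - l) powr (1 - pmax)) * ennreal a + ennreal B * ennreal (\<eta> / (2 * B))"
      using fg by (intro add_mono mult_left_mono) auto
    also have "\<dots> = ennreal ((1 - l) powr (1 - pmax) * a + \<eta> / 2)"
      using assms B by (simp flip: ennreal_mult ennreal_plus)
    also have "\<dots> \<le> ennreal (a + \<eta>)"
      using n by (intro ennreal_leI) (simp add: l_def)
    finally show "rho f \<le> ennreal (a + \<eta>)" .
  qed
qed

lemma rho_limit_const:
  fixes f :: "nat \<Rightarrow> 'a \<Rightarrow> 'b::euclidean_space"
  assumes [measurable]: "\<And>n. f n \<in> borel_measurable M" "u \<in> borel_measurable M"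
    and diff: "(\<lambda>n. rho (\<lambda>x. f n x - u x)) \<longlonglongrightarrow> 0"
    and a: "0 \<le> a" "\<And>n. rho (f n) = ennreal a"
  shows "rho u = ennreal a"
proof -
  have le: "rho u \<le> ennreal (a + \<eta>)" if eta: "0 < \<eta>" for \<eta>
  proof -
    obtain d where d: "0 < d" "\<And>f g :: 'a \<Rightarrow> 'b. f \<in> borel_measurable M \<Longrightarrow> g \<in> borel_measurable M \<Longrightarrow>
      rho g \<le> ennreal a \<Longrightarrow> rho (\<lambda>x. f x - g x) \<le> ennreal d \<Longrightarrow> rho f \<le> ennreal (a + \<eta>)"
      using rho_near_le[OF a(1) eta, where 'b = 'b] by blast
    have "\<forall>\<^sub>F n in sequentially. rho (\<lambda>x. f n x - u x) < ennreal d"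
      using d(1) by (intro order_tendstoD(2)[OF diff]) auto
    then obtain n where "rho (\<lambda>x. f n x - u x) < ennreal d" by (auto dest: eventually_happens)
    then show ?thesis using a by (intro d(2)[of u "f n"]) (auto simp: rho_minus_commute[of u] less_imp_le)
  qed
  obtain b where b: "0 \<le> b" "rho u = ennreal b"
    using le[of 1] by (cases "rho u") (auto simp: top_unique)
  have "b \<le> a"
  proof (rule field_le_epsilon)
    fix \<eta> :: real assume "0 < \<eta>"
    then have "ennreal b \<le> ennreal (a + \<eta>)" using le b(2) by metis
    then show "b \<le> a + \<eta>" using a(1) \<open>0 < \<eta>\<close> by (subst (asm) ennreal_le_iff) auto
  qed
  moreover have "a \<le> b"
  proof (rule field_le_epsilon)
    fix \<eta> :: real assume eta: "0 < \<eta>"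
    obtain d where d: "0 < d" "\<And>f g :: 'a \<Rightarrow> 'b. f \<in> borel_measurable M \<Longrightarrow> g \<in> borel_measurable M \<Longrightarrow>
      rho g \<le> ennreal b \<Longrightarrow> rho (\<lambda>x. f x - g x) \<le> ennreal d \<Longrightarrow> rho f \<le> ennreal (b + \<eta>)"
      using rho_near_le[OF b(1) eta, where 'b = 'b] by blast
    have "\<forall>\<^sub>F n in sequentially. rho (\<lambda>x. f n x - u x) < ennreal d"
      using d(1) by (intro order_tendstoD(2)[OF diff]) auto
    then obtain n where "rho (\<lambda>x. f n x - u x) < ennreal d" by (auto dest: eventually_happens)
    then have "rho (f n) \<le> ennreal (b + \<eta>)" using b by (intro d(2)[of "f n" u]) auto
    then show "a \<le> b + \<eta>" using b eta unfolding a(2) by (subst (asm) ennreal_le_iff) auto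
  qed
  ultimately show ?thesis using b by simp
qed

text \<open>Weak lower semicontinuity without weak convergence.  Among the pairs whose first component is
  within modular distance \<open>1/(j+1)\<close> of \<open>u\<close>, take a near-minimizer of the modular of the second
  component.  These sets are midpoint convex and decrease, so uniform convexity forces the second
  components of the near-minimizers to converge strongly, and the infima stay below \<open>L\<close>.\<close>

lemma rho_convex_lsc:
  fixes C :: "(('a \<Rightarrow> real) \<times> ('a \<Rightarrow> 'b::euclidean_space)) set"
  assumes meas: "\<And>v g. (v, g) \<in> C \<Longrightarrow> v \<in> borel_measurable M \<and> g \<in> borel_measurable M \<and> rho g < \<infinity>"
    and mid: "\<And>v g w h. (v, g) \<in> C \<Longrightarrow> (w, h) \<in> C \<Longrightarrow>
      ((\<lambda>x. (1/2) *\<^sub>R (v x + w x)), (\<lambda>x. (1/2) *\<^sub>R (g x + h x))) \<in> C"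
    and u [measurable]: "u \<in> borel_measurable M"
    and seq: "\<And>k. (v k, g k) \<in> C" and vu: "(\<lambda>k. rho (\<lambda>x. v k x - u x)) \<longlonglongrightarrow> 0"
    and gl: "\<And>k. rho (g k) \<le> ennreal (l k)" and l: "\<And>k. 0 \<le> l k" "l \<longlonglongrightarrow> L"
  obtains G w h where "G \<in> borel_measurable M" "rho G \<le> ennreal L"
    "\<And>k. (w k, h k) \<in> C" "(\<lambda>k. rho (\<lambda>x. w k x - u x)) \<longlonglongrightarrow> 0" "(\<lambda>k. rho (\<lambda>x. h k x - G x)) \<longlonglongrightarrow> 0"
proof -
  have L: "0 \<le> L" using l by (intro LIMSEQ_le_const) auto
  define D where "D j = {(v, g) \<in> C. rho (\<lambda>x. v x - u x) \<le> ennreal (1 / Suc j)}" for j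
  define e where "e j = (INF (v, g) \<in> D j. rho g)" for j
  have e_le: "e j \<le> rho g" if "(v, g) \<in> D j" for j v g
    using INF_lower[OF that, of "\<lambda>(v, g). rho g"] by (simp add: e_def)
  have D_mono: "D j \<subseteq> D i" if "i \<le> j" for i j
  proof -
    have "ennreal (1 / Suc j) \<le> ennreal (1 / Suc i)"
      using that by (intro ennreal_leI divide_left_mono) auto
    then show ?thesis by (auto simp: D_def intro: order_trans)
  qed
  have e_mono: "e i \<le> e j" if "i \<le> j" for i j
    unfolding e_def by (rule INF_superset_mono[OF D_mono[OF that] order_refl])
  have eL: "e j \<le> ennreal L" for j
  proof (rule LIMSEQ_le_const[OF tendsto_ennrealI[OF l(2)]])
    have "\<forall>\<^sub>F k in sequentially. rho (\<lambda>x. v k x - u x) < ennreal (1 / Suc j)"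
      by (intro order_tendstoD(2)[OF vu]) auto
    then obtain N where "\<And>k. k \<ge> N \<Longrightarrow> rho (\<lambda>x. v k x - u x) < ennreal (1 / Suc j)"
      by (auto simp: eventually_sequentially)
    then have "(v k, g k) \<in> D j" if "k \<ge> N" for k
      using that seq by (auto simp: D_def less_imp_le)
    then show "\<exists>N. \<forall>n\<ge>N. e j \<le> ennreal (l n)"
      using e_le gl by (intro exI[of _ N]) (blast intro: order_trans)
  qed
  define er where "er j = enn2real (e j)" for j
  have e_er: "e j = ennreal (er j)" for j
    using eL[of j] by (cases "e j") (auto simp: er_def top_unique)
  have er: "0 \<le> er j" "er j \<le> L" for j
    using eL[of j] L by (auto simp: er_def enn2real_leI)
  have er_mono: "er i \<le> er j" if "i \<le> j" for i j
    using e_mono[OF that] er unfolding e_er by (simp add: ennreal_le_iff)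
  have "\<exists>w h. (w, h) \<in> D j \<and> rho h \<le> ennreal (er j + 1 / Suc j)" for j
  proof -
    have "e j < ennreal (er j + 1 / Suc j)"
      unfolding e_er using er by (intro ennreal_lessI) (auto simp: add_nonneg_pos)
    then show ?thesis unfolding e_def INF_less_iff by (fastforce intro: less_imp_le)
  qed
  then obtain w h where wh: "\<And>j. (w j, h j) \<in> D j" "\<And>j. rho (h j) \<le> ennreal (er j + 1 / Suc j)"
    by metis
  have whC: "(w j, h j) \<in> C" for j using wh(1)[of j] by (auto simp: D_def)
  have hm [measurable]: "w j \<in> borel_measurable M" "h j \<in> borel_measurable M" for j
    using meas[OF whC] by auto
  define a where "a j = enn2real (rho (h j))" for j
  have rho_a: "rho (h j) = ennreal (a j)" for j
    using meas[OF whC[of j]] by (cases "rho (h j)") (auto simp: a_def)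
  have a: "0 \<le> a j" "a j \<le> er j + 1 / Suc j" for j
  proof -
    show "0 \<le> a j" by (simp add: a_def)
    have "0 \<le> er j + 1 / Suc j" using er[of j] by simp
    then show "a j \<le> er j + 1 / Suc j" using wh(2)[of j] unfolding rho_a by (simp only: ennreal_le_iff)
  qed
  \<comment> \<open>the midpoint of the \<open>i\<close>-th and a later near-minimizer competes for the \<open>i\<close>-th infimum\<close>
  have mid_ge: "ennreal (er i) \<le> rho (\<lambda>x. (1/2) *\<^sub>R (h i x + h j x))" if "i \<le> j" for i j
  proof -
    have wi: "rho (\<lambda>x. w i x - u x) \<le> ennreal (1 / Suc i)" using wh(1)[of i] by (auto simp: D_def)
    have wj: "rho (\<lambda>x. w j x - u x) \<le> ennreal (1 / Suc i)" using wh(1)[of j] D_mono[OF that] by (auto simp: D_def)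
    have "rho (\<lambda>x. (1/2) *\<^sub>R (w i x + w j x) - u x)
        = rho (\<lambda>x. (1/2) *\<^sub>R ((w i x - u x) + (w j x - u x)))"
      by (intro rho_cong_AE AE_I2 arg_cong[where f = norm]) (simp add: field_simps)
    also have "\<dots> \<le> ennreal (1/2) * (rho (\<lambda>x. w i x - u x) + rho (\<lambda>x. w j x - u x))"
      by (intro rho_midpoint_le) measurable
    also have "\<dots> \<le> ennreal (1/2) * (ennreal (1 / Suc i) + ennreal (1 / Suc i))"
      by (intro mult_left_mono add_mono wi wj) auto
    also have "\<dots> = ennreal (1 / Suc i)" 
    proof -
      have "ennreal (1 / Suc i) + ennreal (1 / Suc i) = ennreal (1 / Suc i + 1 / Suc i)"
        by (rule ennreal_plus[symmetric]) auto
      also have "ennreal (1/2) * \<dots> = ennreal (1/2 * (1 / Suc i + 1 / Suc i))"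
        by (rule ennreal_mult[symmetric]) auto
      finally show ?thesis by simp
    qed
    finally have "((\<lambda>x. (1/2) *\<^sub>R (w i x + w j x)), (\<lambda>x. (1/2) *\<^sub>R (h i x + h j x))) \<in> D i"
      using mid[OF whC whC] by (simp add: D_def)
    then show ?thesis using e_le unfolding e_er[symmetric] by blast
  qed
  have "convergent er"
    using er er_mono by (intro Bseq_monoseq_convergent BseqI'[of _ L] monoI1) (auto simp: abs_le_iff)
  then have "Cauchy er" by (rule convergent_Cauchy)
  have cauchy: "\<exists>N. \<forall>i\<ge>N. \<forall>j\<ge>N. rho (\<lambda>x. h i x - h j x) \<le> ennreal \<eta>" if eta: "0 < \<eta>" for \<eta>
  proof -
    define \<theta> where "\<theta> = \<eta> / (4 * (L + 1))"
    have theta: "0 < \<theta>" using eta L by (simp add: \<theta>_def)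
    obtain K where K: "0 \<le> K" "\<forall>f g :: 'a \<Rightarrow> 'b. \<forall>a\<ge>0. \<forall>b\<ge>0. \<forall>c\<ge>0.
      f \<in> borel_measurable M \<longrightarrow> g \<in> borel_measurable M \<longrightarrow>
      rho f = ennreal a \<longrightarrow> rho g = ennreal b \<longrightarrow> ennreal c \<le> rho (\<lambda>x. (1/2) *\<^sub>R (f x + g x)) \<longrightarrow>
      rho (\<lambda>x. f x - g x) \<le> ennreal (\<theta> * (a + b) + K * ((a + b) / 2 - c))"
      using rho_uniformly_convex[OF theta, where 'b = 'b] by (elim exE conjE)
    define \<kappa> where "\<kappa> = \<eta> / (4 * (K + 1))"
    have kappa: "0 < \<kappa>" using eta K(1) by (simp add: \<kappa>_def)
    obtain N1 where N1: "\<And>i j. i \<ge> N1 \<Longrightarrow> j \<ge> N1 \<Longrightarrow> \<bar>er i - er j\<bar> < \<kappa>"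
      using \<open>Cauchy er\<close> kappa unfolding Cauchy_def dist_real_def by meson
    obtain N2 where N2: "1 / Suc N2 < \<kappa>" using kappa nat_approx_posE by blast
    define N where "N = max N1 N2"
    have le: "rho (\<lambda>x. h i x - h j x) \<le> ennreal \<eta>" if "N \<le> i" "i \<le> j" for i j
    proof -
      have inv: "1 / Suc i \<le> \<kappa>" "1 / Suc j \<le> \<kappa>"
      proof -
        have "1 / Suc k \<le> \<kappa>" if "N \<le> k" for k
        proof -
          have "1 / Suc k \<le> 1 / Suc N2" using that by (intro divide_left_mono) (auto simp: N_def)
          then show ?thesis using N2 by linarith
        qed
        then show "1 / Suc i \<le> \<kappa>" "1 / Suc j \<le> \<kappa>" using that by auto
      qed
      have inv1: "1 / Suc i \<le> 1" "1 / Suc j \<le> 1" by auto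
      have diff: "er j - er i \<le> \<kappa>" using N1[of i j] that by (auto simp: N_def)
      have "rho (\<lambda>x. h i x - h j x) \<le> ennreal (\<theta> * (a i + a j) + K * ((a i + a j) / 2 - er i))"
        using that by (intro K(2)[rule_format] a er rho_a mid_ge) auto
      also have "\<dots> \<le> ennreal (\<theta> * (2 * (L + 1)) + K * (2 * \<kappa>))"
      proof (intro ennreal_leI add_mono mult_left_mono)
        show "a i + a j \<le> 2 * (L + 1)" 
          using order_trans[OF a(2)[of i] add_mono[OF er(2)[of i] inv1(1)]]
            order_trans[OF a(2)[of j] add_mono[OF er(2)[of j] inv1(2)]] by simp
        show "(a i + a j) / 2 - er i \<le> 2 * \<kappa>" using a(2)[of i] a(2)[of j] inv diff kappa by argo
      qed (use theta K(1) in auto)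
      also have "\<dots> \<le> ennreal \<eta>"
      proof (rule ennreal_leI)
        have "\<theta> * (2 * (L + 1)) = \<eta> / 2" using L by (simp add: \<theta>_def divide_simps)
        moreover have "K * (2 * \<kappa>) \<le> (K + 1) * (2 * \<kappa>)" using kappa by (intro mult_right_mono) auto
        moreover have "(K + 1) * (2 * \<kappa>) = \<eta> / 2" using K(1) by (simp add: \<kappa>_def divide_simps)
        ultimately show "\<theta> * (2 * (L + 1)) + K * (2 * \<kappa>) \<le> \<eta>" by linarith
      qed
      finally show ?thesis .
    qed
    have "rho (\<lambda>x. h i x - h j x) \<le> ennreal \<eta>" if "N \<le> i" "N \<le> j" for i j
      using le[of i j] le[of j i] that rho_minus_commute[of "h i" "h j"] by (cases "i \<le> j") auto
    then show ?thesis by blast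
  qed
  have fin: "rho (h n) < \<infinity>" for n by (simp add: rho_a)
  obtain G r where G [measurable]: "G \<in> borel_measurable M" and r: "strict_mono (r :: nat \<Rightarrow> nat)"
    and lim: "AE x in M. (\<lambda>n. h (r n) x) \<longlonglongrightarrow> G x" and hG: "(\<lambda>n. rho (\<lambda>x. h n x - G x)) \<longlonglongrightarrow> 0"
    by (rule rho_complete[OF hm(2) fin cauchy]) blast+
  have "rho G \<le> liminf (\<lambda>n. rho (h (r n)))" by (intro rho_fatou lim) measurable
  also have "\<dots> \<le> liminf (\<lambda>n. ennreal (L + 1 / Suc n))"
  proof (intro Liminf_mono always_eventually allI)
    fix n
    have "er (r n) + 1 / Suc (r n) \<le> L + 1 / Suc n"
      using er(2)[of "r n"] seq_suble[OF r, of n] by (intro add_mono divide_left_mono) auto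
    then show "rho (h (r n)) \<le> ennreal (L + 1 / Suc n)" using wh(2)[of "r n"] ennreal_leI order_trans by blast
  qed
  also have "\<dots> = ennreal L"
  proof (intro lim_imp_Liminf tendsto_ennrealI)
    have "(\<lambda>n. L + 1 / Suc n) \<longlonglongrightarrow> L + 0" by (intro tendsto_intros LIMSEQ_Suc[OF lim_1_over_n])
    then show "(\<lambda>n. L + 1 / Suc n) \<longlonglongrightarrow> L" by simp
  qed simp
  finally have "rho G \<le> ennreal L" .
  moreover have "(\<lambda>k. rho (\<lambda>x. w k x - u x)) \<longlonglongrightarrow> 0"
  proof (rule tendsto_sandwich[OF _ _ tendsto_const])
    show "\<forall>\<^sub>F n in sequentially. rho (\<lambda>x. w n x - u x) \<le> ennreal (1 / Suc n)"
      using wh(1) by (intro always_eventually) (auto simp: D_def)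
    show "(\<lambda>n. ennreal (1 / Suc n)) \<longlonglongrightarrow> 0"
      using tendsto_ennrealI[OF LIMSEQ_Suc[OF lim_1_over_n]] by simp
  qed auto
  ultimately show ?thesis using that[OF G] whC hG by blast
qed

end

section \<open>Smooth bump functions and test functions\<close>

text \<open>The negative powers make this family of flat functions closed under differentiation, up to
  linear combinations.\<close>

definition exp_inverse_pow :: "nat \<Rightarrow> real \<Rightarrow> real" where
  "exp_inverse_pow m t = (if 0 < t then exp (- (1 / t)) / t ^ m else 0)"

lemma exp_inverse_pow_tendsto_0: "(exp_inverse_pow m \<longlongrightarrow> 0) (at 0)"
proof -
  have "((\<lambda>t::real. inverse t ^ m / exp (inverse t)) \<longlongrightarrow> 0) (at_right 0)"
    using filterlim_compose[OF tendsto_power_div_exp_0[of m] filterlim_inverse_at_top_right] by simp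
  moreover have "\<forall>\<^sub>F t in at_right 0. inverse t ^ m / exp (inverse t) = exp_inverse_pow m t"
    unfolding eventually_at_filter
    by (intro always_eventually) (auto simp: exp_inverse_pow_def exp_minus field_simps)
  ultimately have "(exp_inverse_pow m \<longlongrightarrow> 0) (at_right 0)"
    by (rule Lim_transform_eventually)
  moreover have "(exp_inverse_pow m \<longlongrightarrow> 0) (at_left 0)"
    by (rule Lim_transform_eventually[OF tendsto_const])
      (auto simp: eventually_at_filter exp_inverse_pow_def)
  ultimately show ?thesis by (simp add: filterlim_split_at)
qed

lemma exp_inverse_pow_has_derivative:
  "(exp_inverse_pow m has_real_derivative
     exp_inverse_pow (m + 2) t - real m * exp_inverse_pow (m + 1) t) (at t)"
proof -
  consider "0 < t" | "t < 0" | "t = 0" by linarith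
  then show ?thesis
  proof cases
    case 1
    have "((\<lambda>t. exp (- (1 / t)) / t ^ m) has_real_derivative
       (exp (- (1 / t)) * (1 / (t * t)) * t ^ m - exp (- (1 / t)) * (real m * t ^ (m - 1))) / (t ^ m * t ^ m)) (at t)"
      using 1 by (auto intro!: derivative_eq_intros)
    moreover have "(exp (- (1 / t)) * (1 / (t * t)) * t ^ m - exp (- (1 / t)) * (real m * t ^ (m - 1))) / (t ^ m * t ^ m)
        = exp_inverse_pow (m + 2) t - real m * exp_inverse_pow (m + 1) t"
      using 1 by (cases m) (simp_all add: exp_inverse_pow_def field_simps)
    ultimately have "((\<lambda>t. exp (- (1 / t)) / t ^ m) has_real_derivative
       exp_inverse_pow (m + 2) t - real m * exp_inverse_pow (m + 1) t) (at t)" by simp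
    then show ?thesis
      by (rule has_field_derivative_transform_within_open[where S = "{0<..}"])
        (use 1 in \<open>auto simp: exp_inverse_pow_def\<close>)
  next
    case 2
    have "((\<lambda>t. 0) has_real_derivative
       exp_inverse_pow (m + 2) t - real m * exp_inverse_pow (m + 1) t) (at t)"
      using 2 by (simp add: exp_inverse_pow_def)
    then show ?thesis
      by (rule has_field_derivative_transform_within_open[where S = "{..<0}"])
        (use 2 in \<open>auto simp: exp_inverse_pow_def\<close>)
  next
    case 3
    have "((\<lambda>h. (exp_inverse_pow m h - exp_inverse_pow m 0) / (h - 0)) \<longlongrightarrow> 0) (at 0)"
      by (rule Lim_transform_eventually[OF exp_inverse_pow_tendsto_0[of "Suc m"]])
        (auto simp: exp_inverse_pow_def field_simps intro!: always_eventually)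
    then show ?thesis
      using 3 by (simp add: has_field_derivative_iff exp_inverse_pow_def)
  qed
qed

text \<open>The directional derivatives of these functions are again of this form, which gives
  smoothness of all orders at once.\<close>

inductive_set exp_algebra :: "(real ^ 'n \<Rightarrow> real) set" where
  const: "(\<lambda>x. c) \<in> exp_algebra"
| generator: "(\<lambda>x. exp_inverse_pow m (c * x $ i + d)) \<in> exp_algebra"
| add: "f \<in> exp_algebra \<Longrightarrow> g \<in> exp_algebra \<Longrightarrow> (\<lambda>x. f x + g x) \<in> exp_algebra"
| mult: "f \<in> exp_algebra \<Longrightarrow> g \<in> exp_algebra \<Longrightarrow> (\<lambda>x. f x * g x) \<in> exp_algebra"

lemma exp_algebra_prod:
  "finite I \<Longrightarrow> (\<And>i. i \<in> I \<Longrightarrow> f i \<in> exp_algebra) \<Longrightarrow> (\<lambda>x. \<Prod>i\<in>I. f i x) \<in> exp_algebra"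
  by (induction I rule: finite_induct) (auto intro: exp_algebra.mult exp_algebra.const)

lemma exp_algebra_derivative:
  fixes f :: "real ^ 'n \<Rightarrow> real"
  shows "f \<in> exp_algebra \<Longrightarrow> \<exists>f'. (\<forall>x. (f has_derivative f' x) (at x)) \<and> (\<forall>v. (\<lambda>x. f' x v) \<in> exp_algebra)"
proof (induction rule: exp_algebra.induct)
  case (const c)
  show ?case
    by (intro exI[of _ "\<lambda>x v. 0"]) (auto intro: exp_algebra.const)
next
  case (generator m c i d)
  let ?e = "\<lambda>t. exp_inverse_pow (m + 2) t + (- real m) * exp_inverse_pow (m + 1) t"
  have "((\<lambda>x. exp_inverse_pow m (c * x $ i + d)) has_derivative
      (\<lambda>v. ?e (c * x $ i + d) * (c * v $ i))) (at x)" for x :: "real ^ 'n"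
  proof -
    have inner: "((\<lambda>x. c * x $ i + d) has_derivative (\<lambda>v. c * v $ i)) (at x)"
      by (auto intro!: derivative_eq_intros bounded_linear.has_derivative[OF bounded_linear_vec_nth])
    have "(exp_inverse_pow m has_derivative (*) (?e (c * x $ i + d))) (at (c * x $ i + d))"
      using exp_inverse_pow_has_derivative[of m "c * x $ i + d"]
      by (simp add: has_field_derivative_def)
    from has_derivative_compose[OF inner this] show ?thesis .
  qed
  moreover have "(\<lambda>x. ?e (c * x $ i + d) * (c * v $ i)) \<in> exp_algebra" for v :: "real ^ 'n"
    by (rule exp_algebra.mult[OF exp_algebra.add[OF exp_algebra.generator
      exp_algebra.mult[OF exp_algebra.const exp_algebra.generator]] exp_algebra.const])
  ultimately show ?case
    by (intro exI[of _ "\<lambda>x v. ?e (c * x $ i + d) * (c * v $ i)"]) blast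
next
  case (add f g)
  then obtain f' g' where "\<And>x. (f has_derivative f' x) (at x)" "\<And>v. (\<lambda>x. f' x v) \<in> exp_algebra"
    "\<And>x. (g has_derivative g' x) (at x)" "\<And>v. (\<lambda>x. g' x v) \<in> exp_algebra" by blast
  then show ?case
    by (intro exI[of _ "\<lambda>x v. f' x v + g' x v"])
      (auto intro!: derivative_eq_intros exp_algebra.add)
next
  case (mult f g)
  then obtain f' g' where "\<And>x. (f has_derivative f' x) (at x)" "\<And>v. (\<lambda>x. f' x v) \<in> exp_algebra"
    "\<And>x. (g has_derivative g' x) (at x)" "\<And>v. (\<lambda>x. g' x v) \<in> exp_algebra" by blast
  with mult.hyps show ?case
    by (intro exI[of _ "\<lambda>x v. f x * g' x v + f' x v * g x"])
      (auto intro!: has_derivative_mult exp_algebra.add exp_algebra.mult)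
qed

lemma partial_deriv_eq:
  "(\<And>x. (f has_derivative f' x) (at x)) \<Longrightarrow> partial_deriv i f = (\<lambda>x. f' x (axis i 1))"
  by (rule ext) (metis partial_deriv_def frechet_derivative_at)

lemma exp_algebra_C_k: "f \<in> exp_algebra \<Longrightarrow> C_k k f"
proof (induction k arbitrary: f)
  case 0
  obtain f' where "\<And>x. (f has_derivative f' x) (at x)"
    using exp_algebra_derivative[OF 0] by blast
  then show ?case
    by (auto intro!: continuous_at_imp_continuous_on has_derivative_continuous)
next
  case (Suc k)
  obtain f' where f': "\<And>x. (f has_derivative f' x) (at x)" "\<And>v. (\<lambda>x. f' x v) \<in> exp_algebra"
    using exp_algebra_derivative[OF Suc.prems] by blast
  then show ?case
    using Suc.IH by (auto simp: partial_deriv_eq[OF f'(1)] differentiable_on_def differentiable_def)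
qed

lemma C_k_linear: "C_k k f \<Longrightarrow> C_k k g \<Longrightarrow> C_k k (\<lambda>x. a * f x + b * g x)"
proof (induction k arbitrary: f g)
  case 0
  then show ?case by (auto intro!: continuous_intros)
next
  case (Suc k)
  have f: "(f has_derivative frechet_derivative f (at x)) (at x)"
    and g: "(g has_derivative frechet_derivative g (at x)) (at x)" for x
    using Suc.prems by (auto simp: differentiable_on_def frechet_derivative_works)
  have "((\<lambda>x. a * f x + b * g x) has_derivative
      (\<lambda>v. a * frechet_derivative f (at x) v + b * frechet_derivative g (at x) v)) (at x)" for x
    by (auto intro!: derivative_eq_intros f g)
  note d = this
  have "partial_deriv i (\<lambda>x. a * f x + b * g x)
      = (\<lambda>x. a * partial_deriv i f x + b * partial_deriv i g x)" for i
    unfolding partial_deriv_eq[OF d] by (simp add: partial_deriv_def)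
  moreover have "(\<lambda>x. a * f x + b * g x) differentiable_on UNIV"
    using d unfolding differentiable_on_def differentiable_def by blast
  ultimately show ?case using Suc by auto
qed

definition grad :: "(real ^ 'n \<Rightarrow> real) \<Rightarrow> real ^ 'n \<Rightarrow> real ^ 'n" where
  "grad f x = (\<chi> i. partial_deriv i f x)"

text \<open>The integral estimates below involve one continuous derivative, and are applied to products and
  powers of test functions.\<close>

definition C1_compact :: "(real ^ 'n \<Rightarrow> real) \<Rightarrow> (real ^ 'n \<Rightarrow> real ^ 'n) \<Rightarrow> bool" where
  "C1_compact f g \<longleftrightarrow> (\<forall>x. (f has_derivative (\<lambda>v. g x \<bullet> v)) (at x)) \<and> continuous_on UNIV g \<and>
     compact (closure {x. f x \<noteq> 0})"

lemma has_derivative_grad: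
  fixes f :: "real ^ 'n \<Rightarrow> real"
  assumes "f differentiable (at x)"
  shows "(f has_derivative (\<lambda>v. grad f x \<bullet> v)) (at x)"
proof -
  let ?D = "frechet_derivative f (at x)"
  have D: "(f has_derivative ?D) (at x)" using assms by (simp add: frechet_derivative_works)
  then have lin: "linear ?D" by (rule has_derivative_linear)
  have "?D v = grad f x \<bullet> v" for v
  proof -
    have "?D v = ?D (\<Sum>i\<in>UNIV. v $ i *\<^sub>R axis i 1)"
      by (simp add: basis_expansion flip: scalar_mult_eq_scaleR)
    also have "\<dots> = (\<Sum>i\<in>UNIV. v $ i * ?D (axis i 1))"
      using lin by (simp add: linear_sum linear_cmul)
    finally show ?thesis by (simp add: inner_vec_def grad_def partial_deriv_def mult.commute)
  qed
  then show ?thesis using D by presburger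
qed

lemma test_function_C1_compact:
  assumes "\<phi> \<in> test_functions \<Omega>"
  shows "C1_compact \<phi> (grad \<phi>)"
proof -
  have "C_k (Suc 0) \<phi>" using assms by (simp add: test_functions_def del: C_k.simps)
  then have "\<phi> differentiable at x" "continuous_on UNIV (partial_deriv i \<phi>)" for x i
    by (auto simp: differentiable_on_def)
  then show ?thesis
    using assms unfolding C1_compact_def test_functions_def grad_def[abs_def]
    by (auto intro!: has_derivative_grad[unfolded grad_def] continuous_intros)
qed

lemma test_functions_linear:
  fixes \<phi> \<psi> :: "real ^ 'n \<Rightarrow> real"
  assumes "\<phi> \<in> test_functions \<Omega>" "\<psi> \<in> test_functions \<Omega>"
  shows "(\<lambda>x. a * \<phi> x + b * \<psi> x) \<in> test_functions \<Omega>"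
    and "grad (\<lambda>x. a * \<phi> x + b * \<psi> x) x = a *\<^sub>R grad \<phi> x + b *\<^sub>R grad \<psi> x"
proof -
  let ?S = "\<lambda>f :: real ^ 'n \<Rightarrow> real. closure {x. f x \<noteq> 0}"
  have sub: "?S (\<lambda>x. a * \<phi> x + b * \<psi> x) \<subseteq> ?S \<phi> \<union> ?S \<psi>"
    unfolding closure_Un[symmetric] by (intro closure_mono) auto
  have "compact (?S \<phi> \<union> ?S \<psi>)" "?S \<phi> \<union> ?S \<psi> \<subseteq> \<Omega>"
    using assms by (auto simp: test_functions_def)
  then have "compact (?S (\<lambda>x. a * \<phi> x + b * \<psi> x))" "?S (\<lambda>x. a * \<phi> x + b * \<psi> x) \<subseteq> \<Omega>"
    using sub compact_Int_closed[of "?S \<phi> \<union> ?S \<psi>" "?S (\<lambda>x. a * \<phi> x + b * \<psi> x)"]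
    by (simp_all add: inf.absorb2 order_trans[OF sub])
  then show "(\<lambda>x. a * \<phi> x + b * \<psi> x) \<in> test_functions \<Omega>"
    using assms by (auto simp: test_functions_def intro: C_k_linear)
  have d: "(\<phi> has_derivative (\<lambda>v. grad \<phi> y \<bullet> v)) (at y)" "(\<psi> has_derivative (\<lambda>v. grad \<psi> y \<bullet> v)) (at y)" for y
    using assms[THEN test_function_C1_compact] by (auto simp: C1_compact_def)
  have "((\<lambda>x. a * \<phi> x + b * \<psi> x) has_derivative (\<lambda>v. a * (grad \<phi> y \<bullet> v) + b * (grad \<psi> y \<bullet> v))) (at y)" for y
    by (auto intro!: derivative_eq_intros d)
  from partial_deriv_eq[OF this]
  show "grad (\<lambda>x. a * \<phi> x + b * \<psi> x) x = a *\<^sub>R grad \<phi> x + b *\<^sub>R grad \<psi> x"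
    by (simp add: grad_def vec_eq_iff inner_axis)
qed

definition box_bump :: "real \<Rightarrow> real ^ 'n \<Rightarrow> real ^ 'n \<Rightarrow> real ^ 'n \<Rightarrow> real" where
  "box_bump k a b x =
     (\<Prod>i\<in>UNIV. exp_inverse_pow 0 (k * (x $ i - a $ i)) * exp_inverse_pow 0 (k * (b $ i - x $ i)))"

lemma exp_inverse_pow_0_bounds: "0 \<le> exp_inverse_pow 0 t" "exp_inverse_pow 0 t \<le> 1"
  "exp_inverse_pow 0 t = 0 \<longleftrightarrow> t \<le> 0"
  by (auto simp: exp_inverse_pow_def)

lemma box_bump_bounds: "0 \<le> box_bump k a b x" "box_bump k a b x \<le> 1"
  by (auto simp: box_bump_def exp_inverse_pow_0_bounds intro!: prod_nonneg prod_le_1 mult_nonneg_nonneg mult_le_one)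

lemma box_bump_nonzero_iff: "0 < k \<Longrightarrow> box_bump k a b x \<noteq> 0 \<longleftrightarrow> x \<in> box a b"
  by (auto simp: box_bump_def exp_inverse_pow_0_bounds mem_box_cart not_le zero_less_mult_iff mult_le_0_iff)

lemma box_bump_test_function:
  assumes "0 < k" "cbox a b \<subseteq> \<Omega>"
  shows "box_bump k a b \<in> test_functions \<Omega>"
proof -
  have gen: "(\<lambda>x. exp_inverse_pow 0 (k * (x $ i - a $ i))) \<in> exp_algebra"
     "(\<lambda>x. exp_inverse_pow 0 (k * (b $ i - x $ i))) \<in> exp_algebra" for i
    using exp_algebra.generator[of 0 k i "- (k * a $ i)"] exp_algebra.generator[of 0 "- k" i "k * b $ i"]
    by (simp_all add: algebra_simps)
  have "box_bump k a b \<in> exp_algebra"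
    unfolding box_bump_def[abs_def] by (intro exp_algebra_prod exp_algebra.mult gen) auto
  moreover have eq: "{x. box_bump k a b x \<noteq> 0} = box a b"
    using box_bump_nonzero_iff[OF assms(1), of a b] by auto
  moreover have sub: "closure (box a b) \<subseteq> cbox a b"
    by (intro closure_minimal box_subset_cbox closed_cbox)
  moreover have "compact (closure (box a b))"
    using bounded_box[of a b] by simp
  ultimately show ?thesis
    using assms unfolding test_functions_def by (auto intro: exp_algebra_C_k)
qed

lemma box_bump_tendsto: "(\<lambda>n. box_bump (real (Suc n)) a b x) \<longlonglongrightarrow> indicator (box a b) x"
proof (cases "x \<in> box a b")
  case True
  have lim: "(\<lambda>n. exp_inverse_pow 0 (real (Suc n) * t)) \<longlonglongrightarrow> 1" if "0 < t" for t
  proof -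
    have "(\<lambda>n. exp (- ((1 / real (Suc n)) * (1 / t)))) \<longlonglongrightarrow> exp (- (0 * (1 / t)))"
      by (intro tendsto_intros LIMSEQ_Suc[OF lim_1_over_n])
    then show ?thesis using that by (simp add: exp_inverse_pow_def)
  qed
  have "(\<lambda>n. box_bump (real (Suc n)) a b x) \<longlonglongrightarrow> (\<Prod>i\<in>(UNIV :: 'a set). 1 * 1)"
    unfolding box_bump_def using True by (intro tendsto_intros lim) (auto simp: mem_box_cart)
  then show ?thesis using True by simp
next
  case False
  then have "box_bump (real (Suc n)) a b x = 0" for n
    using box_bump_nonzero_iff[of "real (Suc n)" a b x] by auto
  then show ?thesis using False by simp
qed

section \<open>Integrals of gradients and of translation differences\<close>

lemma C1_compactD:
  assumes "C1_compact f g"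
  shows "(f has_derivative (\<lambda>v. g x \<bullet> v)) (at x)" "continuous_on UNIV f" "continuous_on UNIV g"
    "f \<in> borel_measurable borel" "g \<in> borel_measurable borel"
proof -
  show d: "(f has_derivative (\<lambda>v. g x \<bullet> v)) (at x)" for x
    using assms by (auto simp: C1_compact_def)
  show f: "continuous_on UNIV f"
    using d by (auto intro!: continuous_at_imp_continuous_on has_derivative_continuous)
  show g: "continuous_on UNIV g" using assms by (auto simp: C1_compact_def)
  show "f \<in> borel_measurable borel" "g \<in> borel_measurable borel"
    using f g by (auto intro: borel_measurable_continuous_onI)
qed

lemma C1_compact_grad_support:
  assumes "C1_compact f g" "x \<notin> closure {x. f x \<noteq> 0}"
  shows "g x = 0"
proof -
  have "((\<lambda>x. 0) has_derivative (\<lambda>v. g x \<bullet> v)) (at x)"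
    by (rule has_derivative_transform_within_open[OF C1_compactD(1)[OF assms(1)], of "- closure {x. f x \<noteq> 0}"])
      (use assms(2) closure_subset[of "{x. f x \<noteq> 0}"] in \<open>auto simp: open_Compl\<close>)
  from has_derivative_unique[OF this has_derivative_const]
  have "g x \<bullet> g x = 0" by meson
  then show ?thesis by simp
qed

lemma C1_compact_bounded:
  assumes "C1_compact f g"
  obtains B R where "0 < B" "0 < R" "\<And>x. \<bar>f x\<bar> \<le> B" "\<And>x. norm (g x) \<le> B"
    "\<And>x. R < norm x \<Longrightarrow> f x = 0" "\<And>x. R < norm x \<Longrightarrow> g x = 0"
proof -
  let ?S = "closure {x. f x \<noteq> 0}"
  have S: "compact ?S" using assms by (simp add: C1_compact_def)
  obtain R where R: "0 < R" "\<And>x. x \<in> ?S \<Longrightarrow> norm x \<le> R"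
    using compact_imp_bounded[OF S] by (auto simp: bounded_pos)
  have "compact (f ` ?S)" "compact (g ` ?S)"
    by (intro compact_continuous_image S continuous_on_subset[OF C1_compactD(2)[OF assms]]
      continuous_on_subset[OF C1_compactD(3)[OF assms]] subset_UNIV)+
  then obtain B1 B2 where B: "0 < B1" "\<And>x. x \<in> ?S \<Longrightarrow> \<bar>f x\<bar> \<le> B1" "0 < B2" "\<And>x. x \<in> ?S \<Longrightarrow> norm (g x) \<le> B2"
    by (force dest!: compact_imp_bounded simp: bounded_pos)
  have f0: "f x = 0" if "x \<notin> ?S" for x using that closure_subset[of "{x. f x \<noteq> 0}"] by auto
  show ?thesis
  proof (rule that[of "max B1 B2" R])
    show "\<bar>f x\<bar> \<le> max B1 B2" for x using B f0[of x] by (cases "x \<in> ?S") (auto simp: le_max_iff_disj)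
    show "norm (g x) \<le> max B1 B2" for x
      using B C1_compact_grad_support[OF assms, of x] by (cases "x \<in> ?S") (auto simp: le_max_iff_disj)
    show "f x = 0" "g x = 0" if "R < norm x" for x
      using R(2)[of x] that f0[of x] C1_compact_grad_support[OF assms, of x] by auto
  qed (use B R in auto)
qed

lemma integrable_continuous_bounded_support:
  fixes f :: "'a::euclidean_space \<Rightarrow> 'b::{banach, second_countable_topology}"
  assumes "continuous_on UNIV f" "\<And>x. R < norm x \<Longrightarrow> f x = 0"
  shows "integrable lborel f"
proof -
  have "integrable lborel (\<lambda>x. indicator (cball 0 R) x *\<^sub>R f x)"
    by (intro borel_integrable_compact) (auto intro: continuous_on_subset[OF assms(1)])
  also have "(\<lambda>x. indicator (cball 0 R) x *\<^sub>R f x) = f"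
    using assms(2) by (auto simp: indicator_def fun_eq_iff not_le)
  finally show ?thesis .
qed

lemma C1_compact_integrable:
  assumes "C1_compact f g"
  shows "integrable lborel f" "integrable lborel g"
proof -
  obtain B R where "\<And>x. R < norm x \<Longrightarrow> f x = 0" "\<And>x. R < norm x \<Longrightarrow> g x = 0"
    using C1_compact_bounded[OF assms] by metis
  then show "integrable lborel f" "integrable lborel g"
    using C1_compactD(2,3)[OF assms] by (auto intro: integrable_continuous_bounded_support)
qed

lemma C1_compact_mult:
  assumes "C1_compact \<phi> g" "C1_compact \<psi> h"
  shows "C1_compact (\<lambda>x. \<phi> x * \<psi> x) (\<lambda>x. \<phi> x *\<^sub>R h x + \<psi> x *\<^sub>R g x)"
  unfolding C1_compact_def
proof (intro conjI allI)
  fix x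
  show "((\<lambda>x. \<phi> x * \<psi> x) has_derivative (\<lambda>v. (\<phi> x *\<^sub>R h x + \<psi> x *\<^sub>R g x) \<bullet> v)) (at x)"
    using has_derivative_mult[OF C1_compactD(1)[OF assms(1), of x] C1_compactD(1)[OF assms(2), of x]]
    by (simp add: inner_add_left mult.commute)
next
  show "continuous_on UNIV (\<lambda>x. \<phi> x *\<^sub>R h x + \<psi> x *\<^sub>R g x)"
    by (intro continuous_intros C1_compactD(2,3)[OF assms(1)] C1_compactD(2,3)[OF assms(2)])
  have "closure {x. \<phi> x * \<psi> x \<noteq> 0} \<subseteq> closure {x. \<phi> x \<noteq> 0}" by (intro closure_mono) auto
  then show "compact (closure {x. \<phi> x * \<psi> x \<noteq> 0})"
    using assms(1) compact_Int_closed[OF _ closed_closure, of "closure {x. \<phi> x \<noteq> 0}" "{x. \<phi> x * \<psi> x \<noteq> 0}"]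
    by (simp add: C1_compact_def inf.absorb2)
qed

lemma lborel_integral_translation:
  fixes f :: "'a::euclidean_space \<Rightarrow> 'b::{banach, second_countable_topology}"
  assumes "f \<in> borel_measurable borel"
  shows "(LINT x|lborel. f (x + c)) = (LINT x|lborel. f x)"
proof -
  have "(LINT x|lborel. f x) = (LINT x|distr lborel borel ((+) c). f x)"
    by (simp add: lborel_distr_plus)
  also have "\<dots> = (LINT x|lborel. f (c + x))"
    using assms by (intro integral_distr) auto
  finally show ?thesis by (simp add: add.commute)
qed

lemma lborel_nn_integral_translation:
  fixes f :: "'a::euclidean_space \<Rightarrow> ennreal"
  assumes "f \<in> borel_measurable borel"
  shows "(\<integral>\<^sup>+ x. f (x + c) \<partial>lborel) = (\<integral>\<^sup>+ x. f x \<partial>lborel)"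
proof -
  have "(\<integral>\<^sup>+ x. f x \<partial>lborel) = (\<integral>\<^sup>+ x. f x \<partial>distr lborel borel ((+) c))"
    by (simp add: lborel_distr_plus)
  also have "\<dots> = (\<integral>\<^sup>+ x. f (c + x) \<partial>lborel)"
    using assms by (intro nn_integral_distr) auto
  finally show ?thesis by (simp add: add.commute)
qed

lemma C1_compact_line_derivative:
  assumes "C1_compact w g"
  shows "((\<lambda>t. w (x + t *\<^sub>R h)) has_real_derivative (g (x + t *\<^sub>R h) \<bullet> h)) (at t)"
proof -
  have "((\<lambda>t. x + t *\<^sub>R h) has_derivative (\<lambda>s. s *\<^sub>R h)) (at t)"
    by (auto intro!: derivative_eq_intros)
  from has_derivative_compose[OF this C1_compactD(1)[OF assms]]
  show ?thesis by (simp add: has_field_derivative_def inner_scaleR_right mult.commute[of _ "_ \<bullet> _"] cong: if_cong)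
qed

text \<open>Difference quotients of an integrable function have integral zero, by translation
  invariance; hence so has the gradient.\<close>

lemma C1_compact_integral_grad:
  assumes w: "C1_compact w g"
  shows "(LINT x|lborel. g x \<bullet> e) = 0"
proof -
  obtain B R where B: "0 < B" "\<And>x. norm (g x) \<le> B" and R: "\<And>x. R < norm x \<Longrightarrow> w x = 0"
    using C1_compact_bounded[OF w] by metis
  note [measurable] = C1_compactD(4,5)[OF w]
  define s where "s n = 1 / real (Suc n)" for n
  have s: "0 < s n" "s n \<le> 1" for n by (auto simp: s_def)
  define q where "q n x = (w (x + s n *\<^sub>R e) - w x) / s n" for n x
  have lip: "\<bar>w x - w y\<bar> \<le> B * norm (x - y)" for x y
  proof -
    have "norm (w x - w y) \<le> B * norm (x - y)"
    proof (rule differentiable_bound[where S = UNIV and f' = "\<lambda>x v. g x \<bullet> v"])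
      show "onorm (\<lambda>v. g z \<bullet> v) \<le> B" for z
      proof (rule onorm_le)
        fix v
        have "\<bar>g z \<bullet> v\<bar> \<le> norm (g z) * norm v" by (rule Cauchy_Schwarz_ineq2)
        also have "\<dots> \<le> B * norm v" by (intro mult_right_mono B) auto
        finally show "norm (g z \<bullet> v) \<le> B * norm v" by simp
      qed
    qed (auto simp: C1_compactD(1)[OF w])
    then show ?thesis by simp
  qed
  have "(\<lambda>n. LINT x|lborel. q n x) \<longlonglongrightarrow> (LINT x|lborel. g x \<bullet> e)"
  proof (rule integral_dominated_convergence)
    show "integrable lborel (\<lambda>x. B * norm e * indicator (cball 0 (R + norm e)) x)"
      by (intro integrable_mult_right integrable_real_indicator)
        (auto simp: emeasure_bounded_finite[unfolded infinity_ennreal_def])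
    show "AE x in lborel. (\<lambda>n. q n x) \<longlonglongrightarrow> g x \<bullet> e"
    proof (rule AE_I2)
      fix x
      have "((\<lambda>t. (w (x + t *\<^sub>R e) - w (x + 0 *\<^sub>R e)) / (t - 0)) \<longlongrightarrow> g (x + 0 *\<^sub>R e) \<bullet> e) (at 0)"
        using C1_compact_line_derivative[OF w, of x e 0] unfolding has_field_derivative_iff .
      moreover have "filterlim s (at 0) sequentially"
        using s LIMSEQ_Suc[OF lim_1_over_n] by (intro filterlim_atI) (auto simp: s_def[abs_def])
      ultimately show "(\<lambda>n. q n x) \<longlonglongrightarrow> g x \<bullet> e"
        unfolding q_def by (auto dest: filterlim_compose)
    qed
    show "AE x in lborel. norm (q n x) \<le> B * norm e * indicator (cball 0 (R + norm e)) x" for n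
    proof (rule AE_I2)
      fix x
      show "norm (q n x) \<le> B * norm e * indicator (cball 0 (R + norm e)) x"
      proof (cases "norm x \<le> R + norm e")
        case True
        have "\<bar>w (x + s n *\<^sub>R e) - w x\<bar> \<le> B * (s n * norm e)"
          using lip[of "x + s n *\<^sub>R e" x] s(1)[of n] by simp
        then show ?thesis using True s(1)[of n] by (simp add: q_def field_simps)
      next
        case False
        have "norm (s n *\<^sub>R e) \<le> norm e" using s[of n] by (simp add: mult_left_le_one_le)
        then have "R < norm (x + s n *\<^sub>R e)" "R < norm x"
          using False norm_diff_ineq[of x "s n *\<^sub>R e"] norm_ge_zero[of e] by linarith+
        then have "q n x = 0" by (simp add: q_def R)
        then show ?thesis using B by simp
      qed
    qed
  qed (auto simp: q_def)
  moreover have "(LINT x|lborel. q n x) = 0" for n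
  proof -
    have "integrable lborel w" by (rule C1_compact_integrable[OF w])
    moreover from this have "integrable lborel (\<lambda>x. w (x + s n *\<^sub>R e))"
      using integrable_distr[of "(+) (s n *\<^sub>R e)" lborel borel w] by (simp add: lborel_distr_plus add.commute)
    ultimately show ?thesis
      unfolding q_def by (simp add: lborel_integral_translation)
  qed
  ultimately show ?thesis by (simp add: LIMSEQ_const_iff)
qed

text \<open>Integrate the derivative over the segment from \<open>x\<close> to \<open>x + h\<close> and exchange the integrals.\<close>

lemma C1_compact_translation:
  assumes w: "C1_compact w g"
  shows "(\<integral>\<^sup>+ x. ennreal \<bar>w (x + h) - w x\<bar> \<partial>lborel) \<le> ennreal (norm h) * (\<integral>\<^sup>+ x. ennreal (norm (g x)) \<partial>lborel)"
proof -
  note [measurable] = C1_compactD(4,5)[OF w]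
  have "(\<integral>\<^sup>+ x. ennreal \<bar>w (x + h) - w x\<bar> \<partial>lborel)
     \<le> (\<integral>\<^sup>+ x. (\<integral>\<^sup>+ t. ennreal (norm h) * (indicator {0..1::real} t * ennreal (norm (g (x + t *\<^sub>R h)))) \<partial>lborel) \<partial>lborel)"
  proof (rule nn_integral_mono)
    fix x
    have cont: "continuous_on {0..1} (\<lambda>t. g (x + t *\<^sub>R h) \<bullet> h)"
      by (intro continuous_intros continuous_on_compose2[OF C1_compactD(3)[OF w]]) auto
    have "(LINT t|lborel. indicator {0..1} t *\<^sub>R (g (x + t *\<^sub>R h) \<bullet> h)) = w (x + 1 *\<^sub>R h) - w (x + 0 *\<^sub>R h)"
      using cont
      by (intro integral_FTC_atLeastAtMost)
        (auto intro!: has_vector_derivative_at_within[OF C1_compact_line_derivative[OF w,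
          unfolded has_real_derivative_iff_has_vector_derivative]])
    then have "ennreal \<bar>w (x + h) - w x\<bar> = ennreal (norm (LINT t|lborel. indicator {0..1} t *\<^sub>R (g (x + t *\<^sub>R h) \<bullet> h)))"
      by simp
    also have "\<dots> \<le> (\<integral>\<^sup>+ t. ennreal (norm (indicator {0..1} t *\<^sub>R (g (x + t *\<^sub>R h) \<bullet> h))) \<partial>lborel)"
      using borel_integrable_atLeastAtMost'[OF cont] unfolding set_integrable_def
      by (rule integral_norm_bound_ennreal)
    also have "\<dots> \<le> (\<integral>\<^sup>+ t. ennreal (norm h) * (indicator {0..1::real} t * ennreal (norm (g (x + t *\<^sub>R h)))) \<partial>lborel)"
      using Cauchy_Schwarz_ineq2[of _ h]
      by (intro nn_integral_mono) (auto simp: indicator_def mult.commute[of "norm h"] intro!: ennreal_leI simp flip: ennreal_mult)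
    finally show "ennreal \<bar>w (x + h) - w x\<bar> \<le> (\<integral>\<^sup>+ t. ennreal (norm h) * (indicator {0..1::real} t * ennreal (norm (g (x + t *\<^sub>R h)))) \<partial>lborel)" .
  qed
  also have "\<dots> = (\<integral>\<^sup>+ t. (\<integral>\<^sup>+ x. ennreal (norm h) * (indicator {0..1::real} t * ennreal (norm (g (x + t *\<^sub>R h)))) \<partial>lborel) \<partial>lborel)"
    by (rule lborel_pair.Fubini') measurable
  also have "\<dots> = (\<integral>\<^sup>+ t. ennreal (norm h) * (indicator {0..1::real} t * (\<integral>\<^sup>+ x. ennreal (norm (g x)) \<partial>lborel)) \<partial>lborel)"
    by (intro nn_integral_cong)
      (simp add: nn_integral_cmult lborel_nn_integral_translation[of "\<lambda>x. ennreal (norm (g x))"])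
  also have "\<dots> = ennreal (norm h) * (\<integral>\<^sup>+ x. ennreal (norm (g x)) \<partial>lborel)"
    by (simp add: nn_integral_cmult nn_integral_multc)
  finally show ?thesis .
qed

lemma C1_compact_average_translation:
  fixes w :: "real ^ 'n \<Rightarrow> real"
  assumes w: "C1_compact w g" and "0 < r"
  shows "(\<integral>\<^sup>+ x. (\<integral>\<^sup>+ y. indicator (cball 0 r) y * ennreal \<bar>w (x + y) - w x\<bar> \<partial>lborel) \<partial>lborel)
    \<le> emeasure lborel (cball (0::real^'n) r) * (ennreal r * (\<integral>\<^sup>+ x. ennreal (norm (g x)) \<partial>lborel))"
proof -
  note [measurable] = C1_compactD(4,5)[OF w]
  have "(\<integral>\<^sup>+ x. (\<integral>\<^sup>+ y. indicator (cball 0 r) y * ennreal \<bar>w (x + y) - w x\<bar> \<partial>lborel) \<partial>lborel)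
      = (\<integral>\<^sup>+ y. (\<integral>\<^sup>+ x. indicator (cball 0 r) y * ennreal \<bar>w (x + y) - w x\<bar> \<partial>lborel) \<partial>lborel)"
  proof (rule lborel_pair.Fubini'[symmetric])
    have "(\<lambda>z :: (real ^ 'n) \<times> (real ^ 'n). indicator (cball 0 r) (snd z) :: ennreal) \<in> borel_measurable (lborel \<Otimes>\<^sub>M lborel)"
      by (rule measurable_compose[OF measurable_snd]) (simp add: borel_measurable_indicator)
    moreover have "(\<lambda>z. ennreal \<bar>w (fst z + snd z) - w (fst z)\<bar>) \<in> borel_measurable (lborel \<Otimes>\<^sub>M lborel)"
      by measurable
    ultimately show "(\<lambda>(x, y). indicator (cball 0 r) y * ennreal \<bar>w (x + y) - w x\<bar>)
        \<in> borel_measurable (lborel \<Otimes>\<^sub>M lborel)"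
      unfolding case_prod_beta by (rule borel_measurable_times_ennreal)
  qed
  also have "\<dots> \<le> (\<integral>\<^sup>+ y. indicator (cball (0::real^'n) r) y * (ennreal r * (\<integral>\<^sup>+ x. ennreal (norm (g x)) \<partial>lborel)) \<partial>lborel)"
  proof (rule nn_integral_mono)
    fix y :: "real ^ 'n"
    have "(\<integral>\<^sup>+ x. ennreal \<bar>w (x + y) - w x\<bar> \<partial>lborel) \<le> ennreal r * (\<integral>\<^sup>+ x. ennreal (norm (g x)) \<partial>lborel)"
      if "y \<in> cball 0 r"
      by (rule order_trans[OF C1_compact_translation[OF w]]) (use that in \<open>auto intro!: mult_right_mono ennreal_leI\<close>)
    then show "(\<integral>\<^sup>+ x. indicator (cball 0 r) y * ennreal \<bar>w (x + y) - w x\<bar> \<partial>lborel)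
        \<le> indicator (cball 0 r) y * (ennreal r * (\<integral>\<^sup>+ x. ennreal (norm (g x)) \<partial>lborel))"
      by (auto simp: nn_integral_cmult indicator_def)
  qed
  also have "\<dots> = emeasure lborel (cball (0::real^'n) r) * (ennreal r * (\<integral>\<^sup>+ x. ennreal (norm (g x)) \<partial>lborel))"
    by (subst nn_integral_multc) (simp_all add: borel_measurable_indicator)
  finally show ?thesis .
qed

section \<open>Higher integrability from the gradient\<close>

lemma emeasure_cball_real:
  fixes x :: "'a::euclidean_space"
  assumes "0 \<le> r"
  shows "emeasure lborel (cball x r) = ennreal (unit_ball_vol DIM('a) * r ^ DIM('a))"
  using emeasure_cball[OF assms, of x] by simp

text \<open>The smallness assumption makes all means of \<open>\<bar>w\<bar>\<close> over balls of radius \<open>r\<close> at most \<open>t\<close>.  Hence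
  the excess of \<open>\<bar>w\<bar>\<close> over \<open>t\<close> at a point is at most the mean oscillation on the ball around it.\<close>

lemma C1_compact_tail:
  fixes w :: "real ^ 'n \<Rightarrow> real"
  assumes w: "C1_compact w g" and r: "0 < r" and t: "0 \<le> t"
    and small: "(\<integral>\<^sup>+ x. ennreal \<bar>w x\<bar> \<partial>lborel) \<le> ennreal (t * (unit_ball_vol CARD('n) * r ^ CARD('n)))"
  shows "(\<integral>\<^sup>+ x. ennreal (\<bar>w x\<bar> - t) \<partial>lborel) \<le> ennreal r * (\<integral>\<^sup>+ x. ennreal (norm (g x)) \<partial>lborel)"
proof -
  note [measurable] = C1_compactD(4,5)[OF w]
  define V where "V = unit_ball_vol CARD('n) * r ^ CARD('n)"
  have V: "0 < V" "emeasure lborel (cball (0::real^'n) r) = ennreal V"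
    using r emeasure_cball_real[of r "0::real^'n"] by (auto simp: V_def)
  define Z where "Z x = (\<integral>\<^sup>+ y. indicator (cball 0 r) y * ennreal \<bar>w (x + y) - w x\<bar> \<partial>lborel)" for x
  have pointwise: "ennreal V * ennreal (\<bar>w x\<bar> - t) \<le> Z x" for x
  proof -
    have "ennreal (V * \<bar>w x\<bar>) = (\<integral>\<^sup>+ y. ennreal \<bar>w x\<bar> * indicator (cball (0::real^'n) r) y \<partial>lborel)"
      using V by (subst nn_integral_cmult_indicator) (simp_all add: ennreal_mult mult.commute)
    also have "\<dots> \<le> (\<integral>\<^sup>+ y. indicator (cball (0::real^'n) r) y * ennreal \<bar>w (x + y) - w x\<bar> + ennreal \<bar>w (y + x)\<bar> \<partial>lborel)"
      by (intro nn_integral_mono) (auto simp: indicator_def add.commute intro!: ennreal_leI simp flip: ennreal_plus)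
    also have "\<dots> = Z x + (\<integral>\<^sup>+ y. ennreal \<bar>w (y + x)\<bar> \<partial>lborel)"
      unfolding Z_def by (rule nn_integral_add) (auto intro!: borel_measurable_times_ennreal borel_measurable_indicator)
    also have "(\<integral>\<^sup>+ y. ennreal \<bar>w (y + x)\<bar> \<partial>lborel) \<le> ennreal (t * V)"
      using small lborel_nn_integral_translation[of "\<lambda>y. ennreal \<bar>w y\<bar>" x] by (simp add: V_def)
    finally have le: "ennreal (V * \<bar>w x\<bar>) \<le> Z x + ennreal (t * V)" by (simp add: add_left_mono)
    show ?thesis
    proof (cases "Z x")
      case (real z)
      have "ennreal (V * \<bar>w x\<bar>) \<le> ennreal (z + t * V)" using le real V t by simp
      then have "V * \<bar>w x\<bar> \<le> z + t * V" using real V t by (subst (asm) ennreal_le_iff) auto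
      then have "V * (\<bar>w x\<bar> - t) \<le> z" by (simp add: algebra_simps)
      then show ?thesis using real V by (simp add: ennreal_mult'[symmetric] ennreal_leI)
    qed auto
  qed
  have "ennreal V * (\<integral>\<^sup>+ x. ennreal (\<bar>w x\<bar> - t) \<partial>lborel) = (\<integral>\<^sup>+ x. ennreal V * ennreal (\<bar>w x\<bar> - t) \<partial>lborel)"
    by (simp add: nn_integral_cmult)
  also have "\<dots> \<le> (\<integral>\<^sup>+ x. Z x \<partial>lborel)" by (intro nn_integral_mono pointwise)
  also have "\<dots> \<le> ennreal V * (ennreal r * (\<integral>\<^sup>+ x. ennreal (norm (g x)) \<partial>lborel))"
    unfolding Z_def V(2)[symmetric] by (rule C1_compact_average_translation[OF w r])
  finally show ?thesis using V(1) by (subst (asm) ennreal_mult_le_mult_iff) auto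
qed

text \<open>If \<open>2 * 2 ^ k \<le> s \<le> 4 * 2 ^ k\<close>, then \<open>s - 2 ^ k\<close> is at least half of \<open>s\<close>, so the layer \<open>k\<close> alone
  suffices.\<close>

lemma powr_le_dyadic_sum:
  fixes s \<theta> :: real
  assumes "0 \<le> s" "0 < \<theta>" "\<theta> \<le> 1"
  shows "ennreal (s powr (1 + \<theta>))
    \<le> ennreal (2 * s) + (\<Sum>k. ennreal (2 * 4 powr \<theta> * (2 powr \<theta>) ^ k) * ennreal (s - 2 ^ k))"
proof (cases "s < 2")
  case True
  have "s powr (1 + \<theta>) = s * s powr \<theta>" using assms by (cases "s = 0") (auto simp: powr_add)
  also have "\<dots> \<le> s * 2" 
  proof (rule mult_left_mono)
    have "s powr \<theta> \<le> 2 powr \<theta>" using True assms by (intro powr_mono2) auto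
    also have "\<dots> \<le> 2 powr 1" using assms by (intro powr_mono) auto
    finally show "s powr \<theta> \<le> 2" by simp
  qed (use assms in auto)
  finally have "ennreal (s powr (1 + \<theta>)) \<le> ennreal (2 * s)" by (intro ennreal_leI) simp
  then show ?thesis by (simp add: add_increasing2)
next
  case False
  define k where "k = nat \<lfloor>log 2 s\<rfloor> - 1"
  have "1 \<le> log 2 s" using False by simp
  then have lo: "real k + 1 \<le> log 2 s" and hi: "log 2 s \<le> real k + 2"
    unfolding k_def by linarith+
  have "2 powr (real k + 1) \<le> s" using lo False by (simp add: le_log_iff)
  moreover have "s \<le> 2 powr (real k + 2)" using hi False by (simp add: log_le_iff)
  ultimately have s: "2 * 2 ^ k \<le> s" "s \<le> 4 * 2 ^ k"
    by (simp_all add: powr_add powr_realpow)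
  have "s powr (1 + \<theta>) = s powr \<theta> * s" using False by (simp add: powr_add)
  also have "\<dots> \<le> (4 * 2 ^ k) powr \<theta> * (2 * (s - 2 ^ k))"
    using s assms by (intro mult_mono powr_mono2) auto
  also have "(4 * 2 ^ k) powr \<theta> = 4 powr \<theta> * (2 powr \<theta>) ^ k"
    by (simp add: powr_mult powr_powr mult.commute flip: powr_realpow)
  finally have "ennreal (s powr (1 + \<theta>)) \<le> ennreal ((2 * 4 powr \<theta> * (2 powr \<theta>) ^ k) * (s - 2 ^ k))"
    by (intro ennreal_leI) (simp add: algebra_simps)
  also have "\<dots> = ennreal (2 * 4 powr \<theta> * (2 powr \<theta>) ^ k) * ennreal (s - 2 ^ k)"
    using s by (intro ennreal_mult) (auto intro: order_trans[OF _ s(1)])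
  also have "\<dots> \<le> (\<Sum>k. ennreal (2 * 4 powr \<theta> * (2 powr \<theta>) ^ k) * ennreal (s - 2 ^ k))"
    using sum_le_suminf[OF summableI, of "{k}" "\<lambda>k. ennreal (2 * 4 powr \<theta> * (2 powr \<theta>) ^ k) * ennreal (s - 2 ^ k)"]
    by simp
  finally show ?thesis by (simp add: add_increasing)
qed

text \<open>A weak form of the Sobolev embedding of \<open>W\<^sup>1\<^sup>,\<^sup>1\<close>: the tail estimate with \<open>r\<close> a power of the
  level makes the dyadic layers summable.\<close>

lemma C1_compact_higher_integrability:
  assumes A: "0 < A" and \<theta>: "\<theta> = 1 / (2 * real CARD('n))"
  shows "\<exists>C. \<forall>w g. C1_compact (w :: real ^ 'n \<Rightarrow> real) g \<longrightarrow>
    (\<integral>\<^sup>+ x. ennreal \<bar>w x\<bar> \<partial>lborel) \<le> ennreal A \<longrightarrow> (\<integral>\<^sup>+ x. ennreal (norm (g x)) \<partial>lborel) \<le> ennreal A \<longrightarrow>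
    (\<integral>\<^sup>+ x. ennreal (\<bar>w x\<bar> powr (1 + \<theta>)) \<partial>lborel) \<le> ennreal C"
proof -
  define n where "n = CARD('n)"
  have n: "0 < n" by (simp add: n_def)
  have th_n: "2 * \<theta> * real n = 1" using n by (simp add: \<theta> n_def)
  have th: "0 < \<theta>" "\<theta> \<le> 1" using n unfolding \<theta> n_def[symmetric] by (auto simp: divide_simps)
  define v where "v = unit_ball_vol (real n)"
  have v: "0 < v" by (simp add: v_def)
  \<comment> \<open>a ball of radius \<open>c * 2 powr (- 2 * \<theta> * k)\<close> has volume \<open>A / 2 ^ k\<close>\<close>
  define c where "c = (A / v) powr (2 * \<theta>)"
  have c: "0 < c" using A v by (simp add: c_def)
  define \<kappa> where "\<kappa> = 2 powr (- \<theta>)"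
  have kappa: "0 < \<kappa>" "\<kappa> < 1" using th by (auto simp: \<kappa>_def powr_less_one)
  define b where "b k = 2 * 4 powr \<theta> * (2 powr \<theta>) ^ k * (c * (2 powr (- 2 * \<theta>)) ^ k * A)" for k :: nat
  have b_eq: "b k = 2 * 4 powr \<theta> * c * A * \<kappa> ^ k" for k
  proof -
    have "(2 powr \<theta>) ^ k * (2 powr (- 2 * \<theta>)) ^ k = \<kappa> ^ k"
      unfolding \<kappa>_def power_mult_distrib[symmetric] powr_add[symmetric] by simp
    then show ?thesis by (simp add: b_def ac_simps)
  qed
  have b_sum: "summable b" unfolding b_eq[abs_def] using kappa by (intro summable_mult summable_geometric) auto
  have b_nonneg: "0 \<le> b k" for k using A c kappa by (simp add: b_eq)
  have "(\<integral>\<^sup>+ x. ennreal (\<bar>w x\<bar> powr (1 + \<theta>)) \<partial>lborel) \<le> ennreal (2 * A + (\<Sum>k. b k))"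
    if w: "C1_compact w g" and wA: "(\<integral>\<^sup>+ x. ennreal \<bar>w x\<bar> \<partial>lborel) \<le> ennreal A"
      and gA: "(\<integral>\<^sup>+ x. ennreal (norm (g x)) \<partial>lborel) \<le> ennreal A" for w :: "real ^ 'n \<Rightarrow> real" and g
  proof -
    note [measurable] = C1_compactD(4,5)[OF w]
    have layer: "(\<integral>\<^sup>+ x. ennreal (2 * 4 powr \<theta> * (2 powr \<theta>) ^ k) * ennreal (\<bar>w x\<bar> - 2 ^ k) \<partial>lborel) \<le> ennreal (b k)" for k
    proof -
      define r where "r = c * (2 powr (- 2 * \<theta>)) ^ k"
      have r: "0 < r" using c by (simp add: r_def)
      have r_eq: "r = (A / v) powr (2 * \<theta>) * (2 powr real k) powr (- 2 * \<theta>)"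
        by (simp add: r_def c_def powr_powr ac_simps flip: powr_realpow)
      have "r ^ n = r powr real n" using r by (simp add: powr_realpow)
      also have "\<dots> = (A / v) powr (2 * \<theta> * real n) * (2 powr real k) powr - (2 * \<theta> * real n)"
        unfolding r_eq by (simp add: powr_mult powr_powr mult.assoc)
      also have "\<dots> = A / v / 2 ^ k"
        unfolding th_n using A v by (simp add: powr_minus_divide powr_realpow)
      finally have "2 ^ k * (v * r ^ n) = A" using v by simp
      then have "(\<integral>\<^sup>+ x. ennreal (\<bar>w x\<bar> - 2 ^ k) \<partial>lborel) \<le> ennreal r * (\<integral>\<^sup>+ x. ennreal (norm (g x)) \<partial>lborel)"
        using wA unfolding v_def n_def by (intro C1_compact_tail[OF w r]) auto
      also have "\<dots> \<le> ennreal r * ennreal A" by (intro mult_left_mono gA) auto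
      finally have "(\<integral>\<^sup>+ x. ennreal (2 * 4 powr \<theta> * (2 powr \<theta>) ^ k) * ennreal (\<bar>w x\<bar> - 2 ^ k) \<partial>lborel)
         \<le> ennreal (2 * 4 powr \<theta> * (2 powr \<theta>) ^ k) * (ennreal r * ennreal A)"
        by (simp add: nn_integral_cmult mult_left_mono)
      also have "\<dots> = ennreal (b k)"
        using A r by (simp add: b_def r_def ennreal_mult)
      finally show ?thesis .
    qed
    have "(\<integral>\<^sup>+ x. ennreal (\<bar>w x\<bar> powr (1 + \<theta>)) \<partial>lborel)
      \<le> (\<integral>\<^sup>+ x. ennreal (2 * \<bar>w x\<bar>) + (\<Sum>k. ennreal (2 * 4 powr \<theta> * (2 powr \<theta>) ^ k) * ennreal (\<bar>w x\<bar> - 2 ^ k)) \<partial>lborel)"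
      by (intro nn_integral_mono powr_le_dyadic_sum th) auto
    also have "\<dots> = ennreal 2 * (\<integral>\<^sup>+ x. ennreal \<bar>w x\<bar> \<partial>lborel)
       + (\<Sum>k. \<integral>\<^sup>+ x. ennreal (2 * 4 powr \<theta> * (2 powr \<theta>) ^ k) * ennreal (\<bar>w x\<bar> - 2 ^ k) \<partial>lborel)"
      by (subst nn_integral_add, measurable, subst nn_integral_suminf, measurable)
        (simp add: ennreal_mult nn_integral_cmult)
    also have "\<dots> \<le> ennreal 2 * ennreal A + (\<Sum>k. ennreal (b k))"
      by (intro add_mono mult_left_mono wA suminf_le layer summableI) auto
    also have "\<dots> = ennreal (2 * A + (\<Sum>k. b k))"
      using A b_nonneg b_sum by (simp add: suminf_ennreal2 ennreal_mult suminf_nonneg)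
    finally show ?thesis .
  qed
  then show ?thesis by blast
qed

section \<open>Compactness in the space of integrable functions\<close>

text \<open>Rellich's theorem in \<open>L\<^sup>1\<close>.  For each radius the ball means of the functions are equi-Lipschitz
  and bounded, so a diagonal subsequence makes them all converge pointwise, and on a bounded set also
  in mean; and the functions differ from their ball means by at most the radius times the
  \<open>L\<^sup>1\<close> norm of the gradient.\<close>

lemma C1_compact_L1_compactness:
  fixes w :: "nat \<Rightarrow> real ^ 'n \<Rightarrow> real"
  assumes w: "\<And>k. C1_compact (w k) (g k)" and A: "0 < A"
    and wA: "\<And>k. (\<integral>\<^sup>+ x. ennreal \<bar>w k x\<bar> \<partial>lborel) \<le> ennreal A"
    and gA: "\<And>k. (\<integral>\<^sup>+ x. ennreal (norm (g k x)) \<partial>lborel) \<le> ennreal A"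
    and supp: "\<And>k x. R < norm x \<Longrightarrow> w k x = 0"
  obtains s where "strict_mono (s :: nat \<Rightarrow> nat)"
    "\<And>\<eta>. 0 < \<eta> \<Longrightarrow> \<exists>N. \<forall>i\<ge>N. \<forall>j\<ge>N. (\<integral>\<^sup>+ x. ennreal \<bar>w (s i) x - w (s j) x\<bar> \<partial>lborel) \<le> ennreal \<eta>"
proof -
  note [measurable] = C1_compactD(4,5)[OF w]
  define r where "r m = 1 / real (Suc m)" for m
  have r: "0 < r m" for m by (simp add: r_def)
  define V where "V m = unit_ball_vol CARD('n) * r m ^ CARD('n)" for m
  have V: "0 < V m" "emeasure lborel (cball (0::real^'n) (r m)) = ennreal (V m)" for m
    using r[of m] emeasure_cball_real[of "r m" "0::real^'n"] by (auto simp: V_def)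
  have int_w: "integrable lborel (\<lambda>y. w k (x + y))" for k x
    using C1_compact_integrable(1)[OF w, of k] integrable_distr[of "(+) x" lborel borel "w k"]
    by (simp add: lborel_distr_plus)
  have int_b: "integrable lborel (\<lambda>y. indicator (cball 0 (r m)) y *\<^sub>R w k (x + y))" for k m x
    by (intro integrable_mult_indicator int_w) auto
  define b where "b k m x = (LINT y|lborel. indicator (cball 0 (r m)) y *\<^sub>R w k (x + y))" for k m x
  have b_bound: "\<bar>b k m x\<bar> \<le> A" for k m x
  proof -
    have "ennreal \<bar>b k m x\<bar> \<le> (\<integral>\<^sup>+ y. ennreal (norm (indicator (cball 0 (r m)) y *\<^sub>R w k (x + y))) \<partial>lborel)"
      using integral_norm_bound_ennreal[OF int_b[of m k x]] by (simp add: b_def)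
    also have "\<dots> \<le> (\<integral>\<^sup>+ y. ennreal \<bar>w k (y + x)\<bar> \<partial>lborel)"
      by (intro nn_integral_mono) (auto simp: indicator_def add.commute)
    also have "\<dots> \<le> ennreal A"
      using lborel_nn_integral_translation[of "\<lambda>y. ennreal \<bar>w k y\<bar>" x] wA[of k] by simp
    finally show ?thesis using A by simp
  qed
  have b_lip: "\<bar>b k m x - b k m x'\<bar> \<le> A * norm (x - x')" for k m x x'
  proof -
    have "b k m x - b k m x' = (LINT y|lborel. indicator (cball 0 (r m)) y *\<^sub>R w k (x + y)
        - indicator (cball 0 (r m)) y *\<^sub>R w k (x' + y))"
      unfolding b_def by (rule Bochner_Integration.integral_diff[OF int_b int_b, symmetric])
    then have "ennreal \<bar>b k m x - b k m x'\<bar> \<le> (\<integral>\<^sup>+ y. ennreal (norm (indicator (cball 0 (r m)) y *\<^sub>R w k (x + y)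
        - indicator (cball 0 (r m)) y *\<^sub>R w k (x' + y))) \<partial>lborel)"
      using integral_norm_bound_ennreal[OF Bochner_Integration.integrable_diff[OF int_b[of m k x] int_b[of m k x']]]
      by simp
    also have "\<dots> \<le> (\<integral>\<^sup>+ y. ennreal \<bar>w k ((y + x') + (x - x')) - w k (y + x')\<bar> \<partial>lborel)"
      by (intro nn_integral_mono) (auto simp: indicator_def algebra_simps)
    also have "\<dots> = (\<integral>\<^sup>+ y. ennreal \<bar>w k (y + (x - x')) - w k y\<bar> \<partial>lborel)"
      by (rule lborel_nn_integral_translation[of "\<lambda>y. ennreal \<bar>w k (y + (x - x')) - w k y\<bar>" x']) measurable
    also have "\<dots> \<le> ennreal (norm (x - x')) * (\<integral>\<^sup>+ x. ennreal (norm (g k x)) \<partial>lborel)"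
      by (rule C1_compact_translation[OF w])
    also have "\<dots> \<le> ennreal (norm (x - x')) * ennreal A" by (intro mult_left_mono gA) auto
    also have "\<dots> = ennreal (A * norm (x - x'))" using A by (simp add: ennreal_mult mult.commute)
    finally show ?thesis using A by simp
  qed
  obtain D :: "(real ^ 'n) set" where D: "countable D" "\<And>X. open X \<Longrightarrow> X \<noteq> {} \<Longrightarrow> \<exists>d\<in>D. d \<in> X"
    using countable_dense_setE by blast
  have "countable ((UNIV :: nat set) \<times> D)" using D(1) by auto
  then obtain s where s: "strict_mono (s :: nat \<Rightarrow> nat)"
    and conv_s: "\<And>z. z \<in> UNIV \<times> D \<Longrightarrow> \<exists>l. (\<lambda>n. b (s n) (fst z) (snd z)) \<longlonglongrightarrow> l"
    by (rule function_convergent_subsequence[of _ "\<lambda>k z. b k (fst z) (snd z)" A]) (simp_all add: b_bound)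
  have conv_D: "\<exists>l. (\<lambda>n. b (s n) m x) \<longlonglongrightarrow> l" if "x \<in> D" for m x
    using conv_s[of "(m, x)"] that by simp
  have conv: "convergent (\<lambda>n. b (s n) m x)" for m x
  proof (rule Cauchy_convergent, rule metric_CauchyI)
    fix e :: real assume e: "0 < e"
    have "ball x (e / (3 * A)) \<noteq> {}" using e A by (simp add: not_le)
    then obtain d where d: "d \<in> D" "norm (x - d) < e / (3 * A)"
      using D(2)[of "ball x (e / (3 * A))"] by (auto simp: dist_norm)
    then have close: "A * norm (x - d) < e / 3" using A by (simp add: field_simps)
    have "Cauchy (\<lambda>n. b (s n) m d)" using conv_D[OF d(1)] by (auto intro: LIMSEQ_imp_Cauchy)
    then obtain M where M: "\<And>i j. i \<ge> M \<Longrightarrow> j \<ge> M \<Longrightarrow> \<bar>b (s i) m d - b (s j) m d\<bar> < e / 3"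
      using e unfolding Cauchy_def dist_real_def by (meson zero_less_divide_iff zero_less_numeral)
    show "\<exists>M. \<forall>i\<ge>M. \<forall>j\<ge>M. dist (b (s i) m x) (b (s j) m x) < e"
    proof (intro exI[of _ M] allI impI)
      fix i j assume "i \<ge> M" "j \<ge> M"
      then show "dist (b (s i) m x) (b (s j) m x) < e"
        using M[of i j] b_lip[of "s i" m x d] b_lip[of "s j" m x d] close
        unfolding dist_real_def by linarith
    qed
  qed
  define b' where "b' m x = lim (\<lambda>n. b (s n) m x)" for m x
  have b': "(\<lambda>n. b (s n) m x) \<longlonglongrightarrow> b' m x" for m x
    using conv by (simp add: b'_def convergent_LIMSEQ_iff)
  have "continuous_on UNIV (b k m)" for k m
    using b_lip A by (intro lipschitz_on_continuous_on[of A])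
      (auto intro!: lipschitz_onI simp: dist_norm)
  then have b_meas [measurable]: "b k m \<in> borel_measurable borel" for k m
    by (rule borel_measurable_continuous_onI)
  have b'_meas [measurable]: "b' m \<in> borel_measurable borel" for m
    by (rule borel_measurable_LIMSEQ_real[OF b']) measurable
  have [measurable]: "Measurable.pred borel (\<lambda>x. x \<in> cball (0::real^'n) R)"
    unfolding pred_def by (simp add: borel_closed del: mem_cball)
  have b'_L1: "(\<lambda>n. \<integral>\<^sup>+ x. ennreal (norm (indicator (cball 0 R) x * b' m x - indicator (cball 0 R) x * b (s n) m x)) \<partial>lborel) \<longlonglongrightarrow> 0" for m
  proof (rule nn_integral_dominated_convergence_norm[where w = "\<lambda>x. A * indicator (cball (0::real^'n) R) x"])
    show "(\<lambda>x. A * indicator (cball (0::real^'n) R) x) \<in> borel_measurable lborel"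
      by (intro borel_measurable_times borel_measurable_const borel_measurable_indicator) (simp add: borel_closed)
    show "AE x in lborel. norm (indicator (cball 0 R) x * b (s n) m x) \<le> A * indicator (cball 0 R) x" for n
      using b_bound A by (auto simp: indicator_def)
    show "AE x in lborel. (\<lambda>n. indicator (cball 0 R) x * b (s n) m x) \<longlonglongrightarrow> indicator (cball 0 R) x * b' m x"
      by (intro AE_I2 tendsto_intros b')
    have "(\<integral>\<^sup>+ x. ennreal (A * indicator (cball (0::real^'n) R) x) \<partial>lborel) = (\<integral>\<^sup>+ x. ennreal A * indicator (cball (0::real^'n) R) x \<partial>lborel)"
      by (intro nn_integral_cong) (auto simp: indicator_def)
    also have "\<dots> = ennreal A * emeasure lborel (cball (0::real^'n) R)"
      by (rule nn_integral_cmult_indicator) simp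
    also have "\<dots> < \<infinity>"
      by (simp add: ennreal_mult_less_top emeasure_bounded_finite[unfolded infinity_ennreal_def])
    finally show "(\<integral>\<^sup>+ x. ennreal (A * indicator (cball 0 R) (x::real^'n)) \<partial>lborel) < \<infinity>" .
  qed measurable
  define Z where "Z k m x = (\<integral>\<^sup>+ y. indicator (cball 0 (r m)) y * ennreal \<bar>w k (x + y) - w k x\<bar> \<partial>lborel)" for k m x
  have Z_meas [measurable]: "Z k m \<in> borel_measurable borel" for k m
  proof -
    have "(\<lambda>z :: (real ^ 'n) \<times> (real ^ 'n). indicator (cball 0 (r m)) (snd z) :: ennreal) \<in> borel_measurable (borel \<Otimes>\<^sub>M lborel)"
      by (rule measurable_compose[OF measurable_snd]) (simp add: borel_measurable_indicator)
    moreover have "(\<lambda>z. ennreal \<bar>w k (fst z + snd z) - w k (fst z)\<bar>) \<in> borel_measurable (borel \<Otimes>\<^sub>M lborel)"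
      by measurable
    ultimately have "(\<lambda>(x, y). indicator (cball 0 (r m)) y * ennreal \<bar>w k (x + y) - w k x\<bar>)
        \<in> borel_measurable (borel \<Otimes>\<^sub>M lborel)"
      unfolding case_prod_beta by (rule borel_measurable_times_ennreal)
    then show ?thesis unfolding Z_def by (rule lborel.borel_measurable_nn_integral)
  qed
  have Z_int: "(\<integral>\<^sup>+ x. Z k m x \<partial>lborel) \<le> ennreal (V m * (r m * A))" for k m
  proof -
    have "(\<integral>\<^sup>+ x. Z k m x \<partial>lborel) \<le> ennreal (V m) * (ennreal (r m) * (\<integral>\<^sup>+ x. ennreal (norm (g k x)) \<partial>lborel))"
      using C1_compact_average_translation[OF w r, of m k] by (simp add: Z_def V(2))
    also have "\<dots> \<le> ennreal (V m) * (ennreal (r m) * ennreal A)" by (intro mult_left_mono gA) auto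
    also have "\<dots> = ennreal (V m * (r m * A))" using A V(1)[of m] r[of m] by (simp add: ennreal_mult)
    finally show ?thesis .
  qed
  have b_close: "ennreal \<bar>b k m x - V m * w k x\<bar> \<le> Z k m x" for k m x
  proof -
    have i: "integrable lborel (\<lambda>y. indicator (cball (0::real^'n) (r m)) y *\<^sub>R w k x)"
      by (intro integrable_scaleR_left integrable_real_indicator)
        (auto simp: emeasure_bounded_finite[unfolded infinity_ennreal_def])
    have "(LINT y|lborel. indicator (cball (0::real^'n) (r m)) y *\<^sub>R w k x) = V m * w k x"
      using V[of m] by (simp add: measure_def)
    then have "b k m x - V m * w k x
        = (LINT y|lborel. indicator (cball 0 (r m)) y *\<^sub>R w k (x + y))
          - (LINT y|lborel. indicator (cball (0::real^'n) (r m)) y *\<^sub>R w k x)"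
      by (simp only: b_def)
    also have "\<dots> = (LINT y|lborel. indicator (cball 0 (r m)) y *\<^sub>R w k (x + y) - indicator (cball 0 (r m)) y *\<^sub>R w k x)"
      by (rule Bochner_Integration.integral_diff[OF int_b i, symmetric])
    finally have "b k m x - V m * w k x
        = (LINT y|lborel. indicator (cball 0 (r m)) y *\<^sub>R w k (x + y) - indicator (cball 0 (r m)) y *\<^sub>R w k x)" .
    then have "ennreal \<bar>b k m x - V m * w k x\<bar> \<le> (\<integral>\<^sup>+ y. ennreal (norm
        (indicator (cball 0 (r m)) y *\<^sub>R w k (x + y) - indicator (cball 0 (r m)) y *\<^sub>R w k x)) \<partial>lborel)"
      using integral_norm_bound_ennreal[OF Bochner_Integration.integrable_diff[OF int_b[of m k x] i]] by simp
    also have "\<dots> = Z k m x"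
      unfolding Z_def by (intro nn_integral_cong) (auto simp: indicator_def)
    finally show ?thesis .
  qed
  show ?thesis
  proof (rule that[OF s])
    fix \<eta> :: real assume eta: "0 < \<eta>"
    obtain m where m: "r m < \<eta> / (4 * A)" using nat_approx_posE[of "\<eta> / (4 * A)"] eta A by (auto simp: r_def)
    then have m4: "r m * A \<le> \<eta> / 4" using A by (simp add: field_simps)
    define \<kappa> where "\<kappa> = V m * \<eta> / 4"
    have kappa: "0 < \<kappa>" using eta V(1)[of m] by (simp add: \<kappa>_def)
    obtain N where N: "\<And>n. n \<ge> N \<Longrightarrow>
      (\<integral>\<^sup>+ x. ennreal (norm (indicator (cball 0 R) x * b' m x - indicator (cball 0 R) x * b (s n) m x)) \<partial>lborel) < ennreal \<kappa>"
      using order_tendstoD(2)[OF b'_L1[of m], of "ennreal \<kappa>"] kappa by (auto simp: eventually_sequentially)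
    have "(\<integral>\<^sup>+ x. ennreal \<bar>w (s i) x - w (s j) x\<bar> \<partial>lborel) \<le> ennreal \<eta>" if "i \<ge> N" "j \<ge> N" for i j
    proof -
      let ?d = "\<lambda>n x. ennreal (norm (indicator (cball 0 R) x * b' m x - indicator (cball 0 R) x * b (s n) m x))"
      have "ennreal (V m) * (\<integral>\<^sup>+ x. ennreal \<bar>w (s i) x - w (s j) x\<bar> \<partial>lborel)
          = (\<integral>\<^sup>+ x. ennreal (V m) * ennreal \<bar>w (s i) x - w (s j) x\<bar> \<partial>lborel)"
        by (rule nn_integral_cmult[symmetric]) measurable
      also have "\<dots> \<le> (\<integral>\<^sup>+ x. (Z (s i) m x + Z (s j) m x) + (?d i x + ?d j x) \<partial>lborel)"
      proof (rule nn_integral_mono)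
        fix x
        show "ennreal (V m) * ennreal \<bar>w (s i) x - w (s j) x\<bar> \<le> (Z (s i) m x + Z (s j) m x) + (?d i x + ?d j x)"
        proof (cases "norm x \<le> R")
          case True
          have "V m * \<bar>w (s i) x - w (s j) x\<bar> = \<bar>V m * w (s i) x - V m * w (s j) x\<bar>"
            using V(1)[of m] by (simp add: abs_mult flip: right_diff_distrib)
          also have "\<dots> \<le> (\<bar>b (s i) m x - V m * w (s i) x\<bar> + \<bar>b (s j) m x - V m * w (s j) x\<bar>)
              + (\<bar>b' m x - b (s i) m x\<bar> + \<bar>b' m x - b (s j) m x\<bar>)" by linarith
          finally have "ennreal (V m * \<bar>w (s i) x - w (s j) x\<bar>)
              \<le> (ennreal \<bar>b (s i) m x - V m * w (s i) x\<bar> + ennreal \<bar>b (s j) m x - V m * w (s j) x\<bar>)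
                + (ennreal \<bar>b' m x - b (s i) m x\<bar> + ennreal \<bar>b' m x - b (s j) m x\<bar>)"
            by (simp add: ennreal_leI flip: ennreal_plus)
          also have "\<dots> \<le> (Z (s i) m x + Z (s j) m x) + (?d i x + ?d j x)"
            using True by (intro add_mono b_close) auto
          finally show ?thesis using V(1)[of m] by (simp add: ennreal_mult)
        next
          case False
          then show ?thesis by (simp add: supp)
        qed
      qed
      also have "\<dots> = ((\<integral>\<^sup>+ x. Z (s i) m x \<partial>lborel) + (\<integral>\<^sup>+ x. Z (s j) m x \<partial>lborel))
          + ((\<integral>\<^sup>+ x. ?d i x \<partial>lborel) + (\<integral>\<^sup>+ x. ?d j x \<partial>lborel))"
        by (simp add: nn_integral_add)
      also have "\<dots> \<le> (ennreal (V m * (r m * A)) + ennreal (V m * (r m * A))) + (ennreal \<kappa> + ennreal \<kappa>)"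
        using N that by (intro add_mono Z_int less_imp_le) auto
      also have "\<dots> = ennreal (2 * (V m * (r m * A)) + 2 * \<kappa>)"
        using V(1)[of m] r[of m] A kappa by (simp flip: ennreal_plus)
      also have "\<dots> \<le> ennreal (V m * \<eta>)"
      proof (rule ennreal_leI)
        have "V m * (r m * A) \<le> V m * (\<eta> / 4)" using m4 V(1)[of m] by (intro mult_left_mono) auto
        then show "2 * (V m * (r m * A)) + 2 * \<kappa> \<le> V m * \<eta>"
          unfolding \<kappa>_def times_divide_eq_right by linarith
      qed
      also have "\<dots> = ennreal (V m) * ennreal \<eta>" using V(1)[of m] eta by (simp add: ennreal_mult)
      finally show ?thesis using V(1)[of m] by (subst (asm) ennreal_mult_le_mult_iff) auto
    qed
    then show "\<exists>N. \<forall>i\<ge>N. \<forall>j\<ge>N. (\<integral>\<^sup>+ x. ennreal \<bar>w (s i) x - w (s j) x\<bar> \<partial>lborel) \<le> ennreal \<eta>" by blast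
  qed
qed

section \<open>Variable exponents on a bounded domain\<close>

lemma real_polynomial_function_C1:
  fixes q :: "real ^ 'n \<Rightarrow> real"
  assumes "real_polynomial_function q"
  shows "\<exists>g. (\<forall>x. (q has_derivative (\<lambda>v. g x \<bullet> v)) (at x)) \<and> continuous_on UNIV g"
  using assms
proof (induction rule: real_polynomial_function.induct)
  case (linear f)
  then have d: "(f has_derivative f) (at x)" for x by (rule bounded_linear_imp_has_derivative)
  then have "f differentiable at x" for x by (auto simp: differentiable_def)
  then have "\<forall>x. (f has_derivative (\<lambda>v. grad f x \<bullet> v)) (at x)" by (auto intro: has_derivative_grad)
  moreover have "grad f = (\<lambda>x. \<chi> i. f (axis i 1))"
    by (simp add: grad_def[abs_def] partial_deriv_eq[OF d])
  then have "continuous_on UNIV (grad f)" by simp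
  ultimately show ?case by blast
next
  case (const c)
  show ?case by (intro exI[of _ "\<lambda>x. 0"]) auto
next
  case (add f g)
  then obtain f' g' where "\<And>x. (f has_derivative (\<lambda>v. f' x \<bullet> v)) (at x)" "continuous_on UNIV f'"
    "\<And>x. (g has_derivative (\<lambda>v. g' x \<bullet> v)) (at x)" "continuous_on UNIV g'" by blast
  then show ?case
    by (intro exI[of _ "\<lambda>x. f' x + g' x"]) (auto simp: inner_add_left intro!: derivative_eq_intros continuous_intros)
next
  case (mult f g)
  then obtain f' g' where d: "\<And>x. (f has_derivative (\<lambda>v. f' x \<bullet> v)) (at x)" "continuous_on UNIV f'"
    "\<And>x. (g has_derivative (\<lambda>v. g' x \<bullet> v)) (at x)" "continuous_on UNIV g'" by blast
  have "continuous_on UNIV f" "continuous_on UNIV g"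
    using d by (auto intro!: continuous_at_imp_continuous_on has_derivative_continuous)
  with d show ?case
    by (intro exI[of _ "\<lambda>x. f x *\<^sub>R g' x + g x *\<^sub>R f' x"])
      (auto simp: inner_add_left mult.commute intro!: derivative_eq_intros continuous_intros)
qed

lemma powr_young:
  fixes t D p :: real
  assumes "0 < t" "0 \<le> D" "1 < p"
  shows "t powr (p - 1) * D \<le> t powr p + D powr p"
proof (cases "D \<le> t")
  case True
  then have "t powr (p - 1) * D \<le> t powr (p - 1) * t" by (intro mult_left_mono) auto
  also have "\<dots> = t powr p" using assms by (simp add: powr_diff)
  finally show ?thesis by (simp add: add_increasing2)
next
  case False
  then have "t powr (p - 1) * D \<le> D powr (p - 1) * D" using assms by (intro mult_right_mono powr_mono2) auto
  also have "\<dots> = D powr p" using False assms by (simp add: powr_diff)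
  finally show ?thesis by (simp add: add_increasing)
qed

text \<open>With \<open>t = sqrt (1 + f\<^sup>2)\<close>, and \<open>D\<close> and \<open>L\<close> bounding the gradients of \<open>f\<close> and of the exponent \<open>q\<close>, the
  left-hand side bounds the gradient of \<open>t powr q\<close>.  The logarithm is absorbed by the factor
  \<open>t powr (\<sigma> / 2)\<close> that separates \<open>q\<close> from \<open>p\<close>.\<close>

lemma power_gradient_bound:
  fixes t f p q r \<sigma> L D :: real
  assumes t: "1 \<le> t" and f: "\<bar>f\<bar> \<le> t" and p: "1 < p" and q: "0 \<le> q" "q + \<sigma> / 2 \<le> p" "q \<le> r"
    and \<sigma>: "0 < \<sigma>" and L: "0 \<le> L" and D: "0 \<le> D"
  shows "t powr q * (ln t * L + q * \<bar>f\<bar> / t\<^sup>2 * D) \<le> (2 * L / \<sigma> + r) * (t powr p + D powr p)"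
proof -
  have "ln t * (\<sigma> / 2) = ln (t powr (\<sigma> / 2))" using t by (simp add: ln_powr)
  also have "\<dots> \<le> t powr (\<sigma> / 2)" using t ln_le_minus_one[of "t powr (\<sigma> / 2)"] by simp
  finally have "ln t \<le> 2 / \<sigma> * t powr (\<sigma> / 2)" using \<sigma> by (simp add: field_simps)
  then have "t powr q * ln t \<le> t powr q * (2 / \<sigma> * t powr (\<sigma> / 2))" by (intro mult_left_mono) auto
  also have "\<dots> = 2 / \<sigma> * t powr (q + \<sigma> / 2)" by (simp add: powr_add)
  also have "\<dots> \<le> 2 / \<sigma> * t powr p" using t q \<sigma> by (intro mult_left_mono powr_mono) auto
  finally have "t powr q * ln t * L \<le> 2 / \<sigma> * t powr p * L" using L by (rule mult_right_mono)
  also have "\<dots> = 2 * L / \<sigma> * t powr p" by simp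
  also have "\<dots> \<le> 2 * L / \<sigma> * (t powr p + D powr p)" using L \<sigma> by (intro mult_left_mono) auto
  finally have 1: "t powr q * ln t * L \<le> 2 * L / \<sigma> * (t powr p + D powr p)" .
  have "t powr q * (q * \<bar>f\<bar> / t\<^sup>2 * D) \<le> t powr q * (r * t / t\<^sup>2 * D)"
    using f q t D by (intro mult_left_mono mult_right_mono divide_right_mono mult_mono) auto
  also have "\<dots> = r * (t powr (q - 1) * D)" using t by (simp add: powr_diff power2_eq_square)
  also have "\<dots> \<le> r * (t powr (p - 1) * D)"
    using q \<sigma> t D by (intro mult_left_mono mult_right_mono powr_mono) auto
  also have "\<dots> \<le> r * (t powr p + D powr p)" using t D p q by (intro mult_left_mono powr_young) auto
  finally have "t powr q * (q * \<bar>f\<bar> / t\<^sup>2 * D) \<le> r * (t powr p + D powr p)" .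
  with 1 show ?thesis by (simp add: algebra_simps)
qed

lemma powr_add_le:
  fixes a b q r :: real
  assumes "0 \<le> a" "0 \<le> b" "0 \<le> q" "q \<le> r"
  shows "(a + b) powr q \<le> 2 powr r * (a powr q + b powr q)"
proof -
  have "(a + b) powr q \<le> (2 * max a b) powr q" using assms by (intro powr_mono2) auto
  also have "\<dots> = 2 powr q * max a b powr q" by (simp add: powr_mult)
  also have "\<dots> \<le> 2 powr r * (a powr q + b powr q)"
    using assms by (intro mult_mono powr_mono) (auto simp: max_def)
  finally show ?thesis .
qed

locale exponent_domain =
  fixes \<Omega> :: "(real ^ 'n) set" and p :: "real ^ 'n \<Rightarrow> real" and pmin pmax :: real
  assumes open_domain: "open \<Omega>" and bounded_domain: "bounded \<Omega>"
    and exponent_continuous: "continuous_on (closure \<Omega>) p"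
    and exponent_lower: "1 < pmin" and exponent_range: "x \<in> closure \<Omega> \<Longrightarrow> pmin \<le> p x \<and> p x \<le> pmax"
begin

lemma domain_lmeasurable: "\<Omega> \<in> lmeasurable"
  using open_domain bounded_domain by (simp add: lmeasurable_open)

lemma domain_sets [simp, measurable]: "\<Omega> \<in> sets lebesgue" "\<Omega> \<in> sets borel"
  using open_domain by auto

sublocale variable_exponent "lebesgue_on \<Omega>" p pmin pmax
proof (intro variable_exponent.intro variable_exponent_axioms.intro)
  show "finite_measure (lebesgue_on \<Omega>)" by (rule finite_measure_lebesgue_on[OF domain_lmeasurable])
  show "p \<in> borel_measurable (lebesgue_on \<Omega>)"
    by (intro continuous_imp_measurable_on_sets_lebesgue continuous_on_subset[OF exponent_continuous] closure_subset) simp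
  show "x \<in> space (lebesgue_on \<Omega>) \<Longrightarrow> pmin \<le> p x \<and> p x \<le> pmax" for x
    using exponent_range[of x] closure_subset[of \<Omega>] by auto
qed (rule exponent_lower)

lemma borel_measurable_domain: "f \<in> borel_measurable borel \<Longrightarrow> f \<in> borel_measurable (lebesgue_on \<Omega>)"
  by (intro measurable_restrict_space1 measurable_completion) simp

lemma nn_integral_domain:
  assumes "\<And>x. x \<notin> \<Omega> \<Longrightarrow> f x = 0"
  shows "(\<integral>\<^sup>+ x. f x \<partial>lebesgue_on \<Omega>) = (\<integral>\<^sup>+ x. f x \<partial>lborel)"
proof -
  have "(\<integral>\<^sup>+ x. f x \<partial>lebesgue_on \<Omega>) = (\<integral>\<^sup>+ x. f x * indicator \<Omega> x \<partial>lebesgue)"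
    by (rule nn_integral_restrict_space) simp
  also have "\<dots> = (\<integral>\<^sup>+ x. f x \<partial>lebesgue)"
    using assms by (intro nn_integral_cong) (auto simp: indicator_def)
  finally show ?thesis by (simp add: nn_integral_completion)
qed

lemma test_function_zero_outside:
  assumes "\<phi> \<in> test_functions \<Omega>" "x \<notin> \<Omega>"
  shows "\<phi> x = 0" "grad \<phi> x = 0"
proof -
  have "x \<notin> closure {x. \<phi> x \<noteq> 0}" using assms by (auto simp: test_functions_def)
  then show "\<phi> x = 0" "grad \<phi> x = 0"
    using closure_subset[of "{x. \<phi> x \<noteq> 0}"] C1_compact_grad_support[OF test_function_C1_compact[OF assms(1)]]
    by auto
qed

lemma test_function_measurable:
  assumes "\<phi> \<in> test_functions \<Omega>"
  shows "\<phi> \<in> borel_measurable (lebesgue_on \<Omega>)" "grad \<phi> \<in> borel_measurable (lebesgue_on \<Omega>)"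
  using C1_compactD(4,5)[OF test_function_C1_compact[OF assms]] by (auto intro: borel_measurable_domain)

lemma rho_bounded_finite:
  assumes "\<And>x. norm (f x) \<le> B"
  shows "rho f < \<infinity>"
proof -
  have "rho f \<le> (\<integral>\<^sup>+ x. ennreal ((1 + B) powr pmax) \<partial>lebesgue_on \<Omega>)"
    unfolding rho_def
  proof (intro nn_integral_mono ennreal_leI)
    fix x assume x: "x \<in> space (lebesgue_on \<Omega>)"
    have B: "0 \<le> B" using assms[of x] norm_ge_zero order_trans by blast
    have "norm (f x) powr p x / p x \<le> norm (f x) powr p x"
      using exponent_gt_1[OF x] by (simp add: divide_le_eq mult_le_cancel_left1)
    also have "\<dots> \<le> (1 + B) powr p x"
      using assms[of x] exponent_gt_1[OF x] by (intro powr_mono2) auto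
    also have "\<dots> \<le> (1 + B) powr pmax" using B exponent_bounds[OF x] by (intro powr_mono) auto
    finally show "norm (f x) powr p x / p x \<le> (1 + B) powr pmax" .
  qed
  also have "\<dots> < \<infinity>" by (simp add: ennreal_mult_less_top emeasure_eq_measure)
  finally show ?thesis .
qed

lemma test_function_rho_finite:
  assumes "\<phi> \<in> test_functions \<Omega>"
  shows "rho \<phi> < \<infinity>" "rho (grad \<phi>) < \<infinity>"
proof -
  obtain B where "\<And>x. \<bar>\<phi> x\<bar> \<le> B" "\<And>x. norm (grad \<phi> x) \<le> B"
    using C1_compact_bounded[OF test_function_C1_compact[OF assms]] by metis
  then show "rho \<phi> < \<infinity>" "rho (grad \<phi>) < \<infinity>"
    using rho_bounded_finite[of \<phi> B] rho_bounded_finite[of "grad \<phi>" B] by auto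
qed

lemma powr_integral_le_rho:
  assumes [measurable]: "f \<in> borel_measurable (lebesgue_on \<Omega>)"
  shows "(\<integral>\<^sup>+ x. ennreal (norm (f x) powr p x) \<partial>lebesgue_on \<Omega>) \<le> ennreal pmax * rho f"
proof -
  have "(\<integral>\<^sup>+ x. ennreal (norm (f x) powr p x) \<partial>lebesgue_on \<Omega>)
     \<le> (\<integral>\<^sup>+ x. ennreal pmax * ennreal (norm (f x) powr p x / p x) \<partial>lebesgue_on \<Omega>)"
  proof (rule nn_integral_mono)
    fix x assume x: "x \<in> space (lebesgue_on \<Omega>)"
    have "norm (f x) powr p x = p x * (norm (f x) powr p x / p x)" using exponent_pos[OF x] by simp
    also have "\<dots> \<le> pmax * (norm (f x) powr p x / p x)"
      using exponent_bounds[OF x] exponent_pos[OF x] by (intro mult_right_mono) auto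
    finally show "ennreal (norm (f x) powr p x) \<le> ennreal pmax * ennreal (norm (f x) powr p x / p x)"
      using exponent_bounds[OF x] exponent_pos[OF x] by (simp add: ennreal_leI flip: ennreal_mult)
  qed
  also have "\<dots> = ennreal pmax * rho f" unfolding rho_def by (rule nn_integral_cmult) measurable
  finally show ?thesis .
qed

section \<open>Compact embedding for test functions\<close>

lemma smooth_exponent_below:
  assumes "0 < \<sigma>"
  obtains q g where "\<And>x. (q has_derivative (\<lambda>v. g x \<bullet> v)) (at x)" "continuous_on UNIV q" "continuous_on UNIV g"
    "\<And>x. x \<in> \<Omega> \<Longrightarrow> p x - \<sigma> \<le> q x \<and> q x + \<sigma> / 2 \<le> p x"
proof -
  have "compact (closure \<Omega>)" using bounded_domain by simp
  moreover have "continuous_on (closure \<Omega>) (\<lambda>x. p x - 3 * \<sigma> / 4)"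
    by (intro continuous_intros exponent_continuous)
  ultimately obtain q where q: "real_polynomial_function q"
    and close: "\<And>x. x \<in> closure \<Omega> \<Longrightarrow> \<bar>p x - 3 * \<sigma> / 4 - q x\<bar> < \<sigma> / 4"
    using Stone_Weierstrass_real_polynomial_function[of "closure \<Omega>" "\<lambda>x. p x - 3 * \<sigma> / 4" "\<sigma> / 4"] assms by auto
  obtain g where g: "\<And>x. (q has_derivative (\<lambda>v. g x \<bullet> v)) (at x)" "continuous_on UNIV g"
    using real_polynomial_function_C1[OF q] by blast
  have "continuous_on UNIV q" using g(1) by (auto intro!: continuous_at_imp_continuous_on has_derivative_continuous)
  moreover have "p x - \<sigma> \<le> q x \<and> q x + \<sigma> / 2 \<le> p x" if "x \<in> \<Omega>" for x
  proof -
    have "x \<in> closure \<Omega>" using that closure_subset by blast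
    from close[OF this] show ?thesis by linarith
  qed
  ultimately show ?thesis using that g by blast
qed

text \<open>Gain of integrability.  With a smooth exponent \<open>q\<close> slightly below \<open>p\<close>, the function
  \<open>(1 + \<phi>\<^sup>2) powr (q / 2) - 1\<close> has compact support, and Young's inequality bounds its
  \<open>W\<^sup>1\<^sup>,\<^sup>1\<close> norm through the modulars of \<open>\<phi>\<close> and \<open>grad \<phi>\<close>; the logarithm that comes from
  differentiating the exponent is absorbed by the distance of \<open>q\<close> to \<open>p\<close>.  The higher integrability
  of \<open>W\<^sup>1\<^sup>,\<^sup>1\<close> functions then more than makes up for that distance.\<close>

lemma test_function_higher_integrability:
  assumes B: "0 \<le> B"
  obtains \<theta> C where "0 < \<theta>" "0 \<le> C" "\<And>\<phi>. \<phi> \<in> test_functions \<Omega> \<Longrightarrow> rho \<phi> \<le> ennreal B \<Longrightarrow> rho (grad \<phi>) \<le> ennreal B \<Longrightarrow>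
    (\<integral>\<^sup>+ x. ennreal (\<bar>\<phi> x\<bar> powr (p x + \<theta>)) \<partial>lebesgue_on \<Omega>) \<le> ennreal C"
proof -
  define \<tau> where "\<tau> = 1 / (2 * real CARD('n))"
  have card: "1 \<le> real CARD('n)" by (metis One_nat_def Suc_leI of_nat_1 of_nat_le_iff zero_less_card_finite)
  have "1 \<le> 2 * real CARD('n)" using card by linarith
  then have tau: "0 < \<tau>" "\<tau> \<le> 1"
    unfolding \<tau>_def by (metis divide_pos_pos less_le_trans zero_less_one, metis divide_le_eq_1_pos less_le_trans zero_less_one)
  \<comment> \<open>so small that \<open>(p - \<sigma>) * (1 + \<tau>) \<ge> p + \<tau> / 2\<close>, as \<open>p \<ge> 1\<close> and \<open>\<tau> \<le> 1\<close>\<close>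
  define \<sigma> where "\<sigma> = \<tau> / 4"
  have sig: "0 < \<sigma>" "\<sigma> \<le> 1" using tau by (auto simp: \<sigma>_def)
  obtain q gq where gq: "\<And>x. (q has_derivative (\<lambda>v. gq x \<bullet> v)) (at x)" and q_cont: "continuous_on UNIV q"
    and gq_cont: "continuous_on UNIV gq" and q: "\<And>x. x \<in> \<Omega> \<Longrightarrow> p x - \<sigma> \<le> q x \<and> q x + \<sigma> / 2 \<le> p x"
    using smooth_exponent_below[OF sig(1)] by blast
  have "compact (gq ` closure \<Omega>)"
    using bounded_domain by (intro compact_continuous_image continuous_on_subset[OF gq_cont]) auto
  then obtain L where L: "0 < L" "\<And>x. x \<in> closure \<Omega> \<Longrightarrow> norm (gq x) \<le> L"
    by (auto dest!: compact_imp_bounded simp: bounded_pos)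
  define c where "c = (1 + 2 * L / \<sigma> + \<bar>pmax\<bar>) * 2 powr pmax"
  have c: "0 < c" using L sig by (auto simp: c_def intro!: mult_pos_pos add_pos_nonneg)
  define A where "A = c * (measure (lebesgue_on \<Omega>) \<Omega> + 2 * \<bar>pmax\<bar> * B) + 1"
  have A: "0 < A" using c B by (auto simp: A_def intro!: add_nonneg_pos mult_nonneg_nonneg add_nonneg_nonneg)
  obtain C0 where C0: "\<And>(w :: real ^ 'n \<Rightarrow> real) g. C1_compact w g \<Longrightarrow>
    (\<integral>\<^sup>+ x. ennreal \<bar>w x\<bar> \<partial>lborel) \<le> ennreal A \<Longrightarrow> (\<integral>\<^sup>+ x. ennreal (norm (g x)) \<partial>lborel) \<le> ennreal A \<Longrightarrow>
    (\<integral>\<^sup>+ x. ennreal (\<bar>w x\<bar> powr (1 + \<tau>)) \<partial>lborel) \<le> ennreal C0"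
    using C1_compact_higher_integrability[OF A \<tau>_def] by blast
  define C where "C = 4 * (\<bar>C0\<bar> + measure (lebesgue_on \<Omega>) \<Omega>)"
  show ?thesis
  proof (rule that[of "\<tau> / 2" C])
    show "0 < \<tau> / 2" using tau by simp
    show "0 \<le> C" by (simp add: C_def)
    fix \<phi> assume \<phi>: "\<phi> \<in> test_functions \<Omega>" and rho: "rho \<phi> \<le> ennreal B" "rho (grad \<phi>) \<le> ennreal B"
    note \<phi>_C1 = test_function_C1_compact[OF \<phi>]
    note [measurable] = test_function_measurable[OF \<phi>]
    define w where "w x = (1 + (\<phi> x)\<^sup>2) powr (q x / 2) - 1" for x
    define g where "g x = ((1 + (\<phi> x)\<^sup>2) powr (q x / 2)) *\<^sub>R
      ((ln (1 + (\<phi> x)\<^sup>2) / 2) *\<^sub>R gq x + (q x * \<phi> x / (1 + (\<phi> x)\<^sup>2)) *\<^sub>R grad \<phi> x)" for x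
    have pos: "0 < 1 + (\<phi> x)\<^sup>2" for x by (simp add: add_pos_nonneg)
    have w: "C1_compact w g"
      unfolding C1_compact_def
    proof (intro conjI allI)
      fix x
      have d1: "((\<lambda>x. 1 + (\<phi> x)\<^sup>2) has_derivative (\<lambda>v. 2 * \<phi> x * (grad \<phi> x \<bullet> v))) (at x)"
        using C1_compactD(1)[OF \<phi>_C1, of x] by (auto intro!: derivative_eq_intros)
      have d2: "((\<lambda>x. q x / 2) has_derivative (\<lambda>v. (gq x \<bullet> v) / 2)) (at x)"
        using gq[of x] by (auto intro!: derivative_eq_intros)
      have "((\<lambda>x. (1 + (\<phi> x)\<^sup>2) powr (q x / 2)) has_derivative
         (\<lambda>v. (1 + (\<phi> x)\<^sup>2) powr (q x / 2) * ((gq x \<bullet> v) / 2 * ln (1 + (\<phi> x)\<^sup>2)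
            + 2 * \<phi> x * (grad \<phi> x \<bullet> v) * (q x / 2) / (1 + (\<phi> x)\<^sup>2)))) (at x)"
        by (rule has_derivative_powr[OF d1 d2 pos]) simp
      then show "(w has_derivative (\<lambda>v. g x \<bullet> v)) (at x)"
        unfolding w_def by (rule has_derivative_eq_rhs[OF has_derivative_diff[OF _ has_derivative_const]])
          (auto simp: g_def inner_add_left algebra_simps)
    next
      have c: "continuous_on UNIV \<phi>" "continuous_on UNIV (grad \<phi>)"
        using C1_compactD(2,3)[OF \<phi>_C1] by auto
      show "continuous_on UNIV g"
        unfolding g_def[abs_def] using pos
        by (intro continuous_intros c q_cont gq_cont) (auto simp: less_imp_neq[symmetric])
      have "closure {x. w x \<noteq> 0} \<subseteq> closure {x. \<phi> x \<noteq> 0}" by (intro closure_mono) (auto simp: w_def)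
      then show "compact (closure {x. w x \<noteq> 0})"
        using \<phi>_C1 compact_Int_closed[OF _ closed_closure, of "closure {x. \<phi> x \<noteq> 0}" "{x. w x \<noteq> 0}"]
        by (simp add: C1_compact_def inf.absorb2)
    qed
    have zero: "w x = 0" "g x = 0" if "x \<notin> \<Omega>" for x
      using test_function_zero_outside[OF \<phi> that] by (auto simp: w_def g_def)
    define H where "H x = 1 + \<bar>\<phi> x\<bar> powr p x + norm (grad \<phi> x) powr p x" for x
    have bounds: "\<bar>w x\<bar> \<le> c * H x" "norm (g x) \<le> c * H x" "\<bar>\<phi> x\<bar> powr (p x + \<tau> / 2) \<le> 4 * (\<bar>w x\<bar> powr (1 + \<tau>) + 1)"
      if x: "x \<in> \<Omega>" for x
    proof -
      have xs: "x \<in> space (lebesgue_on \<Omega>)" using x by simp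
      note px = exponent_gt_1[OF xs] exponent_bounds[OF xs]
      have qx: "0 \<le> q x" "q x + \<sigma> / 2 \<le> p x" "q x \<le> p x" "q x \<le> pmax" "p x - \<sigma> \<le> q x"
        using q[OF x] px sig by linarith+
      define t where "t = sqrt (1 + (\<phi> x)\<^sup>2)"
      have t: "1 \<le> t" "t\<^sup>2 = 1 + (\<phi> x)\<^sup>2" "\<bar>\<phi> x\<bar> \<le> t"
        using pos[of x] by (auto simp: t_def intro!: real_le_rsqrt)
      have tq: "(1 + (\<phi> x)\<^sup>2) powr (q x / 2) = t powr q x"
        using pos[of x] by (simp add: t_def powr_half_sqrt[symmetric] powr_powr)
      have lnt: "ln (1 + (\<phi> x)\<^sup>2) / 2 = ln t" using pos[of x] by (simp add: t_def ln_sqrt)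
      have "t \<le> 1 + \<bar>\<phi> x\<bar>"
        unfolding t_def by (intro real_le_lsqrt) (auto simp: power2_eq_square algebra_simps)
      then have "t powr p x \<le> (1 + \<bar>\<phi> x\<bar>) powr p x" using t px by (intro powr_mono2) auto
      also have "\<dots> \<le> 2 powr pmax * (1 powr p x + \<bar>\<phi> x\<bar> powr p x)" using px by (intro powr_add_le) auto
      finally have tp: "t powr p x \<le> 2 powr pmax * (1 + \<bar>\<phi> x\<bar> powr p x)" by simp
      have two: "1 \<le> 2 powr pmax" using px by (intro ge_one_powr_ge_zero) auto
      have tpD: "t powr p x + norm (grad \<phi> x) powr p x \<le> 2 powr pmax * H x"
        using tp mult_right_mono[OF two, of "norm (grad \<phi> x) powr p x"] by (simp add: H_def algebra_simps)
      have nn: "0 \<le> 2 * L / \<sigma>" using L sig by simp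
      have tq1: "1 \<le> t powr q x" using t qx by (intro ge_one_powr_ge_zero) auto
      have w_eq: "\<bar>w x\<bar> = t powr q x - 1" using tq1 by (simp add: w_def tq)
      have "\<bar>w x\<bar> \<le> 1 * (t powr p x + norm (grad \<phi> x) powr p x)"
      proof -
        have "\<bar>w x\<bar> \<le> t powr p x" using w_eq powr_mono[OF qx(3) t(1)] by linarith
        then show ?thesis by (simp add: add_increasing2)
      qed
      also have "\<dots> \<le> (1 + 2 * L / \<sigma> + \<bar>pmax\<bar>) * (t powr p x + norm (grad \<phi> x) powr p x)"
        using nn by (intro mult_right_mono) auto
      also have "\<dots> \<le> (1 + 2 * L / \<sigma> + \<bar>pmax\<bar>) * (2 powr pmax * H x)"
        using nn by (intro mult_left_mono tpD) auto
      finally show "\<bar>w x\<bar> \<le> c * H x" by (simp add: c_def ac_simps)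
      have "norm (g x) \<le> t powr q x * (\<bar>ln t\<bar> * norm (gq x) + \<bar>q x * \<phi> x / t\<^sup>2\<bar> * norm (grad \<phi> x))"
      proof -
        have "g x = t powr q x *\<^sub>R (ln t *\<^sub>R gq x + (q x * \<phi> x / t\<^sup>2) *\<^sub>R grad \<phi> x)"
          by (simp only: g_def tq lnt t(2))
        then have "norm (g x) = t powr q x * norm (ln t *\<^sub>R gq x + (q x * \<phi> x / t\<^sup>2) *\<^sub>R grad \<phi> x)"
          by (simp only: norm_scaleR abs_of_nonneg[OF powr_ge_zero])
        also have "\<dots> \<le> t powr q x * (norm (ln t *\<^sub>R gq x) + norm ((q x * \<phi> x / t\<^sup>2) *\<^sub>R grad \<phi> x))"
          by (intro mult_left_mono norm_triangle_ineq) auto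
        finally show ?thesis by (simp only: norm_scaleR)
      qed
      also have "\<dots> = t powr q x * (ln t * norm (gq x) + q x * \<bar>\<phi> x\<bar> / t\<^sup>2 * norm (grad \<phi> x))"
        using t qx by (simp add: abs_mult abs_divide)
      also have "\<dots> \<le> t powr q x * (ln t * L + q x * \<bar>\<phi> x\<bar> / t\<^sup>2 * norm (grad \<phi> x))"
        using t L(2)[of x] x closure_subset[of \<Omega>] by (intro mult_left_mono add_right_mono) auto
      also have "\<dots> \<le> (2 * L / \<sigma> + pmax) * (t powr p x + norm (grad \<phi> x) powr p x)"
        using t px qx sig L by (intro power_gradient_bound) auto
      also have "\<dots> \<le> (1 + 2 * L / \<sigma> + \<bar>pmax\<bar>) * (t powr p x + norm (grad \<phi> x) powr p x)"
        by (intro mult_right_mono) auto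
      also have "\<dots> \<le> (1 + 2 * L / \<sigma> + \<bar>pmax\<bar>) * (2 powr pmax * H x)"
        using nn by (intro mult_left_mono tpD) auto
      finally show "norm (g x) \<le> c * H x" by (simp add: c_def ac_simps)
      have "p x + \<tau> / 2 \<le> q x * (1 + \<tau>)"
      proof -
        have "p x + \<tau> / 2 \<le> (p x - \<sigma>) * (1 + \<tau>)"
        proof -
          have "\<tau> * 1 \<le> \<tau> * p x" "\<tau> * \<tau> \<le> 1 * \<tau>" using px tau by (auto intro: mult_left_mono mult_right_mono)
          moreover have "(p x - \<sigma>) * (1 + \<tau>) = p x + \<tau> * p x - \<tau> / 4 - \<tau> * \<tau> / 4"
            by (simp add: \<sigma>_def field_simps)
          ultimately show ?thesis using tau(1) by linarith
        qed
        also have "\<dots> \<le> q x * (1 + \<tau>)" using qx tau by (intro mult_right_mono) auto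
        finally show ?thesis .
      qed
      have "\<bar>\<phi> x\<bar> powr (p x + \<tau> / 2) \<le> t powr (p x + \<tau> / 2)"
        using t px tau by (intro powr_mono2) auto
      also have "\<dots> \<le> t powr (q x * (1 + \<tau>))" using \<open>p x + \<tau> / 2 \<le> q x * (1 + \<tau>)\<close> t by (intro powr_mono) auto
      also have "\<dots> = (\<bar>w x\<bar> + 1) powr (1 + \<tau>)" by (simp add: w_eq powr_powr)
      also have "\<dots> \<le> 2 powr 2 * (\<bar>w x\<bar> powr (1 + \<tau>) + 1 powr (1 + \<tau>))"
        using tau by (intro powr_add_le) auto
      finally show "\<bar>\<phi> x\<bar> powr (p x + \<tau> / 2) \<le> 4 * (\<bar>w x\<bar> powr (1 + \<tau>) + 1)" by simp
    qed
    have H_int: "(\<integral>\<^sup>+ x. ennreal (c * H x) \<partial>lebesgue_on \<Omega>) \<le> ennreal A"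
    proof -
      have "(\<integral>\<^sup>+ x. ennreal (c * H x) \<partial>lebesgue_on \<Omega>)
        = (\<integral>\<^sup>+ x. ennreal c * ((1 + ennreal (norm (\<phi> x) powr p x)) + ennreal (norm (grad \<phi> x) powr p x)) \<partial>lebesgue_on \<Omega>)"
        using c by (intro nn_integral_cong) (simp add: H_def ennreal_mult)
      also have "\<dots> = ennreal c * ((emeasure (lebesgue_on \<Omega>) \<Omega> + (\<integral>\<^sup>+ x. ennreal (norm (\<phi> x) powr p x) \<partial>lebesgue_on \<Omega>))
          + (\<integral>\<^sup>+ x. ennreal (norm (grad \<phi> x) powr p x) \<partial>lebesgue_on \<Omega>))"
        by (simp add: nn_integral_cmult nn_integral_add)
      also have "\<dots> \<le> ennreal c * ((ennreal (measure (lebesgue_on \<Omega>) \<Omega>) + ennreal \<bar>pmax\<bar> * ennreal B) + ennreal \<bar>pmax\<bar> * ennreal B)"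
      proof (intro mult_left_mono add_mono)
        show "(\<integral>\<^sup>+ x. ennreal (norm (\<phi> x) powr p x) \<partial>lebesgue_on \<Omega>) \<le> ennreal \<bar>pmax\<bar> * ennreal B"
          by (rule order_trans[OF powr_integral_le_rho mult_mono]) (auto intro: ennreal_leI rho)
        show "(\<integral>\<^sup>+ x. ennreal (norm (grad \<phi> x) powr p x) \<partial>lebesgue_on \<Omega>) \<le> ennreal \<bar>pmax\<bar> * ennreal B"
          by (rule order_trans[OF powr_integral_le_rho mult_mono]) (auto intro: ennreal_leI rho)
      qed (simp_all add: emeasure_eq_measure)
      also have "\<dots> = ennreal (c * (measure (lebesgue_on \<Omega>) \<Omega> + \<bar>pmax\<bar> * B + \<bar>pmax\<bar> * B))"
        using c B by (simp flip: ennreal_mult ennreal_plus)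
      also have "\<dots> \<le> ennreal A" by (intro ennreal_leI) (simp add: A_def algebra_simps)
      finally show ?thesis .
    qed
    have "(\<integral>\<^sup>+ x. ennreal (\<bar>w x\<bar> powr (1 + \<tau>)) \<partial>lborel) \<le> ennreal C0"
    proof (rule C0[OF w])
      have "(\<integral>\<^sup>+ x. ennreal \<bar>w x\<bar> \<partial>lebesgue_on \<Omega>) \<le> (\<integral>\<^sup>+ x. ennreal (c * H x) \<partial>lebesgue_on \<Omega>)"
        using bounds(1) by (intro nn_integral_mono ennreal_leI) auto
      then show "(\<integral>\<^sup>+ x. ennreal \<bar>w x\<bar> \<partial>lborel) \<le> ennreal A"
        using nn_integral_domain[of "\<lambda>x. ennreal \<bar>w x\<bar>"] zero H_int by (simp add: order_trans)
      have "(\<integral>\<^sup>+ x. ennreal (norm (g x)) \<partial>lebesgue_on \<Omega>) \<le> (\<integral>\<^sup>+ x. ennreal (c * H x) \<partial>lebesgue_on \<Omega>)"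
        using bounds(2) by (intro nn_integral_mono ennreal_leI) auto
      then show "(\<integral>\<^sup>+ x. ennreal (norm (g x)) \<partial>lborel) \<le> ennreal A"
        using nn_integral_domain[of "\<lambda>x. ennreal (norm (g x))"] zero H_int by (simp add: order_trans)
    qed
    then have w_int: "(\<integral>\<^sup>+ x. ennreal (\<bar>w x\<bar> powr (1 + \<tau>)) \<partial>lebesgue_on \<Omega>) \<le> ennreal \<bar>C0\<bar>"
      using nn_integral_domain[of "\<lambda>x. ennreal (\<bar>w x\<bar> powr (1 + \<tau>))"] zero
      by (auto intro: order_trans ennreal_leI)
    have [measurable]: "w \<in> borel_measurable (lebesgue_on \<Omega>)"
      by (rule borel_measurable_domain[OF C1_compactD(4)[OF w]])
    have "(\<integral>\<^sup>+ x. ennreal (\<bar>\<phi> x\<bar> powr (p x + \<tau> / 2)) \<partial>lebesgue_on \<Omega>)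
       \<le> (\<integral>\<^sup>+ x. ennreal 4 * (ennreal (\<bar>w x\<bar> powr (1 + \<tau>)) + 1) \<partial>lebesgue_on \<Omega>)"
    proof (rule nn_integral_mono)
      fix x assume "x \<in> space (lebesgue_on \<Omega>)"
      then have "ennreal (\<bar>\<phi> x\<bar> powr (p x + \<tau> / 2)) \<le> ennreal (4 * (\<bar>w x\<bar> powr (1 + \<tau>) + 1))"
        using bounds(3)[of x] by (intro ennreal_leI) auto
      also have "\<dots> = ennreal 4 * (ennreal (\<bar>w x\<bar> powr (1 + \<tau>)) + 1)"
        by (subst ennreal_mult) auto
      finally show "ennreal (\<bar>\<phi> x\<bar> powr (p x + \<tau> / 2)) \<le> ennreal 4 * (ennreal (\<bar>w x\<bar> powr (1 + \<tau>)) + 1)" .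
    qed
    also have "\<dots> = ennreal 4 * ((\<integral>\<^sup>+ x. ennreal (\<bar>w x\<bar> powr (1 + \<tau>)) \<partial>lebesgue_on \<Omega>) + emeasure (lebesgue_on \<Omega>) \<Omega>)"
      by (simp add: nn_integral_cmult nn_integral_add)
    also have "\<dots> \<le> ennreal 4 * (ennreal \<bar>C0\<bar> + ennreal (measure (lebesgue_on \<Omega>) \<Omega>))"
      by (intro mult_left_mono add_mono w_int) (auto simp: emeasure_eq_measure)
    also have "\<dots> = ennreal C" unfolding C_def by (subst ennreal_mult) auto
    finally show "(\<integral>\<^sup>+ x. ennreal (\<bar>\<phi> x\<bar> powr (p x + \<tau> / 2)) \<partial>lebesgue_on \<Omega>) \<le> ennreal C" .
  qed
qed

lemma norm_integral_bounded:
  fixes B :: real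
  shows "\<exists>A>0. \<forall>f :: real ^ 'n \<Rightarrow> 'b::euclidean_space. f \<in> borel_measurable (lebesgue_on \<Omega>) \<longrightarrow> rho f \<le> ennreal B \<longrightarrow>
    (\<integral>\<^sup>+ x. ennreal (norm (f x)) \<partial>lebesgue_on \<Omega>) \<le> ennreal A"
proof (intro exI conjI allI impI)
  show "0 < measure (lebesgue_on \<Omega>) \<Omega> + \<bar>pmax\<bar> * \<bar>B\<bar> + 1" by (intro add_nonneg_pos add_nonneg_nonneg) auto
  fix f :: "real ^ 'n \<Rightarrow> 'b" assume f: "f \<in> borel_measurable (lebesgue_on \<Omega>)" "rho f \<le> ennreal B"
  have "(\<integral>\<^sup>+ x. ennreal (norm (f x)) \<partial>lebesgue_on \<Omega>)
      \<le> ennreal (measure (lebesgue_on \<Omega>) \<Omega>) + ennreal pmax * rho f"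
    using norm_integral_le_rho[OF f(1), of 1] by simp
  also have "\<dots> \<le> ennreal (measure (lebesgue_on \<Omega>) \<Omega>) + ennreal \<bar>pmax\<bar> * ennreal \<bar>B\<bar>"
    using f(2) by (intro add_mono mult_mono order_refl order_trans[OF f(2)] ennreal_leI) auto
  also have "\<dots> = ennreal (measure (lebesgue_on \<Omega>) \<Omega> + \<bar>pmax\<bar> * \<bar>B\<bar>)" by (simp add: ennreal_mult)
  also have "\<dots> \<le> ennreal (measure (lebesgue_on \<Omega>) \<Omega> + \<bar>pmax\<bar> * \<bar>B\<bar> + 1)" by (intro ennreal_leI) simp
  finally show "(\<integral>\<^sup>+ x. ennreal (norm (f x)) \<partial>lebesgue_on \<Omega>) \<le> ennreal (measure (lebesgue_on \<Omega>) \<Omega> + \<bar>pmax\<bar> * \<bar>B\<bar> + 1)" .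
qed

text \<open>Interpolation: where a function is below a level \<open>T\<close>, its modular is controlled by its \<open>L\<^sup>1\<close> norm;
  above it, by the integral of a slightly higher power, with a factor that tends to zero as \<open>T\<close> grows.\<close>

lemma rho_interpolation:
  fixes f :: "real ^ 'n \<Rightarrow> real"
  assumes [measurable]: "f \<in> borel_measurable (lebesgue_on \<Omega>)" and T: "1 \<le> T" and \<theta>: "0 < \<theta>"
  shows "rho f \<le> ennreal (T powr pmax) * (\<integral>\<^sup>+ x. ennreal \<bar>f x\<bar> \<partial>lebesgue_on \<Omega>)
    + ennreal (T powr (- \<theta>)) * (\<integral>\<^sup>+ x. ennreal (\<bar>f x\<bar> powr (p x + \<theta>)) \<partial>lebesgue_on \<Omega>)"
proof -
  have "rho f \<le> (\<integral>\<^sup>+ x. ennreal (T powr pmax) * ennreal \<bar>f x\<bar>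
     + ennreal (T powr (- \<theta>)) * ennreal (\<bar>f x\<bar> powr (p x + \<theta>)) \<partial>lebesgue_on \<Omega>)"
    unfolding rho_def
  proof (rule nn_integral_mono)
    fix x assume x: "x \<in> space (lebesgue_on \<Omega>)"
    note px = exponent_gt_1[OF x] exponent_bounds[OF x]
    have "\<bar>f x\<bar> powr p x \<le> T powr pmax * \<bar>f x\<bar> + T powr (- \<theta>) * \<bar>f x\<bar> powr (p x + \<theta>)"
    proof (cases "\<bar>f x\<bar> \<le> T")
      case True
      have "\<bar>f x\<bar> powr p x = \<bar>f x\<bar> powr (p x - 1) * \<bar>f x\<bar>" using px by (cases "f x = 0") (auto simp: powr_diff)
      also have "\<dots> \<le> T powr (p x - 1) * \<bar>f x\<bar>" using True px by (intro mult_right_mono powr_mono2) auto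
      also have "\<dots> \<le> T powr pmax * \<bar>f x\<bar>" using T px by (intro mult_right_mono powr_mono) auto
      finally show ?thesis by (simp add: add_increasing2)
    next
      case False
      have "\<bar>f x\<bar> powr p x = \<bar>f x\<bar> powr (- \<theta>) * \<bar>f x\<bar> powr (p x + \<theta>)" by (simp flip: powr_add)
      also have "\<dots> \<le> T powr (- \<theta>) * \<bar>f x\<bar> powr (p x + \<theta>)"
        using False T \<theta> by (intro mult_right_mono powr_mono2') auto
      finally show ?thesis using T by (simp add: add_increasing)
    qed
    moreover have "\<bar>f x\<bar> powr p x / p x \<le> \<bar>f x\<bar> powr p x"
      using px by (simp add: divide_le_eq mult_le_cancel_left1)
    ultimately have "ennreal (norm (f x) powr p x / p x) \<le> ennreal (T powr pmax * \<bar>f x\<bar> + T powr (- \<theta>) * \<bar>f x\<bar> powr (p x + \<theta>))"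
      by (intro ennreal_leI) auto
    then show "ennreal (norm (f x) powr p x / p x) \<le> ennreal (T powr pmax) * ennreal \<bar>f x\<bar>
        + ennreal (T powr (- \<theta>)) * ennreal (\<bar>f x\<bar> powr (p x + \<theta>))"
      by (simp add: ennreal_mult)
  qed
  also have "\<dots> = ennreal (T powr pmax) * (\<integral>\<^sup>+ x. ennreal \<bar>f x\<bar> \<partial>lebesgue_on \<Omega>)
    + ennreal (T powr (- \<theta>)) * (\<integral>\<^sup>+ x. ennreal (\<bar>f x\<bar> powr (p x + \<theta>)) \<partial>lebesgue_on \<Omega>)"
    by (simp add: nn_integral_cmult nn_integral_add)
  finally show ?thesis .
qed

text \<open>Rellich's theorem makes a subsequence Cauchy in \<open>L\<^sup>1\<close>, and the higher integrability of the differences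
  makes it Cauchy in the modular, by interpolation.\<close>

lemma test_function_compactness:
  assumes \<phi>: "\<And>k. \<phi> k \<in> test_functions \<Omega>" and B: "0 \<le> B"
    and rho: "\<And>k. rho (\<phi> k) \<le> ennreal B" "\<And>k. rho (grad (\<phi> k)) \<le> ennreal B"
  obtains s u where "strict_mono (s :: nat \<Rightarrow> nat)" "u \<in> borel_measurable (lebesgue_on \<Omega>)"
    "(\<lambda>k. rho (\<lambda>x. \<phi> (s k) x - u x)) \<longlonglongrightarrow> 0"
proof -
  note C1 = test_function_C1_compact[OF \<phi>]
  have meas [measurable]: "\<phi> k \<in> borel_measurable (lebesgue_on \<Omega>)" for k by (rule test_function_measurable[OF \<phi>])
  have measg: "grad (\<phi> k) \<in> borel_measurable (lebesgue_on \<Omega>)" for k by (rule test_function_measurable[OF \<phi>])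
  obtain A1 where A1: "0 < A1" "\<And>f :: real ^ 'n \<Rightarrow> real. f \<in> borel_measurable (lebesgue_on \<Omega>) \<Longrightarrow> rho f \<le> ennreal B \<Longrightarrow>
    (\<integral>\<^sup>+ x. ennreal (norm (f x)) \<partial>lebesgue_on \<Omega>) \<le> ennreal A1"
    using norm_integral_bounded[of B, where 'b = real] by blast
  obtain A2 where A2: "0 < A2" "\<And>f :: real ^ 'n \<Rightarrow> real ^ 'n. f \<in> borel_measurable (lebesgue_on \<Omega>) \<Longrightarrow> rho f \<le> ennreal B \<Longrightarrow>
    (\<integral>\<^sup>+ x. ennreal (norm (f x)) \<partial>lebesgue_on \<Omega>) \<le> ennreal A2"
    using norm_integral_bounded[of B, where 'b = "real ^ 'n"] by blast
  define A where "A = max A1 A2"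
  have A: "0 < A" "ennreal A1 \<le> ennreal A" "ennreal A2 \<le> ennreal A"
    using A1 A2 by (auto simp: A_def intro: ennreal_leI)
  have L1: "(\<integral>\<^sup>+ x. ennreal \<bar>\<phi> k x\<bar> \<partial>lborel) \<le> ennreal A" for k
    using A1(2)[OF meas rho(1), of k] A(2) nn_integral_domain[of "\<lambda>x. ennreal \<bar>\<phi> k x\<bar>"]
      test_function_zero_outside[OF \<phi>, of _ k] by (simp add: order_trans)
  have L1g: "(\<integral>\<^sup>+ x. ennreal (norm (grad (\<phi> k) x)) \<partial>lborel) \<le> ennreal A" for k
    using A2(2)[OF measg rho(2), of k] A(3) nn_integral_domain[of "\<lambda>x. ennreal (norm (grad (\<phi> k) x))"]
      test_function_zero_outside[OF \<phi>, of _ k] by (simp add: order_trans)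
  obtain R where R: "\<And>x. x \<in> \<Omega> \<Longrightarrow> norm x \<le> R" using bounded_domain by (auto simp: bounded_iff)
  have supp: "\<phi> k x = 0" if "R < norm x" for k x
    using R[of x] that test_function_zero_outside[OF \<phi>, of x k] by force
  obtain s where s: "strict_mono (s :: nat \<Rightarrow> nat)" and cauchy: "\<And>\<eta>. 0 < \<eta> \<Longrightarrow>
    \<exists>N. \<forall>i\<ge>N. \<forall>j\<ge>N. (\<integral>\<^sup>+ x. ennreal \<bar>\<phi> (s i) x - \<phi> (s j) x\<bar> \<partial>lborel) \<le> ennreal \<eta>"
    by (rule C1_compact_L1_compactness[of \<phi> "\<lambda>k. grad (\<phi> k)" A R, OF C1 A(1) L1 L1g]) (erule supp, rule that)
  obtain \<theta> C where \<theta>: "0 < \<theta>" and C: "0 \<le> C" "\<And>\<phi>. \<phi> \<in> test_functions \<Omega> \<Longrightarrow> rho \<phi> \<le> ennreal B \<Longrightarrow> rho (grad \<phi>) \<le> ennreal B \<Longrightarrow>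
    (\<integral>\<^sup>+ x. ennreal (\<bar>\<phi> x\<bar> powr (p x + \<theta>)) \<partial>lebesgue_on \<Omega>) \<le> ennreal C"
    by (rule test_function_higher_integrability[OF B]) (rule that)
  define C' where "C' = 2 powr (\<bar>pmax\<bar> + \<theta>) * (2 * C)"
  have C': "0 \<le> C'" using C by (simp add: C'_def)
  have high: "(\<integral>\<^sup>+ x. ennreal (\<bar>\<phi> i x - \<phi> j x\<bar> powr (p x + \<theta>)) \<partial>lebesgue_on \<Omega>) \<le> ennreal C'" for i j
  proof -
    have "(\<integral>\<^sup>+ x. ennreal (\<bar>\<phi> i x - \<phi> j x\<bar> powr (p x + \<theta>)) \<partial>lebesgue_on \<Omega>)
      \<le> (\<integral>\<^sup>+ x. ennreal (2 powr (\<bar>pmax\<bar> + \<theta>)) * (ennreal (\<bar>\<phi> i x\<bar> powr (p x + \<theta>)) + ennreal (\<bar>\<phi> j x\<bar> powr (p x + \<theta>))) \<partial>lebesgue_on \<Omega>)"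
    proof (rule nn_integral_mono)
      fix x assume x: "x \<in> space (lebesgue_on \<Omega>)"
      note px = exponent_gt_1[OF x] exponent_bounds[OF x]
      have "\<bar>\<phi> i x - \<phi> j x\<bar> powr (p x + \<theta>) \<le> (\<bar>\<phi> i x\<bar> + \<bar>\<phi> j x\<bar>) powr (p x + \<theta>)"
        using px \<theta> by (intro powr_mono2) auto
      also have "\<dots> \<le> 2 powr (\<bar>pmax\<bar> + \<theta>) * (\<bar>\<phi> i x\<bar> powr (p x + \<theta>) + \<bar>\<phi> j x\<bar> powr (p x + \<theta>))"
        using px \<theta> by (intro powr_add_le) auto
      finally show "ennreal (\<bar>\<phi> i x - \<phi> j x\<bar> powr (p x + \<theta>))
         \<le> ennreal (2 powr (\<bar>pmax\<bar> + \<theta>)) * (ennreal (\<bar>\<phi> i x\<bar> powr (p x + \<theta>)) + ennreal (\<bar>\<phi> j x\<bar> powr (p x + \<theta>)))"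
        by (simp add: ennreal_leI flip: ennreal_mult ennreal_plus)
    qed
    also have "\<dots> = ennreal (2 powr (\<bar>pmax\<bar> + \<theta>)) * ((\<integral>\<^sup>+ x. ennreal (\<bar>\<phi> i x\<bar> powr (p x + \<theta>)) \<partial>lebesgue_on \<Omega>)
       + (\<integral>\<^sup>+ x. ennreal (\<bar>\<phi> j x\<bar> powr (p x + \<theta>)) \<partial>lebesgue_on \<Omega>))"
      by (simp add: nn_integral_cmult nn_integral_add)
    also have "\<dots> \<le> ennreal (2 powr (\<bar>pmax\<bar> + \<theta>)) * (ennreal C + ennreal C)"
      by (intro mult_left_mono add_mono C(2) \<phi> rho) auto
    also have "\<dots> = ennreal C'" using C(1) by (simp add: C'_def flip: ennreal_mult ennreal_plus)
    finally show ?thesis .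
  qed
  have "\<exists>N. \<forall>i\<ge>N. \<forall>j\<ge>N. rho (\<lambda>x. \<phi> (s i) x - \<phi> (s j) x) \<le> ennreal \<eta>" if eta: "0 < \<eta>" for \<eta>
  proof -
    define T where "T = max 1 ((2 * C' / \<eta>) powr (1 / \<theta>))"
    have T: "1 \<le> T" by (simp add: T_def)
    have "T powr (- \<theta>) * C' \<le> \<eta> / 2"
    proof (cases "C' = 0")
      case False
      have "2 * C' / \<eta> = ((2 * C' / \<eta>) powr (1 / \<theta>)) powr \<theta>" using \<theta> eta C' False by (simp add: powr_powr)
      also have "\<dots> \<le> T powr \<theta>" using \<theta> by (intro powr_mono2) (auto simp: T_def)
      finally show ?thesis using T eta by (simp add: powr_minus field_simps)
    qed (use eta in auto)
    note T\<theta> = this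
    define \<kappa> where "\<kappa> = \<eta> / (2 * T powr pmax)"
    have kappa: "0 < \<kappa>" using eta T by (simp add: \<kappa>_def)
    obtain N where N: "\<And>i j. i \<ge> N \<Longrightarrow> j \<ge> N \<Longrightarrow> (\<integral>\<^sup>+ x. ennreal \<bar>\<phi> (s i) x - \<phi> (s j) x\<bar> \<partial>lborel) \<le> ennreal \<kappa>"
      using cauchy[OF kappa] by blast
    have "rho (\<lambda>x. \<phi> (s i) x - \<phi> (s j) x) \<le> ennreal \<eta>" if "i \<ge> N" "j \<ge> N" for i j
    proof -
      have "rho (\<lambda>x. \<phi> (s i) x - \<phi> (s j) x) \<le> ennreal (T powr pmax) * (\<integral>\<^sup>+ x. ennreal \<bar>\<phi> (s i) x - \<phi> (s j) x\<bar> \<partial>lebesgue_on \<Omega>)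
        + ennreal (T powr (- \<theta>)) * (\<integral>\<^sup>+ x. ennreal (\<bar>\<phi> (s i) x - \<phi> (s j) x\<bar> powr (p x + \<theta>)) \<partial>lebesgue_on \<Omega>)"
        by (intro rho_interpolation T \<theta>) measurable
      also have "\<dots> \<le> ennreal (T powr pmax) * ennreal \<kappa> + ennreal (T powr (- \<theta>)) * ennreal C'"
        using N[OF that] nn_integral_domain[of "\<lambda>x. ennreal \<bar>\<phi> (s i) x - \<phi> (s j) x\<bar>"] test_function_zero_outside[OF \<phi>]
        by (intro add_mono mult_left_mono high) auto
      also have "\<dots> = ennreal (\<eta> / 2 + T powr (- \<theta>) * C')"
        using kappa eta C' T by (simp add: \<kappa>_def flip: ennreal_mult ennreal_plus)
      also have "\<dots> \<le> ennreal \<eta>" using T\<theta> by (intro ennreal_leI) simp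
      finally show ?thesis .
    qed
    then show ?thesis by blast
  qed
  note rho_cauchy = this
  have fin: "rho (\<phi> (s k)) < \<infinity>" for k by (rule test_function_rho_finite[OF \<phi>])
  show ?thesis
    by (rule rho_complete[of "\<lambda>k. \<phi> (s k)", OF meas fin rho_cauchy]) (use s that in blast)+
qed

end

section \<open>Uniqueness of weak gradients\<close>

text \<open>The positive and the negative part are densities of two measures that agree on boxes, and boxes are
  a generator closed under intersection.\<close>

lemma AE_zero_if_box_integrals_zero:
  fixes F :: "'a::euclidean_space \<Rightarrow> real"
  assumes F: "integrable lborel F"
    and zero: "\<And>a b. (LINT x|lborel. indicator (box a b) x *\<^sub>R F x) = 0"
  shows "AE x in lborel. F x = 0"
proof -
  have [measurable]: "F \<in> borel_measurable borel" using borel_measurable_integrable[OF F] by simp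
  have fin: "emeasure (density lborel (\<lambda>x. ennreal (F x))) (box a b) \<noteq> \<infinity>"
    and eq: "emeasure (density lborel (\<lambda>x. ennreal (F x))) (box a b)
      = emeasure (density lborel (\<lambda>x. ennreal (- F x))) (box a b)" for a b
  proof -
    have int: "integrable lborel (\<lambda>x. indicator (box a b) x *\<^sub>R F x)"
      by (intro integrable_mult_indicator F) auto
    have e1: "emeasure (density lborel (\<lambda>x. ennreal (F x))) (box a b) = (\<integral>\<^sup>+ x. ennreal (indicator (box a b) x *\<^sub>R F x) \<partial>lborel)"
      by (subst emeasure_density) (auto intro!: nn_integral_cong simp: indicator_def)
    have e2: "emeasure (density lborel (\<lambda>x. ennreal (- F x))) (box a b) = (\<integral>\<^sup>+ x. ennreal (- (indicator (box a b) x *\<^sub>R F x)) \<partial>lborel)"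
      by (subst emeasure_density) (auto intro!: nn_integral_cong simp: indicator_def)
    have f: "(\<integral>\<^sup>+ x. ennreal (indicator (box a b) x *\<^sub>R F x) \<partial>lborel) \<noteq> \<infinity>"
       "(\<integral>\<^sup>+ x. ennreal (- (indicator (box a b) x *\<^sub>R F x)) \<partial>lborel) \<noteq> \<infinity>"
      using int unfolding real_integrable_def by auto
    have "enn2real (\<integral>\<^sup>+ x. ennreal (indicator (box a b) x *\<^sub>R F x) \<partial>lborel)
      = enn2real (\<integral>\<^sup>+ x. ennreal (- (indicator (box a b) x *\<^sub>R F x)) \<partial>lborel)"
      using zero[of a b] unfolding real_lebesgue_integral_def[OF int] by simp
    then have "(\<integral>\<^sup>+ x. ennreal (indicator (box a b) x *\<^sub>R F x) \<partial>lborel)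
      = (\<integral>\<^sup>+ x. ennreal (- (indicator (box a b) x *\<^sub>R F x)) \<partial>lborel)"
    proof -
      have "X = Y" if "enn2real X = enn2real Y" "X \<noteq> \<infinity>" "Y \<noteq> \<infinity>" for X Y
        using that by (cases X; cases Y) auto
      then show ?thesis using f \<open>enn2real _ = enn2real _\<close> by blast
    qed
    then show "emeasure (density lborel (\<lambda>x. ennreal (F x))) (box a b) \<noteq> \<infinity>"
      "emeasure (density lborel (\<lambda>x. ennreal (F x))) (box a b) = emeasure (density lborel (\<lambda>x. ennreal (- F x))) (box a b)"
      using f e1 e2 by auto
  qed
  have "density lborel (\<lambda>x. ennreal (F x)) = density lborel (\<lambda>x. ennreal (- F x))"
  proof (rule measure_eqI_generator_eq)
    let ?E = "range (\<lambda>(a, b). box a b :: 'a set)"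
    show "Int_stable ?E" by (auto simp: Int_stable_def box_Int_box)
    show "?E \<subseteq> Pow UNIV" by simp
    show "sets (density lborel (\<lambda>x. ennreal (F x))) = sigma_sets UNIV ?E"
      "sets (density lborel (\<lambda>x. ennreal (- F x))) = sigma_sets UNIV ?E"
      by (simp_all add: borel_eq_box)
    let ?A = "\<lambda>n::nat. box (- (real n *\<^sub>R One)) (real n *\<^sub>R One) :: 'a set"
    show "range ?A \<subseteq> ?E" "(\<Union>i. ?A i) = UNIV" unfolding UN_box_eq_UNIV by auto
    show "emeasure (density lborel (\<lambda>x. ennreal (F x))) (?A i) \<noteq> \<infinity>" for i by (rule fin)
    show "emeasure (density lborel (\<lambda>x. ennreal (F x))) X = emeasure (density lborel (\<lambda>x. ennreal (- F x))) X" if "X \<in> ?E" for X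
      using that eq by auto
  qed
  then have "AE x in lborel. ennreal (F x) = ennreal (- F x)"
    by (subst (asm) sigma_finite_measure.density_unique_iff[OF sigma_finite_lborel]) auto
  then show ?thesis
  proof eventually_elim
    case (elim x)
    then show ?case
      by (cases "0 \<le> F x") (auto simp: ennreal_neg ennreal_eq_0_iff dest: sym)
  qed
qed

text \<open>The indicator functions of boxes are pointwise limits of uniformly bounded bump functions, so all
  integrals over boxes vanish.\<close>

lemma fundamental_lemma_calculus_of_variations:
  fixes f :: "real ^ 'n \<Rightarrow> real"
  assumes "open \<Omega>" and f: "locally_integrable \<Omega> f"
    and zero: "\<And>\<psi>. \<psi> \<in> test_functions \<Omega> \<Longrightarrow> (LINT x|lebesgue_on \<Omega>. f x * \<psi> x) = 0"
  shows "AE x in lebesgue_on \<Omega>. f x = 0"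
proof -
  have om [simp]: "\<Omega> \<in> sets lebesgue" using \<open>open \<Omega>\<close> by auto
  have set_int: "integrable lebesgue (\<lambda>x. indicator (cbox a b) x *\<^sub>R f x)" if "cbox a b \<subseteq> \<Omega>" for a b
    using f that unfolding locally_integrable_def set_integrable_def by (simp add: compact_cbox)
  have box_zero: "(LINT x|lebesgue. indicator (box a b) x *\<^sub>R f x) = 0" if ab: "cbox a b \<subseteq> \<Omega>" for a b
  proof -
    have "(\<lambda>n. LINT x|lebesgue. indicator \<Omega> x *\<^sub>R (f x * box_bump (real (Suc n)) a b x))
        \<longlonglongrightarrow> (LINT x|lebesgue. indicator (box a b) x *\<^sub>R f x)"
    proof (rule integral_dominated_convergence[where w = "\<lambda>x. norm (indicator (cbox a b) x *\<^sub>R f x)"])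
      have eq: "indicator \<Omega> x *\<^sub>R (f x * box_bump (real (Suc n)) a b x)
          = (indicator (cbox a b) x *\<^sub>R f x) * box_bump (real (Suc n)) a b x" for n x
        using ab box_subset_cbox[of a b] box_bump_nonzero_iff[of "real (Suc n)" a b x]
        by (auto simp: indicator_def)
      show "(\<lambda>x. indicator (box a b) x *\<^sub>R f x) \<in> borel_measurable lebesgue"
      proof -
        have "(\<lambda>x. indicator (box a b) x *\<^sub>R (indicator (cbox a b) x *\<^sub>R f x)) \<in> borel_measurable lebesgue"
          by (intro borel_measurable_scaleR borel_measurable_indicator borel_measurable_integrable[OF set_int[OF ab]]) auto
        also have "(\<lambda>x. indicator (box a b) x *\<^sub>R (indicator (cbox a b) x *\<^sub>R f x)) = (\<lambda>x. indicator (box a b) x *\<^sub>R f x)"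
          using box_subset_cbox[of a b] by (auto simp: indicator_def fun_eq_iff)
        finally show ?thesis .
      qed
      show "(\<lambda>x. indicator \<Omega> x *\<^sub>R (f x * box_bump (real (Suc n)) a b x)) \<in> borel_measurable lebesgue" for n
      proof -
        have "box_bump (real (Suc n)) a b \<in> borel_measurable borel"
          using box_bump_test_function[of "real (Suc n)" a b \<Omega>] ab test_function_C1_compact C1_compactD(4) by force
        then have "box_bump (real (Suc n)) a b \<in> borel_measurable lebesgue" by (intro measurable_completion) simp
        then show ?thesis
          unfolding eq by (intro borel_measurable_times borel_measurable_integrable[OF set_int[OF ab]])
      qed
      show "integrable lebesgue (\<lambda>x. norm (indicator (cbox a b) x *\<^sub>R f x))"
        using set_int[OF ab] by (rule integrable_norm)
      show "AE x in lebesgue. (\<lambda>n. indicator \<Omega> x *\<^sub>R (f x * box_bump (real (Suc n)) a b x)) \<longlonglongrightarrow> indicator (box a b) x *\<^sub>R f x"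
      proof (rule AE_I2)
        fix x
        have "(\<lambda>n. (indicator (cbox a b) x *\<^sub>R f x) * box_bump (real (Suc n)) a b x) \<longlonglongrightarrow> (indicator (cbox a b) x *\<^sub>R f x) * indicator (box a b) x"
          by (intro tendsto_intros box_bump_tendsto)
        also have "(indicator (cbox a b) x *\<^sub>R f x) * indicator (box a b) x = indicator (box a b) x *\<^sub>R f x"
          using box_subset_cbox[of a b] by (auto simp: indicator_def)
        finally show "(\<lambda>n. indicator \<Omega> x *\<^sub>R (f x * box_bump (real (Suc n)) a b x)) \<longlonglongrightarrow> indicator (box a b) x *\<^sub>R f x"
          unfolding eq .
      qed
      show "AE x in lebesgue. norm (indicator \<Omega> x *\<^sub>R (f x * box_bump (real (Suc n)) a b x)) \<le> norm (indicator (cbox a b) x *\<^sub>R f x)" for n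
        unfolding eq using box_bump_bounds[of "real (Suc n)" a b]
        by (intro AE_I2) (auto simp: abs_mult intro!: mult_left_le)
    qed
    moreover have "(LINT x|lebesgue. indicator \<Omega> x *\<^sub>R (f x * box_bump (real (Suc n)) a b x)) = 0" for n
      using zero[OF box_bump_test_function[of "real (Suc n)" a b]] ab integral_restrict_space[of \<Omega> lebesgue "\<lambda>x. f x * box_bump (real (Suc n)) a b x"]
      by simp
    ultimately show ?thesis by (simp add: LIMSEQ_const_iff)
  qed
  have on_box: "AE x in lebesgue. x \<in> cbox a b \<longrightarrow> f x = 0" if ab: "cbox a b \<subseteq> \<Omega>" for a b
  proof -
    define F where "F x = indicator (box a b) x *\<^sub>R f x" for x
    have F_int: "integrable lebesgue F"
    proof -
      have "integrable lebesgue (\<lambda>x. indicator (box a b) x *\<^sub>R (indicator (cbox a b) x *\<^sub>R f x))"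
        by (intro integrable_mult_indicator set_int ab) auto
      also have "(\<lambda>x. indicator (box a b) x *\<^sub>R (indicator (cbox a b) x *\<^sub>R f x)) = F"
        using box_subset_cbox[of a b] by (auto simp: indicator_def fun_eq_iff F_def)
      finally show ?thesis .
    qed
    obtain F' where F': "F' \<in> borel_measurable lborel" "AE x in lborel. F x = F' x"
      using completion_ex_borel_measurable_real[OF borel_measurable_integrable[OF F_int]] by blast
    have AE_leb: "AE x in lebesgue. F x = F' x" using F'(2) by (rule AE_completion)
    have F'_leb: "F' \<in> borel_measurable lebesgue" using F'(1) by (rule measurable_completion)
    have "integrable lebesgue F'"
      using F_int integrable_cong_AE[OF borel_measurable_integrable[OF F_int] F'_leb AE_leb] by simp
    then have F'_int: "integrable lborel F'" using F'(1) by (simp add: integrable_completion)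
    have "AE x in lborel. F' x = 0"
    proof (rule AE_zero_if_box_integrals_zero[OF F'_int])
      fix c d :: "real ^ 'n"
      define c' d' :: "real ^ 'n" where "c' = (\<Sum>i\<in>Basis. max (c\<bullet>i) (a\<bullet>i) *\<^sub>R i)" and "d' = (\<Sum>i\<in>Basis. min (d\<bullet>i) (b\<bullet>i) *\<^sub>R i)"
      have box: "box c d \<inter> box a b = box c' d'" "cbox c d \<inter> cbox a b = cbox c' d'"
        unfolding c'_def d'_def by (rule box_Int_box, rule Int_interval)
      have "(LINT x|lborel. indicator (box c d) x *\<^sub>R F' x) = (LINT x|lebesgue. indicator (box c d) x *\<^sub>R F' x)"
        using F'(1) by (intro integral_completion[symmetric]) auto
      also have "\<dots> = (LINT x|lebesgue. indicator (box c d) x *\<^sub>R F x)"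
      proof (rule integral_cong_AE)
        show "(\<lambda>x. indicator (box c d) x *\<^sub>R F' x) \<in> borel_measurable lebesgue"
          "(\<lambda>x. indicator (box c d) x *\<^sub>R F x) \<in> borel_measurable lebesgue"
          by (intro borel_measurable_scaleR borel_measurable_indicator F'_leb borel_measurable_integrable[OF F_int]; simp)+
        show "AE x in lebesgue. indicator (box c d) x *\<^sub>R F' x = indicator (box c d) x *\<^sub>R F x"
          using AE_leb by eventually_elim simp
      qed
      also have "\<dots> = (LINT x|lebesgue. indicator (box c' d') x *\<^sub>R f x)"
        unfolding F_def box(1)[symmetric] by (intro Bochner_Integration.integral_cong) (auto simp: indicator_def)
      also have "\<dots> = 0" using box(2) ab by (intro box_zero) blast
      finally show "(LINT x|lborel. indicator (box c d) x *\<^sub>R F' x) = 0" .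
    qed
    then have "AE x in lebesgue. F' x = 0" by (rule AE_completion)
    moreover have "AE x in lebesgue. x \<notin> cbox a b - box a b"
      using negligible_frontier_interval[of a b] by (intro AE_not_in) (simp add: negligible_iff_null_sets)
    ultimately show ?thesis using AE_leb by eventually_elim (auto simp: F_def)
  qed
  obtain D where D: "countable D" "D \<subseteq> Pow \<Omega>" "\<And>X. X \<in> D \<Longrightarrow> \<exists>a b. X = cbox a b" "\<Union>D = \<Omega>"
    by (rule open_countable_Union_open_cbox[OF \<open>open \<Omega>\<close>]) (rule that)
  have "AE x in lebesgue. x \<in> X \<longrightarrow> f x = 0" if "X \<in> D" for X
  proof -
    have "\<exists>a b. X = cbox a b" using D(3) that .
    then obtain a b where X: "X = cbox a b" by blast
    show ?thesis unfolding X using D(2) that X by (intro on_box) blast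
  qed
  then have "AE x in lebesgue. \<forall>X\<in>D. x \<in> X \<longrightarrow> f x = 0"
    by (subst AE_ball_countable[OF D(1)]) blast
  then have "AE x in lebesgue. x \<in> \<Omega> \<longrightarrow> f x = 0"
    using D(4) by (auto elim!: eventually_mono)
  then show ?thesis by (subst AE_restrict_space_iff) auto
qed

lemma weak_gradient_unique:
  fixes u :: "real ^ 'n \<Rightarrow> real"
  assumes "open \<Omega>" and g: "has_weak_gradient \<Omega> u g" and h: "has_weak_gradient \<Omega> u h"
  shows "AE x in lebesgue_on \<Omega>. g x = h x"
proof -
  have om [simp]: "\<Omega> \<in> sets lebesgue" using \<open>open \<Omega>\<close> by auto
  have lg: "locally_integrable \<Omega> g" and lh: "locally_integrable \<Omega> h"
    using g h by (auto simp: has_weak_gradient_def)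
  have comp: "(\<lambda>x. f x $ i) \<in> borel_measurable (lebesgue_on \<Omega>)"
    if "f \<in> borel_measurable (lebesgue_on \<Omega>)" for f :: "real ^ 'n \<Rightarrow> real ^ 'n" and i
    using that by (auto intro: measurable_compose[OF _ borel_measurable_nth] )
  have "AE x in lebesgue_on \<Omega>. (g x - h x) $ i = 0" for i
  proof (rule fundamental_lemma_calculus_of_variations[OF \<open>open \<Omega>\<close>])
    have set_int: "integrable lebesgue (\<lambda>x. indicator K x *\<^sub>R f x $ i)"
      if "locally_integrable \<Omega> f" "compact K" "K \<subseteq> \<Omega>" for f :: "real ^ 'n \<Rightarrow> real ^ 'n" and K
      using that integrable_bounded_linear[OF bounded_linear_vec_nth[of i], of lebesgue "\<lambda>x. indicator K x *\<^sub>R f x"]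
      by (auto simp: locally_integrable_def set_integrable_def)
    show "locally_integrable \<Omega> (\<lambda>x. (g x - h x) $ i)"
      unfolding locally_integrable_def
    proof (intro conjI allI impI)
      show "(\<lambda>x. (g x - h x) $ i) \<in> borel_measurable (lebesgue_on \<Omega>)"
        using lg lh comp[of g i] comp[of h i] by (auto simp: locally_integrable_def)
      fix K assume K: "compact K \<and> K \<subseteq> \<Omega>"
      have "integrable lebesgue (\<lambda>x. indicator K x *\<^sub>R g x $ i - indicator K x *\<^sub>R h x $ i)"
        using K by (intro Bochner_Integration.integrable_diff set_int lg lh) auto
      then show "set_integrable lebesgue K (\<lambda>x. (g x - h x) $ i)"
        by (simp add: set_integrable_def algebra_simps)
    qed
    fix \<psi> assume \<psi>: "\<psi> \<in> test_functions \<Omega>"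
    define S where "S = closure {x. \<psi> x \<noteq> 0}"
    have S: "compact S" "S \<subseteq> \<Omega>" "\<And>x. x \<notin> S \<Longrightarrow> \<psi> x = 0"
      using \<psi> closure_subset[of "{x. \<psi> x \<noteq> 0}"] by (auto simp: test_functions_def S_def)
    obtain B where B: "0 < B" "\<And>x. \<bar>\<psi> x\<bar> \<le> B"
      using C1_compact_bounded[OF test_function_C1_compact[OF \<psi>]] by metis
    have \<psi>_meas: "\<psi> \<in> borel_measurable lebesgue"
      using C1_compactD(4)[OF test_function_C1_compact[OF \<psi>]] by (intro measurable_completion) simp
    have int: "integrable (lebesgue_on \<Omega>) (\<lambda>x. f x $ i * \<psi> x)"
      if "locally_integrable \<Omega> f" for f :: "real ^ 'n \<Rightarrow> real ^ 'n"
    proof -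
      have "integrable lebesgue (\<lambda>x. indicator S x *\<^sub>R f x $ i * \<psi> x)"
      proof (rule Bochner_Integration.integrable_bound)
        show "integrable lebesgue (\<lambda>x. B * (indicator S x *\<^sub>R f x $ i))"
          using set_int[OF that S(1,2)] by simp
        show "(\<lambda>x. indicator S x *\<^sub>R f x $ i * \<psi> x) \<in> borel_measurable lebesgue"
          by (rule borel_measurable_times[OF borel_measurable_integrable[OF set_int[OF that S(1,2)]] \<psi>_meas])
        show "AE x in lebesgue. norm (indicator S x *\<^sub>R f x $ i * \<psi> x) \<le> norm (B * (indicator S x *\<^sub>R f x $ i))"
          using B by (intro AE_I2) (auto simp: abs_mult indicator_def mult.commute intro: mult_right_mono)
      qed
      also have "(\<lambda>x. indicator S x *\<^sub>R f x $ i * \<psi> x) = (\<lambda>x. indicator \<Omega> x *\<^sub>R (f x $ i * \<psi> x))"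
        using S by (auto simp: indicator_def fun_eq_iff)
      finally show ?thesis by (subst integrable_restrict_space) auto
    qed
    have "(LINT x|lebesgue_on \<Omega>. (g x - h x) $ i * \<psi> x)
        = (LINT x|lebesgue_on \<Omega>. g x $ i * \<psi> x) - (LINT x|lebesgue_on \<Omega>. h x $ i * \<psi> x)"
      using int[OF lg] int[OF lh] by (simp add: left_diff_distrib)
    also have "\<dots> = 0" using g h \<psi> by (auto simp: has_weak_gradient_def)
    finally show "(LINT x|lebesgue_on \<Omega>. (g x - h x) $ i * \<psi> x) = 0" .
  qed
  then have "AE x in lebesgue_on \<Omega>. \<forall>i. (g x - h x) $ i = 0" by (simp add: AE_all_countable)
  then show ?thesis by eventually_elim (simp add: vec_eq_iff)
qed

lemma weak_gradient_AE_eq: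
  assumes "open \<Omega>" "has_weak_gradient \<Omega> u g"
  shows "has_weak_gradient \<Omega> u (weak_gradient \<Omega> u)" "AE x in lebesgue_on \<Omega>. weak_gradient \<Omega> u x = g x"
proof -
  show "has_weak_gradient \<Omega> u (weak_gradient \<Omega> u)"
    unfolding weak_gradient_def using assms(2) by (rule someI[of "has_weak_gradient \<Omega> u"])
  then show "AE x in lebesgue_on \<Omega>. weak_gradient \<Omega> u x = g x"
    by (rule weak_gradient_unique[OF assms(1) _ assms(2)])
qed

context exponent_domain begin

lemma integrable_locally_integrable:
  fixes f :: "real ^ 'n \<Rightarrow> 'b::{banach, second_countable_topology}"
  assumes "integrable (lebesgue_on \<Omega>) f"
  shows "locally_integrable \<Omega> f"
proof -
  have "set_integrable lebesgue \<Omega> f"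
    using assms by (simp add: set_integrable_def integrable_restrict_space)
  then show ?thesis
    using assms by (auto simp: locally_integrable_def intro: set_integrable_subset lmeasurable_compact fmeasurableD)
qed

lemma integral_domain:
  fixes f :: "real ^ 'n \<Rightarrow> real"
  assumes "f \<in> borel_measurable borel" "\<And>x. x \<notin> \<Omega> \<Longrightarrow> f x = 0"
  shows "(LINT x|lebesgue_on \<Omega>. f x) = (LINT x|lborel. f x)"
proof -
  have "(LINT x|lebesgue_on \<Omega>. f x) = (LINT x|lebesgue. indicator \<Omega> x *\<^sub>R f x)"
    by (rule integral_restrict_space) simp
  also have "(\<lambda>x. indicator \<Omega> x *\<^sub>R f x) = f" using assms(2) by (auto simp: indicator_def fun_eq_iff)
  also have "(LINT x|lebesgue. f x) = (LINT x|lborel. f x)" using assms(1) by (intro integral_completion) simp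
  finally show ?thesis .
qed

lemma test_function_integration_by_parts:
  assumes \<phi>: "\<phi> \<in> test_functions \<Omega>" and \<psi>: "\<psi> \<in> test_functions \<Omega>"
  shows "(LINT x|lebesgue_on \<Omega>. \<phi> x * partial_deriv i \<psi> x) = - (LINT x|lebesgue_on \<Omega>. grad \<phi> x $ i * \<psi> x)"
proof -
  note C = test_function_C1_compact[OF \<phi>] test_function_C1_compact[OF \<psi>]
  have pd: "partial_deriv i \<psi> x = grad \<psi> x \<bullet> axis i 1" "grad \<phi> x $ i = grad \<phi> x \<bullet> axis i 1" for x
    by (simp_all add: grad_def inner_axis)
  obtain R where R: "\<And>x. R < norm x \<Longrightarrow> \<phi> x = 0" using C1_compact_bounded[OF C(1)] by metis
  obtain R' where R': "\<And>x. R' < norm x \<Longrightarrow> \<psi> x = 0" using C1_compact_bounded[OF C(2)] by metis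
  have i1: "integrable lborel (\<lambda>x. \<phi> x * (grad \<psi> x \<bullet> axis i 1))"
    using C1_compactD(2,3)[OF C(1)] C1_compactD(2,3)[OF C(2)] R
    by (intro integrable_continuous_bounded_support[of _ R] continuous_intros) auto
  have i2: "integrable lborel (\<lambda>x. (grad \<phi> x \<bullet> axis i 1) * \<psi> x)"
    using C1_compactD(2,3)[OF C(1)] C1_compactD(2,3)[OF C(2)] R'
    by (intro integrable_continuous_bounded_support[of _ R'] continuous_intros) auto
  have "0 = (LINT x|lborel. (\<phi> x *\<^sub>R grad \<psi> x + \<psi> x *\<^sub>R grad \<phi> x) \<bullet> axis i 1)"
    by (rule C1_compact_integral_grad[OF C1_compact_mult[OF C], symmetric])
  also have "\<dots> = (LINT x|lborel. \<phi> x * (grad \<psi> x \<bullet> axis i 1) + (grad \<phi> x \<bullet> axis i 1) * \<psi> x)"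
    by (simp add: inner_add_left mult.commute)
  also have "\<dots> = (LINT x|lborel. \<phi> x * (grad \<psi> x \<bullet> axis i 1)) + (LINT x|lborel. (grad \<phi> x \<bullet> axis i 1) * \<psi> x)"
    by (rule Bochner_Integration.integral_add[OF i1 i2])
  finally have sum: "(LINT x|lborel. \<phi> x * (grad \<psi> x \<bullet> axis i 1)) = - (LINT x|lborel. (grad \<phi> x \<bullet> axis i 1) * \<psi> x)" by simp
  show ?thesis
    unfolding pd
    using sum borel_measurable_integrable[OF i1] borel_measurable_integrable[OF i2]
      test_function_zero_outside[OF \<phi>] test_function_zero_outside[OF \<psi>]
    by (subst integral_domain, simp, simp, subst integral_domain, simp, simp) simp
qed

text \<open>A version of the zero trace Sobolev space in which the gradient is part of the data and which
  mentions neither weak gradients nor norms.\<close>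

definition sobolev_zero :: "(real ^ 'n \<Rightarrow> real) \<Rightarrow> (real ^ 'n \<Rightarrow> real ^ 'n) \<Rightarrow> bool" where
  "sobolev_zero u g \<longleftrightarrow> u \<in> borel_measurable (lebesgue_on \<Omega>) \<and> g \<in> borel_measurable (lebesgue_on \<Omega>) \<and>
    (\<exists>\<phi>. (\<forall>k::nat. \<phi> k \<in> test_functions \<Omega>) \<and> (\<lambda>k. rho (\<lambda>x. \<phi> k x - u x)) \<longlonglongrightarrow> 0 \<and>
      (\<lambda>k. rho (\<lambda>x. grad (\<phi> k) x - g x)) \<longlonglongrightarrow> 0)"

lemma rho_limit_finite:
  fixes f :: "nat \<Rightarrow> real ^ 'n \<Rightarrow> 'b::euclidean_space"
  assumes "\<And>k. f k \<in> borel_measurable (lebesgue_on \<Omega>)" "u \<in> borel_measurable (lebesgue_on \<Omega>)"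
    "(\<lambda>k. rho (\<lambda>x. f k x - u x)) \<longlonglongrightarrow> 0" "\<And>k. rho (f k) < \<infinity>"
  shows "rho u < \<infinity>"
proof -
  obtain k where k: "rho (\<lambda>x. f k x - u x) < 1"
    using order_tendstoD(2)[OF assms(3), of 1] by (auto dest: eventually_happens)
  have "rho u \<le> ennreal (2 powr (pmax - 1)) * (rho (\<lambda>x. u x - f k x) + rho (f k))"
    using rho_triangle[OF assms(2) assms(1)[of k], of "\<lambda>x. 0"] by simp
  also have "\<dots> < \<infinity>"
    using k assms(4)[of k] rho_minus_commute[of "f k" u] by (simp add: ennreal_mult_less_top less_trans[OF _ ennreal_one_less_top])
  finally show ?thesis .
qed

lemma rho_tendsto_L1:
  fixes f :: "nat \<Rightarrow> real ^ 'n \<Rightarrow> 'b::euclidean_space"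
  assumes [measurable]: "\<And>k. f k \<in> borel_measurable (lebesgue_on \<Omega>)" "u \<in> borel_measurable (lebesgue_on \<Omega>)"
    and lim: "(\<lambda>k. rho (\<lambda>x. f k x - u x)) \<longlonglongrightarrow> 0"
  shows "(\<lambda>k. \<integral>\<^sup>+ x. ennreal (norm (f k x - u x)) \<partial>lebesgue_on \<Omega>) \<longlonglongrightarrow> 0"
proof (rule order_tendstoI)
  fix a :: ennreal assume "0 < a"
  then obtain z where z: "0 < z" "z < a" using dense by blast
  obtain \<eta> where \<eta>: "0 < \<eta>" "ennreal \<eta> < a" using z that by (cases z) auto
  obtain d where d: "0 < d" "\<And>h :: real ^ 'n \<Rightarrow> 'b. h \<in> borel_measurable (lebesgue_on \<Omega>) \<Longrightarrow> rho h \<le> ennreal d \<Longrightarrow>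
      (\<integral>\<^sup>+ x. ennreal (norm (h x)) \<partial>lebesgue_on \<Omega>) \<le> ennreal \<eta>"
    using norm_integral_small[of \<eta>, where 'b = 'b] \<eta>(1) by meson
  have "\<forall>\<^sub>F k in sequentially. rho (\<lambda>x. f k x - u x) < ennreal d"
    using d(1) by (intro order_tendstoD(2)[OF lim]) auto
  then show "\<forall>\<^sub>F k in sequentially. (\<integral>\<^sup>+ x. ennreal (norm (f k x - u x)) \<partial>lebesgue_on \<Omega>) < a"
  proof eventually_elim
    case (elim k)
    then show ?case by (intro le_less_trans[OF d(2) \<eta>(2)]) auto
  qed
qed auto

lemma rho_tendsto_integral:
  fixes f :: "nat \<Rightarrow> real ^ 'n \<Rightarrow> 'b::euclidean_space"
  assumes f: "\<And>k. f k \<in> borel_measurable (lebesgue_on \<Omega>)" "\<And>k. rho (f k) < \<infinity>"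
    and u: "u \<in> borel_measurable (lebesgue_on \<Omega>)"
    and lim: "(\<lambda>k. rho (\<lambda>x. f k x - u x)) \<longlonglongrightarrow> 0"
    and \<psi>: "\<psi> \<in> borel_measurable (lebesgue_on \<Omega>)" "\<And>x. \<bar>\<psi> x\<bar> \<le> B"
  shows "(\<lambda>k. LINT x|lebesgue_on \<Omega>. (f k x \<bullet> e) * \<psi> x) \<longlonglongrightarrow> (LINT x|lebesgue_on \<Omega>. (u x \<bullet> e) * \<psi> x)"
proof (rule tendsto_L1_int)
  note [measurable] = f(1) u \<psi>(1)
  have int: "integrable (lebesgue_on \<Omega>) (\<lambda>x. (v x \<bullet> e) * \<psi> x)"
    if v: "v \<in> borel_measurable (lebesgue_on \<Omega>)" "rho v < \<infinity>" for v :: "real ^ 'n \<Rightarrow> 'b"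
  proof (rule Bochner_Integration.integrable_bound)
    show "integrable (lebesgue_on \<Omega>) (\<lambda>x. (v x \<bullet> e) * B)"
      using rho_finite_integrable[OF v] by simp
    show "AE x in lebesgue_on \<Omega>. norm ((v x \<bullet> e) * \<psi> x) \<le> norm ((v x \<bullet> e) * B)"
    proof (rule AE_I2)
      fix x
      have "\<bar>\<psi> x\<bar> \<le> \<bar>B\<bar>" using \<psi>(2)[of x] by linarith
      then show "norm ((v x \<bullet> e) * \<psi> x) \<le> norm ((v x \<bullet> e) * B)"
        unfolding real_norm_def abs_mult by (intro mult_left_mono) auto
    qed
  qed (use v in measurable)
  show "integrable (lebesgue_on \<Omega>) (\<lambda>x. (f k x \<bullet> e) * \<psi> x)" for k by (intro int f)
  show "integrable (lebesgue_on \<Omega>) (\<lambda>x. (u x \<bullet> e) * \<psi> x)"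
    by (intro int u rho_limit_finite[OF f(1) u lim f(2)])
  have B: "0 \<le> B" using \<psi>(2)[of 0] by linarith
  define c where "c = norm e * B + 1"
  have c: "0 < c" using B by (simp add: c_def add_nonneg_pos)
  have le: "(\<integral>\<^sup>+ x. ennreal (norm ((f k x \<bullet> e) * \<psi> x - (u x \<bullet> e) * \<psi> x)) \<partial>lebesgue_on \<Omega>)
    \<le> ennreal c * (\<integral>\<^sup>+ x. ennreal (norm (f k x - u x)) \<partial>lebesgue_on \<Omega>)" for k
  proof -
    have "(\<integral>\<^sup>+ x. ennreal (norm ((f k x \<bullet> e) * \<psi> x - (u x \<bullet> e) * \<psi> x)) \<partial>lebesgue_on \<Omega>)
      \<le> (\<integral>\<^sup>+ x. ennreal c * ennreal (norm (f k x - u x)) \<partial>lebesgue_on \<Omega>)"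
    proof (rule nn_integral_mono)
      fix x
      have "norm ((f k x \<bullet> e) * \<psi> x - (u x \<bullet> e) * \<psi> x) = \<bar>(f k x - u x) \<bullet> e\<bar> * \<bar>\<psi> x\<bar>"
        by (simp add: inner_diff_left abs_mult flip: left_diff_distrib)
      also have "\<dots> \<le> (norm (f k x - u x) * norm e) * B"
        using B by (intro mult_mono Cauchy_Schwarz_ineq2 \<psi>(2)) auto
      also have "\<dots> \<le> c * norm (f k x - u x)" by (simp add: c_def algebra_simps)
      finally show "ennreal (norm ((f k x \<bullet> e) * \<psi> x - (u x \<bullet> e) * \<psi> x)) \<le> ennreal c * ennreal (norm (f k x - u x))"
        using c by (simp add: ennreal_leI flip: ennreal_mult)
    qed
    also have "\<dots> = ennreal c * (\<integral>\<^sup>+ x. ennreal (norm (f k x - u x)) \<partial>lebesgue_on \<Omega>)"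
      by (rule nn_integral_cmult) measurable
    finally show ?thesis .
  qed
  show "(\<lambda>k. \<integral>\<^sup>+ x. ennreal (norm ((f k x \<bullet> e) * \<psi> x - (u x \<bullet> e) * \<psi> x)) \<partial>lebesgue_on \<Omega>) \<longlonglongrightarrow> 0"
  proof (rule tendsto_sandwich[OF _ always_eventually[OF allI[OF le]] tendsto_const])
    show "(\<lambda>k. ennreal c * (\<integral>\<^sup>+ x. ennreal (norm (f k x - u x)) \<partial>lebesgue_on \<Omega>)) \<longlonglongrightarrow> 0"
      using ennreal_tendsto_cmult[OF _ rho_tendsto_L1[OF f(1) u lim], of "ennreal c"] by simp
  qed auto
qed

lemma sobolev_zero_finite:
  assumes "sobolev_zero u g"
  shows "rho u < \<infinity>" "rho g < \<infinity>"
  using assms unfolding sobolev_zero_def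
  by (auto intro: rho_limit_finite[OF test_function_measurable(1) _ _ test_function_rho_finite(1), simplified]
      rho_limit_finite[OF test_function_measurable(2) _ _ test_function_rho_finite(2), simplified])

text \<open>Integration by parts passes to the limit, because modular convergence implies \<open>L\<^sup>1\<close> convergence.\<close>

lemma sobolev_zero_weak_gradient:
  assumes ug: "sobolev_zero u g"
  shows "has_weak_gradient \<Omega> u g"
proof -
  obtain \<phi> where meas: "u \<in> borel_measurable (lebesgue_on \<Omega>)" "g \<in> borel_measurable (lebesgue_on \<Omega>)"
    and \<phi>: "\<And>k::nat. \<phi> k \<in> test_functions \<Omega>" and lim: "(\<lambda>k. rho (\<lambda>x. \<phi> k x - u x)) \<longlonglongrightarrow> 0"
      "(\<lambda>k. rho (\<lambda>x. grad (\<phi> k) x - g x)) \<longlonglongrightarrow> 0"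
    using ug unfolding sobolev_zero_def by blast
  have "(LINT x|lebesgue_on \<Omega>. u x * partial_deriv i \<psi> x) = - (LINT x|lebesgue_on \<Omega>. g x $ i * \<psi> x)"
    if \<psi>: "\<psi> \<in> test_functions \<Omega>" for \<psi> i
  proof -
    obtain B where B: "\<And>x. \<bar>\<psi> x\<bar> \<le> B" "\<And>x. norm (grad \<psi> x) \<le> B"
      using C1_compact_bounded[OF test_function_C1_compact[OF \<psi>]] by metis
    have pd: "partial_deriv i \<psi> = (\<lambda>x. grad \<psi> x $ i)" by (simp add: grad_def)
    have pd_B: "\<bar>partial_deriv i \<psi> x\<bar> \<le> B" for x
      using component_le_norm_cart[of "grad \<psi> x" i] B(2)[of x] by (simp add: pd)
    have pd_meas: "partial_deriv i \<psi> \<in> borel_measurable (lebesgue_on \<Omega>)"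
      unfolding pd by (rule measurable_compose[OF test_function_measurable(2)[OF \<psi>] borel_measurable_nth])
    have "(\<lambda>k. LINT x|lebesgue_on \<Omega>. (\<phi> k x \<bullet> 1) * partial_deriv i \<psi> x) \<longlonglongrightarrow> (LINT x|lebesgue_on \<Omega>. (u x \<bullet> 1) * partial_deriv i \<psi> x)"
      by (rule rho_tendsto_integral[OF test_function_measurable(1)[OF \<phi>] test_function_rho_finite(1)[OF \<phi>] meas(1) lim(1) pd_meas pd_B])
    moreover have "(\<lambda>k. LINT x|lebesgue_on \<Omega>. (grad (\<phi> k) x \<bullet> axis i 1) * \<psi> x) \<longlonglongrightarrow> (LINT x|lebesgue_on \<Omega>. (g x \<bullet> axis i 1) * \<psi> x)"
      by (rule rho_tendsto_integral[OF test_function_measurable(2)[OF \<phi>] test_function_rho_finite(2)[OF \<phi>] meas(2) lim(2)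
          test_function_measurable(1)[OF \<psi>] B(1)])
    ultimately have "(\<lambda>k. LINT x|lebesgue_on \<Omega>. \<phi> k x * partial_deriv i \<psi> x) \<longlonglongrightarrow> (LINT x|lebesgue_on \<Omega>. u x * partial_deriv i \<psi> x)"
      "(\<lambda>k. - (LINT x|lebesgue_on \<Omega>. grad (\<phi> k) x $ i * \<psi> x)) \<longlonglongrightarrow> - (LINT x|lebesgue_on \<Omega>. g x $ i * \<psi> x)"
      by (auto simp: inner_axis intro: tendsto_minus)
    then show ?thesis
      unfolding test_function_integration_by_parts[OF \<phi> \<psi>] by (rule LIMSEQ_unique)
  qed
  then show ?thesis
    using meas sobolev_zero_finite[OF ug]
    by (auto simp: has_weak_gradient_def intro!: integrable_locally_integrable rho_finite_integrable)
qed

section \<open>Luxemburg norm convergence and modular convergence\<close>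

lemma modular_eq: "modular \<Omega> p (\<lambda>x. norm (f x)) = (\<integral>\<^sup>+ x. ennreal (norm (f x) powr p x) \<partial>lebesgue_on \<Omega>)"
  by (simp add: modular_def)

lemma modular_le_rho:
  assumes "f \<in> borel_measurable (lebesgue_on \<Omega>)"
  shows "modular \<Omega> p (\<lambda>x. norm (f x)) \<le> ennreal pmax * rho f"
  unfolding modular_eq by (rule powr_integral_le_rho[OF assms])

lemma rho_le_modular: "rho f \<le> modular \<Omega> p (\<lambda>x. norm (f x))"
  unfolding modular_eq rho_def
proof (intro nn_integral_mono ennreal_leI)
  fix x assume x: "x \<in> space (lebesgue_on \<Omega>)"
  show "norm (f x) powr p x / p x \<le> norm (f x) powr p x"
    using exponent_gt_1[OF x] by (simp add: divide_le_eq mult_le_cancel_left1)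
qed

text \<open>The scaling inequalities that compare the modular with the Luxemburg norm; the second one depends
  on the upper bound of the exponent.\<close>

lemma modular_scale_le:
  assumes [measurable]: "f \<in> borel_measurable (lebesgue_on \<Omega>)" and s: "0 < s" "s \<le> 1"
  shows "modular \<Omega> p f \<le> ennreal s * modular \<Omega> p (\<lambda>x. f x / s)"
    and "modular \<Omega> p (\<lambda>x. f x / s) \<le> ennreal (s powr (- pmax)) * modular \<Omega> p f"
proof -
  have "modular \<Omega> p f \<le> (\<integral>\<^sup>+ x. ennreal s * ennreal (\<bar>f x / s\<bar> powr p x) \<partial>lebesgue_on \<Omega>)"
    unfolding modular_def
  proof (rule nn_integral_mono)
    fix x assume x: "x \<in> space (lebesgue_on \<Omega>)"
    have "\<bar>f x\<bar> powr p x = s powr p x * \<bar>f x / s\<bar> powr p x" using s by (simp add: powr_divide abs_divide)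
    also have "\<dots> \<le> s powr 1 * \<bar>f x / s\<bar> powr p x"
      using s exponent_gt_1[OF x] by (intro mult_right_mono powr_mono') auto
    finally show "ennreal (\<bar>f x\<bar> powr p x) \<le> ennreal s * ennreal (\<bar>f x / s\<bar> powr p x)"
      using s by (simp add: ennreal_leI flip: ennreal_mult)
  qed
  also have "\<dots> = ennreal s * modular \<Omega> p (\<lambda>x. f x / s)"
    unfolding modular_def by (rule nn_integral_cmult) measurable
  finally show "modular \<Omega> p f \<le> ennreal s * modular \<Omega> p (\<lambda>x. f x / s)" .
  have "modular \<Omega> p (\<lambda>x. f x / s) \<le> (\<integral>\<^sup>+ x. ennreal (s powr (- pmax)) * ennreal (\<bar>f x\<bar> powr p x) \<partial>lebesgue_on \<Omega>)"
    unfolding modular_def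
  proof (rule nn_integral_mono)
    fix x assume x: "x \<in> space (lebesgue_on \<Omega>)"
    have "\<bar>f x / s\<bar> powr p x = s powr (- p x) * \<bar>f x\<bar> powr p x"
      using s by (simp add: powr_divide abs_divide powr_minus field_simps)
    also have "\<dots> \<le> s powr (- pmax) * \<bar>f x\<bar> powr p x"
      using s exponent_bounds[OF x] by (intro mult_right_mono powr_mono') auto
    finally show "ennreal (\<bar>f x / s\<bar> powr p x) \<le> ennreal (s powr (- pmax)) * ennreal (\<bar>f x\<bar> powr p x)"
      by (simp add: ennreal_leI flip: ennreal_mult)
  qed
  also have "\<dots> = ennreal (s powr (- pmax)) * modular \<Omega> p f"
    unfolding modular_def by (rule nn_integral_cmult) measurable
  finally show "modular \<Omega> p (\<lambda>x. f x / s) \<le> ennreal (s powr (- pmax)) * modular \<Omega> p f" .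
qed

lemma luxemburg_set_nonempty:
  assumes [measurable]: "f \<in> borel_measurable (lebesgue_on \<Omega>)" and fin: "modular \<Omega> p f < \<infinity>"
  shows "{\<tau>. \<tau> > 0 \<and> modular \<Omega> p (\<lambda>x. f x / \<tau>) \<le> 1} \<noteq> {}"
proof -
  obtain M where M: "0 \<le> M" "modular \<Omega> p f = ennreal M" using fin by (cases "modular \<Omega> p f") auto
  define \<tau> where "\<tau> = M + 1"
  have \<tau>: "1 \<le> \<tau>" using M by (simp add: \<tau>_def)
  have "modular \<Omega> p (\<lambda>x. f x / \<tau>) \<le> ennreal (1 / \<tau>) * modular \<Omega> p (\<lambda>x. (f x / \<tau>) / (1 / \<tau>))"
    using \<tau> by (intro modular_scale_le(1)) auto
  also have "\<dots> = ennreal (M / \<tau>)" using \<tau> M by (simp flip: ennreal_mult)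
  also have "\<dots> \<le> 1" using M by (simp add: \<tau>_def)
  finally show ?thesis using \<tau> by (auto intro!: exI[of _ \<tau>])
qed

lemma luxemburg_norm_nonneg:
  assumes "f \<in> borel_measurable (lebesgue_on \<Omega>)" "modular \<Omega> p f < \<infinity>"
  shows "0 \<le> luxemburg_norm \<Omega> p f"
  unfolding luxemburg_norm_def using luxemburg_set_nonempty[OF assms] by (intro cInf_greatest) auto

lemma modular_le_of_luxemburg_norm:
  assumes f: "f \<in> borel_measurable (lebesgue_on \<Omega>)" "modular \<Omega> p f < \<infinity>"
    and \<tau>: "luxemburg_norm \<Omega> p f < \<tau>" "\<tau> \<le> 1"
  shows "modular \<Omega> p f \<le> ennreal \<tau>"
proof -
  obtain s where s: "0 < s" "modular \<Omega> p (\<lambda>x. f x / s) \<le> 1" "s < \<tau>"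
    using cInf_lessD[OF luxemburg_set_nonempty[OF f] \<tau>(1)[unfolded luxemburg_norm_def]] by auto
  have "modular \<Omega> p f \<le> ennreal s * modular \<Omega> p (\<lambda>x. f x / s)"
    using s \<tau> by (intro modular_scale_le(1) f) auto
  also have "\<dots> \<le> ennreal s * 1" using s by (intro mult_left_mono) auto
  also have "\<dots> \<le> ennreal \<tau>" using s by (simp add: ennreal_leI)
  finally show ?thesis .
qed

lemma luxemburg_norm_le_of_modular:
  assumes f: "f \<in> borel_measurable (lebesgue_on \<Omega>)"
    and \<tau>: "0 < \<tau>" "\<tau> \<le> 1" and small: "modular \<Omega> p f \<le> ennreal (\<tau> powr pmax)"
  shows "luxemburg_norm \<Omega> p f \<le> \<tau>"
  unfolding luxemburg_norm_def
proof (rule cInf_lower)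
  have "modular \<Omega> p (\<lambda>x. f x / \<tau>) \<le> ennreal (\<tau> powr (- pmax)) * modular \<Omega> p f"
    by (intro modular_scale_le(2) f \<tau>)
  also have "\<dots> \<le> ennreal (\<tau> powr (- pmax)) * ennreal (\<tau> powr pmax)" by (intro mult_left_mono small) auto
  also have "\<dots> = 1" using \<tau> by (simp flip: ennreal_mult powr_add)
  finally show "\<tau> \<in> {\<tau>. \<tau> > 0 \<and> modular \<Omega> p (\<lambda>x. f x / \<tau>) \<le> 1}" using \<tau> by simp
  show "bdd_below {\<tau>. \<tau> > 0 \<and> modular \<Omega> p (\<lambda>x. f x / \<tau>) \<le> 1}" by (rule bdd_belowI[of _ 0]) auto
qed

lemma Lp_var_iff:
  "(\<lambda>x. norm (f x)) \<in> Lp_var \<Omega> p \<longleftrightarrow> (\<lambda>x. norm (f x)) \<in> borel_measurable (lebesgue_on \<Omega>) \<and> rho f < \<infinity>"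
proof -
  have "modular \<Omega> p (\<lambda>x. norm (f x)) < \<infinity> \<longleftrightarrow> rho f < \<infinity>" if "(\<lambda>x. norm (f x)) \<in> borel_measurable (lebesgue_on \<Omega>)"
  proof
    assume "rho f < \<infinity>"
    then have "ennreal pmax * rho (\<lambda>x. norm (f x)) < \<infinity>"
      using rho_cong_AE[of "\<lambda>x. norm (f x)" f] by (simp add: ennreal_mult_less_top)
    then show "modular \<Omega> p (\<lambda>x. norm (f x)) < \<infinity>"
      using modular_le_rho[OF that] by (simp add: le_less_trans)
  qed (rule le_less_trans[OF rho_le_modular])
  then show ?thesis by (auto simp: Lp_var_def)
qed

lemma Lp_var_real_iff: "u \<in> Lp_var \<Omega> p \<longleftrightarrow> u \<in> borel_measurable (lebesgue_on \<Omega>) \<and> rho u < \<infinity>"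
proof -
  have eq: "modular \<Omega> p (\<lambda>x. norm (u x)) = modular \<Omega> p u" by (simp add: modular_def)
  have "modular \<Omega> p u < \<infinity> \<longleftrightarrow> rho u < \<infinity>" if u: "u \<in> borel_measurable (lebesgue_on \<Omega>)"
  proof
    assume "rho u < \<infinity>"
    then have "ennreal pmax * rho u < \<infinity>" by (simp add: ennreal_mult_less_top)
    then show "modular \<Omega> p u < \<infinity>" using modular_le_rho[OF u] unfolding eq by (rule le_less_trans[rotated])
  next
    assume "modular \<Omega> p u < \<infinity>"
    then show "rho u < \<infinity>" using rho_le_modular[of u] unfolding eq by (rule le_less_trans[rotated])
  qed
  then show ?thesis by (auto simp: Lp_var_def)
qed

lemma integrable_bounded_mult:
  fixes f \<psi> :: "real ^ 'n \<Rightarrow> real"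
  assumes "integrable (lebesgue_on \<Omega>) f" "\<psi> \<in> borel_measurable (lebesgue_on \<Omega>)" "\<And>x. \<bar>\<psi> x\<bar> \<le> B"
  shows "integrable (lebesgue_on \<Omega>) (\<lambda>x. f x * \<psi> x)"
proof (rule Bochner_Integration.integrable_bound)
  show "integrable (lebesgue_on \<Omega>) (\<lambda>x. f x * B)" using assms by simp
  show "AE x in lebesgue_on \<Omega>. norm (f x * \<psi> x) \<le> norm (f x * B)"
  proof (rule AE_I2)
    fix x
    have "\<bar>\<psi> x\<bar> \<le> \<bar>B\<bar>" using assms(3)[of x] by linarith
    then show "norm (f x * \<psi> x) \<le> norm (f x * B)"
      unfolding real_norm_def abs_mult by (intro mult_left_mono) auto
  qed
qed (use assms in auto)

lemma has_weak_gradient_diff_test: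
  assumes g: "has_weak_gradient \<Omega> u g" and int: "integrable (lebesgue_on \<Omega>) u" "integrable (lebesgue_on \<Omega>) g"
    and \<phi>: "\<phi> \<in> test_functions \<Omega>"
  shows "has_weak_gradient \<Omega> (\<lambda>x. u x - \<phi> x) (\<lambda>x. g x - grad \<phi> x)"
proof -
  have int\<phi>: "integrable (lebesgue_on \<Omega>) \<phi>" "integrable (lebesgue_on \<Omega>) (grad \<phi>)"
    by (intro rho_finite_integrable test_function_measurable[OF \<phi>] test_function_rho_finite[OF \<phi>])+
  have nth: "integrable (lebesgue_on \<Omega>) (\<lambda>x. f x $ i)" if "integrable (lebesgue_on \<Omega>) f" for f :: "real ^ 'n \<Rightarrow> real ^ 'n" and i
    using integrable_bounded_linear[OF bounded_linear_vec_nth that] .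
  have "(LINT x|lebesgue_on \<Omega>. (u x - \<phi> x) * partial_deriv i \<psi> x) = - (LINT x|lebesgue_on \<Omega>. (g x - grad \<phi> x) $ i * \<psi> x)"
    if \<psi>: "\<psi> \<in> test_functions \<Omega>" for \<psi> i
  proof -
    obtain B where B: "\<And>x. \<bar>\<psi> x\<bar> \<le> B" "\<And>x. norm (grad \<psi> x) \<le> B"
      using C1_compact_bounded[OF test_function_C1_compact[OF \<psi>]] by metis
    have pd: "partial_deriv i \<psi> = (\<lambda>x. grad \<psi> x $ i)" by (simp add: grad_def)
    have pd_B: "\<bar>partial_deriv i \<psi> x\<bar> \<le> B" for x
      using component_le_norm_cart[of "grad \<psi> x" i] B(2)[of x] by (simp add: pd)
    have pd_meas: "partial_deriv i \<psi> \<in> borel_measurable (lebesgue_on \<Omega>)"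
      unfolding pd by (rule measurable_compose[OF test_function_measurable(2)[OF \<psi>] borel_measurable_nth])
    have "(LINT x|lebesgue_on \<Omega>. (u x - \<phi> x) * partial_deriv i \<psi> x)
       = (LINT x|lebesgue_on \<Omega>. u x * partial_deriv i \<psi> x) - (LINT x|lebesgue_on \<Omega>. \<phi> x * partial_deriv i \<psi> x)"
      unfolding left_diff_distrib
      by (intro Bochner_Integration.integral_diff integrable_bounded_mult[OF _ pd_meas pd_B] int int\<phi>)
    also have "\<dots> = - (LINT x|lebesgue_on \<Omega>. g x $ i * \<psi> x) + (LINT x|lebesgue_on \<Omega>. grad \<phi> x $ i * \<psi> x)"
      using g \<psi> test_function_integration_by_parts[OF \<phi> \<psi>, of i] by (simp add: has_weak_gradient_def)
    also have "\<dots> = - (LINT x|lebesgue_on \<Omega>. g x $ i * \<psi> x - grad \<phi> x $ i * \<psi> x)"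
      using integrable_bounded_mult[OF nth[OF int(2), of i] test_function_measurable(1)[OF \<psi>] B(1)]
        integrable_bounded_mult[OF nth[OF int\<phi>(2), of i] test_function_measurable(1)[OF \<psi>] B(1)] by simp
    finally show ?thesis by (simp add: left_diff_distrib)
  qed
  then show ?thesis
    unfolding has_weak_gradient_def using int int\<phi>
    by (auto intro!: integrable_locally_integrable Bochner_Integration.integrable_diff)
qed

lemma sobolev_zero_weak_gradient_eq:
  assumes "sobolev_zero u g"
  shows "AE x in lebesgue_on \<Omega>. weak_gradient \<Omega> u x = g x"
    and "weak_gradient \<Omega> u \<in> borel_measurable (lebesgue_on \<Omega>)"
proof -
  note w = weak_gradient_AE_eq[OF open_domain sobolev_zero_weak_gradient[OF assms]]
  show "AE x in lebesgue_on \<Omega>. weak_gradient \<Omega> u x = g x" by (rule w(2))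
  show "weak_gradient \<Omega> u \<in> borel_measurable (lebesgue_on \<Omega>)"
    using w(1) by (auto simp: has_weak_gradient_def locally_integrable_def)
qed

lemma luxemburg_norm_weak_gradient_diff:
  assumes g: "has_weak_gradient \<Omega> u g" and u: "u \<in> borel_measurable (lebesgue_on \<Omega>)" "rho u < \<infinity>"
    and gm: "g \<in> borel_measurable (lebesgue_on \<Omega>)" "rho g < \<infinity>" and \<phi>: "\<phi> \<in> test_functions \<Omega>"
  shows "luxemburg_norm \<Omega> p (\<lambda>x. norm (weak_gradient \<Omega> (\<lambda>x. u x - \<phi> x) x))
    = luxemburg_norm \<Omega> p (\<lambda>x. norm (g x - grad \<phi> x))"
proof -
  have "has_weak_gradient \<Omega> (\<lambda>x. u x - \<phi> x) (\<lambda>x. g x - grad \<phi> x)"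
    by (intro has_weak_gradient_diff_test g \<phi> rho_finite_integrable u gm)
  from weak_gradient_AE_eq(2)[OF open_domain this]
  have AE: "AE x in lebesgue_on \<Omega>. weak_gradient \<Omega> (\<lambda>x. u x - \<phi> x) x = g x - grad \<phi> x" .
  have "modular \<Omega> p (\<lambda>x. norm (weak_gradient \<Omega> (\<lambda>x. u x - \<phi> x) x) / \<tau>) = modular \<Omega> p (\<lambda>x. norm (g x - grad \<phi> x) / \<tau>)" for \<tau>
    unfolding modular_def by (intro nn_integral_cong_AE) (use AE in eventually_elim, simp)
  then show ?thesis by (simp add: luxemburg_norm_def)
qed

lemma sobolev_zero_W1p0_var:
  assumes ug: "sobolev_zero u g"
  shows "u \<in> W1p0_var \<Omega> p"
proof -
  obtain \<phi> where u: "u \<in> borel_measurable (lebesgue_on \<Omega>)" and g: "g \<in> borel_measurable (lebesgue_on \<Omega>)"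
    and \<phi>: "\<And>k::nat. \<phi> k \<in> test_functions \<Omega>" and lim: "(\<lambda>k. rho (\<lambda>x. \<phi> k x - u x)) \<longlonglongrightarrow> 0"
      "(\<lambda>k. rho (\<lambda>x. grad (\<phi> k) x - g x)) \<longlonglongrightarrow> 0"
    using ug unfolding sobolev_zero_def by blast
  note fin = sobolev_zero_finite[OF ug] and wg = sobolev_zero_weak_gradient[OF ug]
  note w = sobolev_zero_weak_gradient_eq[OF ug]
  have "rho (weak_gradient \<Omega> u) = rho g"
    using w(1) by (intro rho_cong_AE) (auto elim: eventually_mono)
  then have "(\<lambda>x. norm (weak_gradient \<Omega> u x)) \<in> Lp_var \<Omega> p"
    using fin(2) w(2) by (intro Lp_var_iff[THEN iffD2]) simp
  moreover have "u \<in> Lp_var \<Omega> p" using u fin(1) by (intro Lp_var_real_iff[THEN iffD2]) simp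
  ultimately have "u \<in> W1p_var \<Omega> p"
    using wg unfolding W1p_var_def by blast
  moreover have "\<exists>\<phi>\<in>test_functions \<Omega>. W1p_norm \<Omega> p (\<lambda>x. u x - \<phi> x) < \<eta>" if "0 < \<eta>" for \<eta>
  proof -
    define \<tau> where "\<tau> = min 1 (\<eta> / 4)"
    have \<tau>: "0 < \<tau>" "\<tau> \<le> 1" "\<tau> + \<tau> < \<eta>" using \<open>0 < \<eta>\<close> by (auto simp: \<tau>_def)
    define d where "d = \<tau> powr pmax / (\<bar>pmax\<bar> + 1)"
    have d: "0 < d" using \<tau> by (simp add: d_def add_nonneg_pos)
    have small: "ennreal pmax * z \<le> ennreal (\<tau> powr pmax)" if "z \<le> ennreal d" for z
    proof -
      have "ennreal pmax * z \<le> ennreal (\<bar>pmax\<bar> + 1) * ennreal d"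
        using that by (intro mult_mono ennreal_leI) auto
      also have "\<dots> = ennreal ((\<bar>pmax\<bar> + 1) * d)" using d by (intro ennreal_mult[symmetric]) auto
      also have "(\<bar>pmax\<bar> + 1) * d = \<tau> powr pmax" by (simp add: d_def)
      finally show ?thesis .
    qed
    have d': "0 < ennreal d" using d by simp
    obtain k where k: "rho (\<lambda>x. \<phi> k x - u x) < ennreal d" "rho (\<lambda>x. grad (\<phi> k) x - g x) < ennreal d"
      using eventually_happens[OF eventually_conj[OF order_tendstoD(2)[OF lim(1) d'] order_tendstoD(2)[OF lim(2) d']]]
      by auto
    note [measurable] = u g test_function_measurable[OF \<phi>]
    have "modular \<Omega> p (\<lambda>x. u x - \<phi> k x) = modular \<Omega> p (\<lambda>x. norm (u x - \<phi> k x))" by (simp add: modular_def)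
    also have "\<dots> \<le> ennreal pmax * rho (\<lambda>x. u x - \<phi> k x)" by (rule modular_le_rho) measurable
    also have "\<dots> \<le> ennreal (\<tau> powr pmax)" using k(1) rho_minus_commute[of "\<phi> k" u] by (intro small) auto
    finally have 1: "luxemburg_norm \<Omega> p (\<lambda>x. u x - \<phi> k x) \<le> \<tau>"
      using \<tau> by (intro luxemburg_norm_le_of_modular) auto
    have "modular \<Omega> p (\<lambda>x. norm (g x - grad (\<phi> k) x)) \<le> ennreal pmax * rho (\<lambda>x. g x - grad (\<phi> k) x)"
      by (rule modular_le_rho) measurable
    also have "\<dots> \<le> ennreal (\<tau> powr pmax)" using k(2) rho_minus_commute[of "grad (\<phi> k)" g] by (intro small) auto
    finally have "luxemburg_norm \<Omega> p (\<lambda>x. norm (g x - grad (\<phi> k) x)) \<le> \<tau>"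
      using \<tau> by (intro luxemburg_norm_le_of_modular) auto
    with 1 have "W1p_norm \<Omega> p (\<lambda>x. u x - \<phi> k x) < \<eta>"
      unfolding W1p_norm_def luxemburg_norm_weak_gradient_diff[OF wg u fin(1) g fin(2) \<phi>] using \<tau>(3) by linarith
    then show ?thesis using \<phi> by blast
  qed
  ultimately show ?thesis by (simp add: W1p0_var_def)
qed

lemma W1p0_var_sobolev_zero:
  assumes "u \<in> W1p0_var \<Omega> p"
  shows "sobolev_zero u (weak_gradient \<Omega> u)"
proof -
  define g where "g = weak_gradient \<Omega> u"
  have W: "u \<in> Lp_var \<Omega> p" "\<exists>g. has_weak_gradient \<Omega> u g" "(\<lambda>x. norm (g x)) \<in> Lp_var \<Omega> p"
    and approx: "\<And>\<eta>. 0 < \<eta> \<Longrightarrow> \<exists>\<phi>\<in>test_functions \<Omega>. W1p_norm \<Omega> p (\<lambda>x. u x - \<phi> x) < \<eta>"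
    using assms by (auto simp: W1p0_var_def W1p_var_def g_def)
  have wg: "has_weak_gradient \<Omega> u g"
    using W(2) weak_gradient_AE_eq(1)[OF open_domain] by (auto simp: g_def)
  then have gm: "g \<in> borel_measurable (lebesgue_on \<Omega>)" by (auto simp: has_weak_gradient_def locally_integrable_def)
  have u: "u \<in> borel_measurable (lebesgue_on \<Omega>)" "rho u < \<infinity>" using iffD1[OF Lp_var_real_iff W(1)] by blast+
  have g_fin: "rho g < \<infinity>" using iffD1[OF Lp_var_iff W(3)] by blast
  have step: "\<exists>\<phi>\<in>test_functions \<Omega>. rho (\<lambda>x. \<phi> x - u x) \<le> ennreal (1 / Suc n) \<and> rho (\<lambda>x. grad \<phi> x - g x) \<le> ennreal (1 / Suc n)" for n :: nat
  proof -
    obtain \<phi> where \<phi>: "\<phi> \<in> test_functions \<Omega>" and lt: "W1p_norm \<Omega> p (\<lambda>x. u x - \<phi> x) < 1 / Suc n"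
      using approx[of "1 / Suc n"] by auto
    note [measurable] = u(1) gm test_function_measurable[OF \<phi>]
    have "rho (\<lambda>x. u x - \<phi> x) < \<infinity>"
      using rho_triangle[of u "\<lambda>x. 0" \<phi>] u(2) test_function_rho_finite(1)[OF \<phi>] rho_minus_commute[of "\<lambda>x. 0" \<phi>]
      by (auto simp: ennreal_mult_less_top intro: le_less_trans)
    then have f1: "modular \<Omega> p (\<lambda>x. u x - \<phi> x) < \<infinity>"
      using Lp_var_real_iff[of "\<lambda>x. u x - \<phi> x"] by (simp add: Lp_var_def)
    have "rho (\<lambda>x. g x - grad \<phi> x) < \<infinity>"
      using rho_triangle[of g "\<lambda>x. 0" "grad \<phi>"] g_fin test_function_rho_finite(2)[OF \<phi>] rho_minus_commute[of "\<lambda>x. 0" "grad \<phi>"]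
      by (auto simp: ennreal_mult_less_top intro: le_less_trans)
    then have f2: "modular \<Omega> p (\<lambda>x. norm (g x - grad \<phi> x)) < \<infinity>"
      using Lp_var_iff[of "\<lambda>x. g x - grad \<phi> x"] by (simp add: Lp_var_def)
    have sum: "luxemburg_norm \<Omega> p (\<lambda>x. u x - \<phi> x) + luxemburg_norm \<Omega> p (\<lambda>x. norm (g x - grad \<phi> x)) < 1 / Suc n"
      using lt unfolding W1p_norm_def luxemburg_norm_weak_gradient_diff[OF wg u gm g_fin \<phi>] .
    have "0 \<le> luxemburg_norm \<Omega> p (\<lambda>x. u x - \<phi> x)" "0 \<le> luxemburg_norm \<Omega> p (\<lambda>x. norm (g x - grad \<phi> x))"
      using f1 f2 by (auto intro!: luxemburg_norm_nonneg)
    then have "luxemburg_norm \<Omega> p (\<lambda>x. u x - \<phi> x) < 1 / Suc n" "luxemburg_norm \<Omega> p (\<lambda>x. norm (g x - grad \<phi> x)) < 1 / Suc n"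
      using sum by linarith+
    then have m: "modular \<Omega> p (\<lambda>x. u x - \<phi> x) \<le> ennreal (1 / Suc n)" "modular \<Omega> p (\<lambda>x. norm (g x - grad \<phi> x)) \<le> ennreal (1 / Suc n)"
      using f1 f2 by (auto intro!: modular_le_of_luxemburg_norm)
    have "rho (\<lambda>x. u x - \<phi> x) \<le> modular \<Omega> p (\<lambda>x. norm (u x - \<phi> x))" by (rule rho_le_modular)
    also have "\<dots> \<le> ennreal (1 / Suc n)" using m(1) by (simp add: modular_def)
    finally show ?thesis
      using \<phi> order_trans[OF rho_le_modular m(2)] rho_minus_commute[of u \<phi>] rho_minus_commute[of g "grad \<phi>"] by auto
  qed
  have "\<exists>\<phi>. \<forall>n. \<phi> n \<in> test_functions \<Omega> \<and> rho (\<lambda>x. \<phi> n x - u x) \<le> ennreal (1 / Suc n) \<and>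
      rho (\<lambda>x. grad (\<phi> n) x - g x) \<le> ennreal (1 / Suc n)"
    by (rule choice) (use step in blast)
  then obtain \<phi> where \<phi>: "\<And>n. \<phi> n \<in> test_functions \<Omega>"
    "\<And>n. rho (\<lambda>x. \<phi> n x - u x) \<le> ennreal (1 / Suc n)" "\<And>n. rho (\<lambda>x. grad (\<phi> n) x - g x) \<le> ennreal (1 / Suc n)"
    by blast
  have lim: "(\<lambda>n. ennreal (1 / Suc n)) \<longlonglongrightarrow> 0"
    using tendsto_ennrealI[OF LIMSEQ_Suc[OF lim_1_over_n]] by simp
  have "(\<lambda>n. rho (\<lambda>x. \<phi> n x - u x)) \<longlonglongrightarrow> 0" "(\<lambda>n. rho (\<lambda>x. grad (\<phi> n) x - g x)) \<longlonglongrightarrow> 0"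
    by (rule tendsto_sandwich[OF _ _ tendsto_const lim]; use \<phi> in simp)+
  then show ?thesis
    unfolding sobolev_zero_def g_def[symmetric] using u gm \<phi> by blast
qed

section \<open>The energy, the constraint and the singular term\<close>

lemma norm_Pair_powr:
  fixes \<xi> :: "'b::real_normed_vector"
  shows "norm (\<epsilon>::real, \<xi>) powr q = (\<epsilon>\<^sup>2 + (norm \<xi>)\<^sup>2) powr (q / 2)"
proof -
  have "0 \<le> \<epsilon>\<^sup>2 + (norm \<xi>)\<^sup>2" by simp
  then have "norm (\<epsilon>, \<xi>) = (\<epsilon>\<^sup>2 + (norm \<xi>)\<^sup>2) powr (1 / 2)"
    by (simp add: norm_Pair powr_half_sqrt)
  then show ?thesis by (simp add: powr_powr)
qed

lemma integral_powr_eq_rho: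
  assumes [measurable]: "f \<in> borel_measurable (lebesgue_on \<Omega>)" and fin: "rho f < \<infinity>"
  shows "integrable (lebesgue_on \<Omega>) (\<lambda>x. norm (f x) powr p x / p x)"
    and "(LINT x|lebesgue_on \<Omega>. norm (f x) powr p x / p x) = enn2real (rho f)"
proof -
  have nn: "AE x in lebesgue_on \<Omega>. 0 \<le> norm (f x) powr p x / p x"
    using exponent_pos by (intro AE_I2) (auto simp: less_imp_le)
  show int: "integrable (lebesgue_on \<Omega>) (\<lambda>x. norm (f x) powr p x / p x)"
    using fin nn by (intro integrableI_nonneg) (auto simp: rho_def)
  show "(LINT x|lebesgue_on \<Omega>. norm (f x) powr p x / p x) = enn2real (rho f)"
    unfolding rho_def using nn by (intro integral_eq_nn_integral) measurable
qed

lemma rho_Pair_finite: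
  fixes g :: "real ^ 'n \<Rightarrow> 'b::euclidean_space"
  assumes [measurable]: "g \<in> borel_measurable (lebesgue_on \<Omega>)" and fin: "rho g < \<infinity>"
  shows "rho (\<lambda>x. (\<epsilon>::real, g x)) < \<infinity>"
proof -
  have "rho (\<lambda>x. (\<epsilon>, g x) - 0) \<le> ennreal (2 powr (pmax - 1)) * (rho (\<lambda>x. (\<epsilon>, g x) - (\<epsilon>, 0)) + rho (\<lambda>x. (\<epsilon>, 0 :: 'b) - 0))"
    by (rule rho_triangle) measurable
  moreover have "rho (\<lambda>x. (\<epsilon>, g x) - (\<epsilon>, 0)) = rho g" by (intro rho_cong_AE) (simp add: norm_Pair)
  moreover have "rho (\<lambda>x. (\<epsilon>, 0 :: 'b) - 0) < \<infinity>" by (rule rho_bounded_finite[of _ "norm (\<epsilon>, 0 :: 'b)"]) simp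
  ultimately show ?thesis using fin by (auto simp: ennreal_mult_less_top intro: le_less_trans)
qed

text \<open>Up to an additive constant, the energy is the modular of the gradient augmented by the constant
  component \<open>\<epsilon>\<close>.\<close>

lemma E_func_eq_rho:
  assumes g: "g \<in> borel_measurable (lebesgue_on \<Omega>)" "rho g < \<infinity>"
    and wg: "AE x in lebesgue_on \<Omega>. weak_gradient \<Omega> u x = g x" "weak_gradient \<Omega> u \<in> borel_measurable (lebesgue_on \<Omega>)"
    and \<epsilon>: "0 < \<epsilon>"
  shows "E_func \<Omega> p \<epsilon> u = enn2real (rho (\<lambda>x. (\<epsilon>, g x))) - (LINT x|lebesgue_on \<Omega>. \<epsilon> powr p x / p x)"
proof -
  note [measurable] = g(1) wg(2)
  have const: "integrable (lebesgue_on \<Omega>) (\<lambda>x. \<epsilon> powr p x / p x)"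
    using integral_powr_eq_rho(1)[of "\<lambda>x. \<epsilon>"] rho_bounded_finite[of "\<lambda>x. \<epsilon>" "\<bar>\<epsilon>\<bar>"] \<epsilon> by simp
  have "E_func \<Omega> p \<epsilon> u = (LINT x|lebesgue_on \<Omega>. norm (\<epsilon>, g x) powr p x / p x - \<epsilon> powr p x / p x)"
    unfolding E_func_def
  proof (rule integral_cong_AE)
    show "AE x in lebesgue_on \<Omega>. Phi p \<epsilon> x (weak_gradient \<Omega> u x) = norm (\<epsilon>, g x) powr p x / p x - \<epsilon> powr p x / p x"
      using wg(1) by eventually_elim (simp add: Phi_def norm_Pair_powr diff_divide_distrib)
    show "(\<lambda>x. Phi p \<epsilon> x (weak_gradient \<Omega> u x)) \<in> borel_measurable (lebesgue_on \<Omega>)"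
      unfolding Phi_def by measurable
  qed measurable
  also have "\<dots> = (LINT x|lebesgue_on \<Omega>. norm (\<epsilon>, g x) powr p x / p x) - (LINT x|lebesgue_on \<Omega>. \<epsilon> powr p x / p x)"
    by (intro Bochner_Integration.integral_diff integral_powr_eq_rho rho_Pair_finite g const) measurable
  finally show ?thesis
    using integral_powr_eq_rho(2)[of "\<lambda>x. (\<epsilon>, g x)"] rho_Pair_finite[OF g] by simp
qed

lemma J_func_eq_rho:
  assumes "u \<in> borel_measurable (lebesgue_on \<Omega>)" "rho u < \<infinity>"
  shows "J_func \<Omega> p u = enn2real (rho u)"
  using integral_powr_eq_rho(2)[OF assms] by (simp add: J_func_def)

lemma rho_zero: "rho (\<lambda>x. 0) = 0"
  by (simp add: rho_def)

lemma test_function_sobolev_zero: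
  assumes "\<phi> \<in> test_functions \<Omega>"
  shows "sobolev_zero \<phi> (grad \<phi>)"
  unfolding sobolev_zero_def
  by (intro conjI exI[of _ "\<lambda>_. \<phi>"] allI assms test_function_measurable[OF assms]) (simp_all add: rho_zero)

lemma M_plus_iff:
  assumes "0 \<le> m"
  shows "u \<in> M_plus \<Omega> p m \<longleftrightarrow> (\<exists>g. sobolev_zero u g) \<and> (AE x in lebesgue_on \<Omega>. 0 \<le> u x) \<and> rho u = ennreal m"
proof -
  have J: "J_func \<Omega> p u = m \<longleftrightarrow> rho u = ennreal m" if s: "sobolev_zero u g" for g
  proof -
    have u: "u \<in> borel_measurable (lebesgue_on \<Omega>)" "rho u < \<infinity>"
      using s sobolev_zero_finite[OF s] by (auto simp: sobolev_zero_def)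
    show ?thesis
      unfolding J_func_eq_rho[OF u] using u(2) assms by (cases "rho u") auto
  qed
  have "u \<in> W1p0_var \<Omega> p \<longleftrightarrow> (\<exists>g. sobolev_zero u g)"
    using sobolev_zero_W1p0_var W1p0_var_sobolev_zero by blast
  then show ?thesis unfolding M_plus_def W1p0_nonneg_def using J by blast
qed

text \<open>Along the multiples of a nonnegative bump function the constraint functional is continuous
  and grows from zero to infinity.\<close>

lemma M_plus_nonempty:
  assumes "\<Omega> \<noteq> {}" "0 < m"
  shows "M_plus \<Omega> p m \<noteq> {}"
proof -
  obtain z where "z \<in> \<Omega>" using assms(1) by blast
  then obtain a b where ab: "cbox a b \<subseteq> \<Omega>" "z \<in> box a b"
    by (rule open_contains_cbox[OF open_domain]) (rule that)
  define \<phi> where "\<phi> = box_bump 1 a b"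
  have \<phi>: "\<phi> \<in> test_functions \<Omega>" unfolding \<phi>_def by (rule box_bump_test_function) (use ab in auto)
  have \<phi>_bounds: "0 \<le> \<phi> x" "\<phi> x \<le> 1" for x by (auto simp: \<phi>_def box_bump_bounds)
  note [measurable] = test_function_measurable(1)[OF \<phi>]
  define J where "J t = (LINT x|lebesgue_on \<Omega>. \<bar>t * \<phi> x\<bar> powr p x / p x)" for t
  have fin: "rho (\<lambda>x. t * \<phi> x) < \<infinity>" for t
    using \<phi>_bounds by (intro rho_bounded_finite[of _ "\<bar>t\<bar>"]) (auto simp: abs_mult intro: mult_left_le)
  have J_int: "integrable (lebesgue_on \<Omega>) (\<lambda>x. \<bar>t * \<phi> x\<bar> powr p x / p x)" for t
    using integral_powr_eq_rho(1)[OF _ fin[of t]] by simp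
  have J_rho: "J t = enn2real (rho (\<lambda>x. t * \<phi> x))" for t
    using integral_powr_eq_rho(2)[OF _ fin[of t]] by (simp add: J_def)
  have pos: "0 < J 1"
  proof (rule ccontr)
    assume "\<not> 0 < J 1"
    then have "rho \<phi> = 0" using J_rho[of 1] fin[of 1] by (cases "rho \<phi>") auto
    then have "AE x in lebesgue_on \<Omega>. ennreal (norm (\<phi> x) powr p x / p x) = 0"
      unfolding rho_def by (subst (asm) nn_integral_0_iff_AE) auto
    then have "AE x in lebesgue_on \<Omega>. x \<notin> box a b"
      using AE_space
    proof eventually_elim
      case (elim x)
      then have "\<phi> x = 0" using exponent_pos[of x] by (auto simp: ennreal_eq_0_iff divide_le_0_iff)
      then show ?case using box_bump_nonzero_iff[of 1 a b x] by (simp add: \<phi>_def)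
    qed
    then have "AE x in lebesgue. x \<in> \<Omega> \<longrightarrow> x \<notin> box a b" by (subst (asm) AE_restrict_space_iff) auto
    then have "AE x in lebesgue. x \<notin> box a b"
      using ab box_subset_cbox[of a b] by (auto elim!: eventually_mono)
    then have "box a b \<in> null_sets lebesgue" by (subst (asm) AE_iff_null_sets[symmetric]) auto
    then show False using open_not_negligible[OF open_box, of a b] ab(2) by (auto simp: negligible_iff_null_sets)
  qed
  define T where "T = max 1 (m / J 1)"
  have T: "1 \<le> T" by (simp add: T_def)
  have cont: "continuous_on {0..T} J"
  proof (rule continuous_on_sequentiallyI)
    fix t s assume ts: "\<forall>n. t n \<in> {0..T}" "s \<in> {0..T}" "t \<longlonglongrightarrow> s"
    show "(\<lambda>n. J (t n)) \<longlonglongrightarrow> J s"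
      unfolding J_def
    proof (rule integral_dominated_convergence[where w = "\<lambda>x. \<bar>T * \<phi> x\<bar> powr p x / p x"])
      show "integrable (lebesgue_on \<Omega>) (\<lambda>x. \<bar>T * \<phi> x\<bar> powr p x / p x)" by (rule J_int)
      show "AE x in lebesgue_on \<Omega>. (\<lambda>n. \<bar>t n * \<phi> x\<bar> powr p x / p x) \<longlonglongrightarrow> \<bar>s * \<phi> x\<bar> powr p x / p x"
        using AE_space
      proof eventually_elim
        case (elim x)
        then show ?case using exponent_pos[of x] ts(3) by (intro tendsto_intros) auto
      qed
      show "AE x in lebesgue_on \<Omega>. norm (\<bar>t n * \<phi> x\<bar> powr p x / p x) \<le> \<bar>T * \<phi> x\<bar> powr p x / p x" for n
        using AE_space
      proof eventually_elim
        case (elim x)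
        have "\<bar>t n * \<phi> x\<bar> \<le> \<bar>T * \<phi> x\<bar>"
          using ts(1) T \<phi>_bounds[of x] by (auto simp: abs_mult intro!: mult_right_mono)
        then have "\<bar>t n * \<phi> x\<bar> powr p x / p x \<le> \<bar>T * \<phi> x\<bar> powr p x / p x"
          using exponent_pos[of x] elim by (intro divide_right_mono powr_mono2) auto
        then show ?case using exponent_pos[of x] elim by simp
      qed
    qed measurable
  qed
  have "J 0 = 0" by (simp add: J_def)
  moreover have "m \<le> J T"
  proof -
    have "m = (m / J 1) * J 1" using pos by simp
    also have "\<dots> \<le> T * J 1" using pos by (intro mult_right_mono) (auto simp: T_def)
    also have "\<dots> = (LINT x|lebesgue_on \<Omega>. T * (\<bar>1 * \<phi> x\<bar> powr p x / p x))"
      unfolding J_def by (rule integral_mult_right_zero[symmetric])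
    also have "\<dots> \<le> J T"
      unfolding J_def
    proof (rule integral_mono)
      show "integrable (lebesgue_on \<Omega>) (\<lambda>x. T * (\<bar>1 * \<phi> x\<bar> powr p x / p x))"
        using J_int[of 1] by (intro integrable_mult_right)
      fix x assume x: "x \<in> space (lebesgue_on \<Omega>)"
      have "T * \<bar>\<phi> x\<bar> powr p x \<le> T powr p x * \<bar>\<phi> x\<bar> powr p x"
        using powr_mono[of 1 "p x" T] T exponent_gt_1[OF x] by (intro mult_right_mono) auto
      also have "\<dots> = \<bar>T * \<phi> x\<bar> powr p x" using T by (simp add: abs_mult powr_mult)
      finally show "T * (\<bar>1 * \<phi> x\<bar> powr p x / p x) \<le> \<bar>T * \<phi> x\<bar> powr p x / p x"
        using exponent_pos[OF x] by (simp add: divide_right_mono)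
    qed (rule J_int)
    finally show ?thesis .
  qed
  ultimately obtain t where t: "0 \<le> t" "J t = m"
    using IVT'[of J 0 m T] cont T assms(2) by auto
  have lin: "(\<lambda>x. t * \<phi> x) \<in> test_functions \<Omega>"
    using test_functions_linear(1)[OF \<phi> \<phi>, of t 0] by simp
  have "rho (\<lambda>x. t * \<phi> x) = ennreal m"
    using t(2) fin[of t] unfolding J_rho by (cases "rho (\<lambda>x. t * \<phi> x)") auto
  moreover have "AE x in lebesgue_on \<Omega>. 0 \<le> t * \<phi> x" using t(1) \<phi>_bounds by auto
  ultimately have "(\<lambda>x. t * \<phi> x) \<in> M_plus \<Omega> p m"
    using test_function_sobolev_zero[OF lin] assms(2) by (intro M_plus_iff[THEN iffD2]) auto
  then show ?thesis by blast
qed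

lemma rho_eq_0_AE:
  assumes [measurable]: "f \<in> borel_measurable (lebesgue_on \<Omega>)" and "rho f = 0"
  shows "AE x in lebesgue_on \<Omega>. f x = 0"
proof -
  have "AE x in lebesgue_on \<Omega>. ennreal (norm (f x) powr p x / p x) = 0"
    using assms(2) unfolding rho_def by (subst (asm) nn_integral_0_iff_AE) auto
  then show ?thesis
    using AE_space
  proof eventually_elim
    case (elim x)
    then show ?case using exponent_pos[of x] by (auto simp: ennreal_eq_0_iff divide_le_0_iff)
  qed
qed

text \<open>The negative part of the limit is at most the distance to the nonnegative approximants.\<close>

lemma rho_limit_nonneg:
  assumes [measurable]: "\<And>k. f k \<in> borel_measurable (lebesgue_on \<Omega>)" "u \<in> borel_measurable (lebesgue_on \<Omega>)"
    and lim: "(\<lambda>k. rho (\<lambda>x. f k x - u x)) \<longlonglongrightarrow> 0"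
    and nonneg: "\<And>k. AE x in lebesgue_on \<Omega>. (0::real) \<le> f k x"
  shows "AE x in lebesgue_on \<Omega>. 0 \<le> u x"
proof -
  have "rho (\<lambda>x. min (u x) 0) \<le> rho (\<lambda>x. f k x - u x)" for k
    using nonneg[of k] by (intro rho_mono_AE) (auto elim!: eventually_mono)
  then have "rho (\<lambda>x. min (u x) 0) \<le> 0"
    by (intro LIMSEQ_le_const[OF lim]) auto
  then have "AE x in lebesgue_on \<Omega>. min (u x) 0 = 0" by (intro rho_eq_0_AE) auto
  then show ?thesis by eventually_elim (simp add: min_def split: if_splits)
qed

text \<open>The derivative in \<open>s\<close> is \<open>(s + \<delta>) powr (- \<gamma> x)\<close>, which is at most \<open>1 / \<delta>\<close>.\<close>

lemma G_reg_lipschitz: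
  assumes \<gamma>: "0 < \<gamma> x" "\<gamma> x < 1" and \<delta>: "0 < \<delta>" "\<delta> \<le> 1" and st: "0 \<le> s" "0 \<le> t"
  shows "\<bar>G_reg \<gamma> \<delta> x s - G_reg \<gamma> \<delta> x t\<bar> \<le> (1 / \<delta>) * \<bar>s - t\<bar>"
proof -
  have "norm (G_reg \<gamma> \<delta> x s - G_reg \<gamma> \<delta> x t) \<le> (1 / \<delta>) * norm (s - t)"
  proof (rule field_differentiable_bound[where S = "{0..}" and f' = "\<lambda>r. (r + \<delta>) powr (- \<gamma> x)"])
    show "(G_reg \<gamma> \<delta> x has_field_derivative (r + \<delta>) powr (- \<gamma> x)) (at r within {0..})" if "r \<in> {0..}" for r
    proof -
      have "((\<lambda>r. r + \<delta>) has_field_derivative 1) (at r)" by (auto intro!: derivative_eq_intros)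
      then have "((\<lambda>r. (r + \<delta>) powr (1 - \<gamma> x)) has_field_derivative
          (1 - \<gamma> x) * (r + \<delta>) powr (1 - \<gamma> x - of_nat 1) * 1) (at r)"
        using that \<delta> by (intro DERIV_fun_powr) auto
      from DERIV_cdivide[OF DERIV_diff[OF this DERIV_const], of "\<delta> powr (1 - \<gamma> x)" "1 - \<gamma> x"]
      have "(G_reg \<gamma> \<delta> x has_field_derivative (r + \<delta>) powr (- \<gamma> x)) (at r)"
        using \<gamma> by (simp add: G_reg_def[abs_def])
      then show ?thesis by (rule has_field_derivative_at_within)
    qed
    show "norm ((r + \<delta>) powr (- \<gamma> x)) \<le> 1 / \<delta>" if "r \<in> {0..}" for r
    proof -
      have "(r + \<delta>) powr (- \<gamma> x) \<le> \<delta> powr (- \<gamma> x)" using that \<delta> \<gamma> by (intro powr_mono2') auto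
      also have "\<dots> \<le> \<delta> powr (- 1)" using \<delta> \<gamma> by (intro powr_mono') auto
      finally show ?thesis using \<delta> by (simp add: powr_minus_divide)
    qed
  qed (use st in auto)
  then show ?thesis by simp
qed

lemma G_reg_integral_continuous:
  assumes h: "h \<in> borel_measurable (lebesgue_on \<Omega>)" "AE x in lebesgue_on \<Omega>. \<bar>h x\<bar> \<le> C" "0 \<le> C"
    and \<gamma>: "\<gamma> \<in> borel_measurable (lebesgue_on \<Omega>)" "\<And>x. x \<in> \<Omega> \<Longrightarrow> 0 < \<gamma> x \<and> \<gamma> x < 1"
    and \<delta>: "0 < \<delta>" "\<delta> \<le> 1"
    and f: "\<And>k. f k \<in> borel_measurable (lebesgue_on \<Omega>)" "u \<in> borel_measurable (lebesgue_on \<Omega>)"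
      "\<And>k. rho (f k) < \<infinity>" "rho u < \<infinity>"
    and lim: "(\<lambda>k. rho (\<lambda>x. f k x - u x)) \<longlonglongrightarrow> 0"
    and nonneg: "\<And>k. AE x in lebesgue_on \<Omega>. 0 \<le> f k x" "AE x in lebesgue_on \<Omega>. 0 \<le> u x"
  shows "(\<lambda>k. LINT x|lebesgue_on \<Omega>. h x * G_reg \<gamma> \<delta> x (f k x)) \<longlonglongrightarrow> (LINT x|lebesgue_on \<Omega>. h x * G_reg \<gamma> \<delta> x (u x))"
proof (rule tendsto_L1_int)
  note [measurable] = h(1) \<gamma>(1) f(1,2)
  have meas: "(\<lambda>x. h x * G_reg \<gamma> \<delta> x (v x)) \<in> borel_measurable (lebesgue_on \<Omega>)"
    if [measurable]: "v \<in> borel_measurable (lebesgue_on \<Omega>)" for v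
    unfolding G_reg_def by measurable
  have lip: "AE x in lebesgue_on \<Omega>. norm (h x * G_reg \<gamma> \<delta> x (v x) - h x * G_reg \<gamma> \<delta> x (w x)) \<le> C * (1 / \<delta>) * \<bar>v x - w x\<bar>"
    if "AE x in lebesgue_on \<Omega>. 0 \<le> v x" "AE x in lebesgue_on \<Omega>. 0 \<le> w x" for v w
    using that h(2) AE_space
  proof eventually_elim
    case (elim x)
    have "norm (h x * G_reg \<gamma> \<delta> x (v x) - h x * G_reg \<gamma> \<delta> x (w x)) = \<bar>h x\<bar> * \<bar>G_reg \<gamma> \<delta> x (v x) - G_reg \<gamma> \<delta> x (w x)\<bar>"
      by (simp add: abs_mult flip: right_diff_distrib)
    also have "\<dots> \<le> C * ((1 / \<delta>) * \<bar>v x - w x\<bar>)"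
      using elim \<gamma>(2)[of x] \<delta> h(3) by (intro mult_mono G_reg_lipschitz) auto
    finally show ?case by simp
  qed
  have int: "integrable (lebesgue_on \<Omega>) (\<lambda>x. h x * G_reg \<gamma> \<delta> x (v x))"
    if v: "v \<in> borel_measurable (lebesgue_on \<Omega>)" "rho v < \<infinity>" "AE x in lebesgue_on \<Omega>. 0 \<le> v x" for v :: "real ^ 'n \<Rightarrow> real"
  proof (rule Bochner_Integration.integrable_bound)
    show "integrable (lebesgue_on \<Omega>) (\<lambda>x. C * (1 / \<delta>) * v x)"
      using rho_finite_integrable[OF v(1,2)] by (intro integrable_mult_right)
    show "AE x in lebesgue_on \<Omega>. norm (h x * G_reg \<gamma> \<delta> x (v x)) \<le> norm (C * (1 / \<delta>) * v x)"
      using lip[OF v(3), of "\<lambda>x. 0"] v(3) h(3) \<delta> by (auto elim!: eventually_mono simp: G_reg_def abs_mult)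
  qed (rule meas[OF v(1)])
  show "integrable (lebesgue_on \<Omega>) (\<lambda>x. h x * G_reg \<gamma> \<delta> x (f k x))" for k by (intro int f nonneg)
  show "integrable (lebesgue_on \<Omega>) (\<lambda>x. h x * G_reg \<gamma> \<delta> x (u x))" by (intro int f nonneg)
  have le: "(\<integral>\<^sup>+ x. ennreal (norm (h x * G_reg \<gamma> \<delta> x (f k x) - h x * G_reg \<gamma> \<delta> x (u x))) \<partial>lebesgue_on \<Omega>)
      \<le> ennreal (C * (1 / \<delta>)) * (\<integral>\<^sup>+ x. ennreal (norm (f k x - u x)) \<partial>lebesgue_on \<Omega>)" for k
  proof -
    have "(\<integral>\<^sup>+ x. ennreal (norm (h x * G_reg \<gamma> \<delta> x (f k x) - h x * G_reg \<gamma> \<delta> x (u x))) \<partial>lebesgue_on \<Omega>)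
      \<le> (\<integral>\<^sup>+ x. ennreal (C * (1 / \<delta>)) * ennreal (norm (f k x - u x)) \<partial>lebesgue_on \<Omega>)"
      using lip[OF nonneg(1)[of k] nonneg(2)] h(3) \<delta>
      by (intro nn_integral_mono_AE) (auto elim!: eventually_mono intro!: ennreal_leI simp flip: ennreal_mult)
    also have "\<dots> = ennreal (C * (1 / \<delta>)) * (\<integral>\<^sup>+ x. ennreal (norm (f k x - u x)) \<partial>lebesgue_on \<Omega>)"
      by (rule nn_integral_cmult) measurable
    finally show ?thesis .
  qed
  show "(\<lambda>k. \<integral>\<^sup>+ x. ennreal (norm (h x * G_reg \<gamma> \<delta> x (f k x) - h x * G_reg \<gamma> \<delta> x (u x))) \<partial>lebesgue_on \<Omega>) \<longlonglongrightarrow> 0"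
  proof (rule tendsto_sandwich[OF _ always_eventually[OF allI[OF le]] tendsto_const])
    show "(\<lambda>k. ennreal (C * (1 / \<delta>)) * (\<integral>\<^sup>+ x. ennreal (norm (f k x - u x)) \<partial>lebesgue_on \<Omega>)) \<longlonglongrightarrow> 0"
      using ennreal_tendsto_cmult[OF _ rho_tendsto_L1[OF f(1,2) lim], of "ennreal (C * (1 / \<delta>))"] by simp
  qed auto
qed

section \<open>Existence of a minimizer\<close>

text \<open>Replace the members of the sequence by test functions with almost the same energy, extract a
  convergent subsequence, and apply lower semicontinuity to the convex set of the pairs
  \<open>(\<phi>, (\<epsilon>, grad \<phi>))\<close>.  The limit of the second components still has the first entry \<open>\<epsilon>\<close>, so it
  carries a gradient of the limit function.\<close>

lemma energy_bounded_compactness: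
  fixes \<epsilon> :: real
  assumes ug: "\<And>k::nat. sobolev_zero (u k) (g k)" and \<epsilon>: "0 < \<epsilon>"
    and B: "\<And>k. rho (u k) \<le> ennreal B" and a: "\<And>k. rho (\<lambda>x. (\<epsilon>, g k x)) = ennreal (a k)" "\<And>k. 0 \<le> a k" "\<And>k. a k \<le> B"
  obtains s v gv L where "strict_mono (s :: nat \<Rightarrow> nat)" "sobolev_zero v gv"
    "(\<lambda>k. rho (\<lambda>x. u (s k) x - v x)) \<longlonglongrightarrow> 0" "(\<lambda>k. a (s k)) \<longlonglongrightarrow> L" "rho (\<lambda>x. (\<epsilon>, gv x)) \<le> ennreal L"
proof -
  have B0: "0 \<le> B" using a(2,3) order_trans by blast
  have meas [measurable]: "u k \<in> borel_measurable (lebesgue_on \<Omega>)" "g k \<in> borel_measurable (lebesgue_on \<Omega>)" for k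
    using ug[of k] by (auto simp: sobolev_zero_def)
  have "\<exists>\<phi>. \<phi> \<in> test_functions \<Omega> \<and> rho (\<lambda>x. \<phi> x - u k x) \<le> ennreal (1 / Suc k) \<and>
      rho (\<lambda>x. (\<epsilon>, grad \<phi> x)) \<le> ennreal (a k + 1 / Suc k)" for k
  proof -
    obtain \<phi> where \<phi>: "\<And>j::nat. \<phi> j \<in> test_functions \<Omega>" and lim: "(\<lambda>j. rho (\<lambda>x. \<phi> j x - u k x)) \<longlonglongrightarrow> 0"
      "(\<lambda>j. rho (\<lambda>x. grad (\<phi> j) x - g k x)) \<longlonglongrightarrow> 0"
      using ug[of k] unfolding sobolev_zero_def by blast
    obtain d where d: "0 < d" "\<And>f h :: real ^ 'n \<Rightarrow> real \<times> (real ^ 'n). f \<in> borel_measurable (lebesgue_on \<Omega>) \<Longrightarrow> h \<in> borel_measurable (lebesgue_on \<Omega>) \<Longrightarrow>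
      rho h \<le> ennreal (a k) \<Longrightarrow> rho (\<lambda>x. f x - h x) \<le> ennreal d \<Longrightarrow> rho f \<le> ennreal (a k + 1 / Suc k)"
      using rho_near_le[OF a(2)[of k], of "1 / Suc k", where 'b = "real \<times> (real ^ 'n)"] by auto
    have pos: "0 < ennreal (1 / Suc k)" "0 < ennreal d" using d(1) by auto
    obtain j where j: "rho (\<lambda>x. \<phi> j x - u k x) < ennreal (1 / Suc k)" "rho (\<lambda>x. grad (\<phi> j) x - g k x) < ennreal d"
      using eventually_happens[OF eventually_conj[OF order_tendstoD(2)[OF lim(1) pos(1)] order_tendstoD(2)[OF lim(2) pos(2)]]]
      by auto
    note [measurable] = test_function_measurable[OF \<phi>]
    have "rho (\<lambda>x. (\<epsilon>, grad (\<phi> j) x)) \<le> ennreal (a k + 1 / Suc k)"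
    proof (rule d(2)[of "\<lambda>x. (\<epsilon>, grad (\<phi> j) x)" "\<lambda>x. (\<epsilon>, g k x)"])
      show "rho (\<lambda>x. (\<epsilon>, g k x)) \<le> ennreal (a k)" using a(1) by simp
      have "rho (\<lambda>x. (\<epsilon>, grad (\<phi> j) x) - (\<epsilon>, g k x)) = rho (\<lambda>x. grad (\<phi> j) x - g k x)"
        by (intro rho_cong_AE) (simp add: norm_Pair)
      then show "rho (\<lambda>x. (\<epsilon>, grad (\<phi> j) x) - (\<epsilon>, g k x)) \<le> ennreal d" using j(2) by simp
    qed measurable
    then show ?thesis using \<phi> j(1) by (intro exI[of _ "\<phi> j"]) auto
  qed
  then have "\<exists>\<phi>. \<forall>k. \<phi> k \<in> test_functions \<Omega> \<and> rho (\<lambda>x. \<phi> k x - u k x) \<le> ennreal (1 / Suc k) \<and>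
      rho (\<lambda>x. (\<epsilon>, grad (\<phi> k) x)) \<le> ennreal (a k + 1 / Suc k)"
    by (intro choice) blast
  then obtain \<phi> where \<phi>: "\<And>k. \<phi> k \<in> test_functions \<Omega>" and near: "\<And>k. rho (\<lambda>x. \<phi> k x - u k x) \<le> ennreal (1 / Suc k)"
    and energy: "\<And>k. rho (\<lambda>x. (\<epsilon>, grad (\<phi> k) x)) \<le> ennreal (a k + 1 / Suc k)" by blast
  note \<phi>_meas [measurable] = test_function_measurable[OF \<phi>]
  have inv_lim: "(\<lambda>n. ennreal (1 / Suc n)) \<longlonglongrightarrow> 0"
    using tendsto_ennrealI[OF LIMSEQ_Suc[OF lim_1_over_n]] by simp
  have inv_le: "1 / real (Suc k) \<le> 1" for k by simp
  define B' where "B' = 2 powr (pmax - 1) * (1 + B) + B + 1"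
  have B': "0 \<le> B'" "B + 1 \<le> B'" "2 powr (pmax - 1) * (1 + B) \<le> B'" using B0 by (auto simp: B'_def)
  have r1: "rho (\<phi> k) \<le> ennreal B'" for k
  proof -
    have "rho (\<lambda>x. \<phi> k x - 0) \<le> ennreal (2 powr (pmax - 1)) * (rho (\<lambda>x. \<phi> k x - u k x) + rho (\<lambda>x. u k x - 0))"
      by (rule rho_triangle) measurable
    also have "\<dots> \<le> ennreal (2 powr (pmax - 1)) * (ennreal 1 + ennreal B)"
      using B[of k] by (intro mult_left_mono add_mono order_trans[OF near] ennreal_leI inv_le) auto
    also have "\<dots> = ennreal (2 powr (pmax - 1) * (1 + B))" using B0 by (simp flip: ennreal_mult ennreal_plus ennreal_1)
    finally show ?thesis using B'(3) by (simp add: order_trans ennreal_leI)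
  qed
  have r2: "rho (grad (\<phi> k)) \<le> ennreal B'" for k
  proof -
    have "rho (grad (\<phi> k)) \<le> rho (\<lambda>x. (\<epsilon>, grad (\<phi> k) x))"
      by (intro rho_mono_AE AE_I2) (simp add: norm_Pair real_le_rsqrt)
    also have "\<dots> \<le> ennreal (a k + 1 / Suc k)" by (rule energy)
    also have "\<dots> \<le> ennreal B'" using a(3)[of k] inv_le[of k] B'(2) by (intro ennreal_leI) linarith
    finally show ?thesis .
  qed
  obtain s1 v where s1: "strict_mono (s1 :: nat \<Rightarrow> nat)" and v [measurable]: "v \<in> borel_measurable (lebesgue_on \<Omega>)"
    and \<phi>v: "(\<lambda>k. rho (\<lambda>x. \<phi> (s1 k) x - v x)) \<longlonglongrightarrow> 0"
    by (rule test_function_compactness[OF \<phi> B'(1) r1 r2]) (rule that)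
  have "bounded (range (\<lambda>k. a (s1 k)))"
    using a(2,3) by (intro boundedI[of _ B]) auto
  from bounded_imp_convergent_subsequence[OF this]
  obtain L s2 where s2: "strict_mono (s2 :: nat \<Rightarrow> nat)" and aL: "((\<lambda>k. a (s1 k)) \<circ> s2) \<longlonglongrightarrow> L" by blast
  define s where "s = s1 \<circ> s2"
  have s: "strict_mono s" unfolding s_def by (intro strict_mono_o s1 s2)
  have a_lim: "(\<lambda>k. a (s k)) \<longlonglongrightarrow> L" using aL by (simp add: s_def o_def)
  have \<phi>_lim: "(\<lambda>k. rho (\<lambda>x. \<phi> (s k) x - v x)) \<longlonglongrightarrow> 0"
    using LIMSEQ_subseq_LIMSEQ[OF \<phi>v s2] by (simp add: s_def o_def)
  have u_lim: "(\<lambda>k. rho (\<lambda>x. u (s k) x - v x)) \<longlonglongrightarrow> 0"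
  proof (rule rho_tendsto_triangle[OF _ _ _ _ \<phi>_lim])
    have "(\<lambda>k. rho (\<lambda>x. u k x - \<phi> k x)) \<longlonglongrightarrow> 0"
    proof (rule tendsto_sandwich[OF _ _ tendsto_const inv_lim])
      show "\<forall>\<^sub>F k in sequentially. rho (\<lambda>x. u k x - \<phi> k x) \<le> ennreal (1 / Suc k)"
        using near by (intro always_eventually allI) (simp add: rho_minus_commute[of "u _"])
    qed auto
    from LIMSEQ_subseq_LIMSEQ[OF this s] show "(\<lambda>k. rho (\<lambda>x. u (s k) x - \<phi> (s k) x)) \<longlonglongrightarrow> 0"
      by (simp add: o_def)
  qed measurable
  define C where "C = {(\<phi>, \<lambda>x. (\<epsilon>, grad \<phi> x)) | \<phi>. \<phi> \<in> test_functions \<Omega>}"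
  obtain G w h where G [measurable]: "G \<in> borel_measurable (lebesgue_on \<Omega>)" and GL: "rho G \<le> ennreal L"
    and C: "\<And>k. (w k, h k) \<in> C" and w_lim: "(\<lambda>k. rho (\<lambda>x. w k x - v x)) \<longlonglongrightarrow> 0"
    and h_lim: "(\<lambda>k. rho (\<lambda>x. h k x - G x)) \<longlonglongrightarrow> 0"
  proof (rule rho_convex_lsc[of C v "\<lambda>k. \<phi> (s k)" "\<lambda>k x. (\<epsilon>, grad (\<phi> (s k)) x)" "\<lambda>k. a (s k) + 1 / Suc (s k)" L])
    show "f \<in> borel_measurable (lebesgue_on \<Omega>) \<and> G \<in> borel_measurable (lebesgue_on \<Omega>) \<and> rho G < \<infinity>" if "(f, G) \<in> C" for f G
    proof -
      have f: "f \<in> test_functions \<Omega>" and G: "G = (\<lambda>x. (\<epsilon>, grad f x))" using that by (auto simp: C_def)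
      note [measurable] = test_function_measurable[OF f]
      have "rho (\<lambda>x. (\<epsilon>, grad f x)) < \<infinity>"
        by (rule rho_Pair_finite[OF test_function_measurable(2)[OF f] test_function_rho_finite(2)[OF f]])
      then show ?thesis unfolding G by auto
    qed
    show "(\<lambda>x. (1/2) *\<^sub>R (f x + f' x), \<lambda>x. (1/2) *\<^sub>R (G x + G' x)) \<in> C" if "(f, G) \<in> C" "(f', G') \<in> C" for f G f' G'
    proof -
      have f: "f \<in> test_functions \<Omega>" "f' \<in> test_functions \<Omega>" and G: "G = (\<lambda>x. (\<epsilon>, grad f x))" "G' = (\<lambda>x. (\<epsilon>, grad f' x))"
        using that by (auto simp: C_def)
      note lin = test_functions_linear[OF f, of "1/2" "1/2"]
      have eq: "(\<lambda>x. (1/2) *\<^sub>R (f x + f' x)) = (\<lambda>x. 1/2 * f x + 1/2 * f' x)"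
        by (simp add: add_divide_distrib)
      have "(\<lambda>x. (1/2) *\<^sub>R (G x + G' x)) = (\<lambda>x. (\<epsilon>, grad (\<lambda>x. 1/2 * f x + 1/2 * f' x) x))"
        unfolding lin(2) G by (simp add: scaleR_right_distrib fun_eq_iff)
      then show ?thesis unfolding C_def eq using lin(1) by blast
    qed
    show "(\<phi> (s k), \<lambda>x. (\<epsilon>, grad (\<phi> (s k)) x)) \<in> C" for k using \<phi> by (auto simp: C_def)
    show "0 \<le> a (s k) + 1 / Suc (s k)" for k using a(2)[of "s k"] by simp
    show "(\<lambda>k. a (s k) + 1 / Suc (s k)) \<longlonglongrightarrow> L"
      using tendsto_add[OF a_lim LIMSEQ_subseq_LIMSEQ[OF LIMSEQ_Suc[OF lim_1_over_n] s]] by (simp add: o_def)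
  qed (use \<phi>_lim energy in \<open>auto intro: that\<close>)
  have w: "w k \<in> test_functions \<Omega>" and h: "h k = (\<lambda>x. (\<epsilon>, grad (w k) x))" for k
    using C[of k] by (auto simp: C_def)
  define gv where "gv x = snd (G x)" for x
  have gv [measurable]: "gv \<in> borel_measurable (lebesgue_on \<Omega>)"
    unfolding gv_def by (rule measurable_compose[OF G borel_measurable_continuous_onI]) (intro continuous_intros)
  have fst_G [measurable]: "(\<lambda>x. fst (G x)) \<in> borel_measurable (lebesgue_on \<Omega>)"
    by (rule measurable_compose[OF G borel_measurable_continuous_onI]) (intro continuous_intros)
  have "(\<lambda>k. rho (\<lambda>x. grad (w k) x - gv x)) \<longlonglongrightarrow> 0"
  proof (rule tendsto_sandwich[OF _ _ tendsto_const h_lim])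
    show "\<forall>\<^sub>F k in sequentially. rho (\<lambda>x. grad (w k) x - gv x) \<le> rho (\<lambda>x. h k x - G x)"
    proof (intro always_eventually allI rho_mono_AE AE_I2)
      fix k x show "norm (grad (w k) x - gv x) \<le> norm (h k x - G x)"
        using norm_snd_le[of "grad (w k) x - gv x" "\<epsilon> - fst (G x)"] by (simp add: h gv_def minus_prod_def)
    qed
  qed auto
  then have sob: "sobolev_zero v gv"
    unfolding sobolev_zero_def using v gv w w_lim by blast
  have "rho (\<lambda>x. \<epsilon> - fst (G x)) \<le> rho (\<lambda>x. h k x - G x)" for k
  proof (intro rho_mono_AE AE_I2)
    fix x show "norm (\<epsilon> - fst (G x)) \<le> norm (h k x - G x)"
      using norm_fst_le[of "\<epsilon> - fst (G x)" "grad (w k) x - gv x"] by (simp add: h gv_def minus_prod_def)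
  qed
  then have "rho (\<lambda>x. \<epsilon> - fst (G x)) \<le> 0" by (intro LIMSEQ_le_const[OF h_lim]) auto
  then have "AE x in lebesgue_on \<Omega>. \<epsilon> - fst (G x) = 0" by (intro rho_eq_0_AE) auto
  then have "rho (\<lambda>x. (\<epsilon>, gv x)) = rho G"
    by (intro rho_cong_AE) (auto elim!: eventually_mono simp: gv_def)
  then have "rho (\<lambda>x. (\<epsilon>, gv x)) \<le> ennreal L" using GL by simp
  then show ?thesis using that s sob u_lim a_lim by blast
qed

text \<open>The constraint bounds the singular term (the constant \<open>D\<close>), which makes the functional bounded below
  and the energy bounded along a minimizing sequence.\<close>

theorem I_func_attains_minimum:
  assumes nonempty: "\<Omega> \<noteq> {}" and \<epsilon>: "0 < \<epsilon>" and m: "0 < m"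
    and h: "h \<in> borel_measurable (lebesgue_on \<Omega>)" "AE x in lebesgue_on \<Omega>. \<bar>h x\<bar> \<le> C" "0 \<le> C"
    and \<gamma>: "\<gamma> \<in> borel_measurable (lebesgue_on \<Omega>)" "\<And>x. x \<in> \<Omega> \<Longrightarrow> 0 < \<gamma> x \<and> \<gamma> x < 1"
    and \<delta>: "0 < \<delta>" "\<delta> \<le> 1" and \<mu>: "0 \<le> \<mu>"
  shows "\<exists>u\<in>M_plus \<Omega> p m. \<forall>v\<in>M_plus \<Omega> p m. I_func \<Omega> p h \<gamma> \<epsilon> \<mu> \<delta> u \<le> I_func \<Omega> p h \<gamma> \<epsilon> \<mu> \<delta> v"
proof -
  define S where "S = M_plus \<Omega> p m"
  define I where "I = I_func \<Omega> p h \<gamma> \<epsilon> \<mu> \<delta>"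
  define H where "H u = (LINT x|lebesgue_on \<Omega>. h x * G_reg \<gamma> \<delta> x (u x))" for u
  define c0 where "c0 = (LINT x|lebesgue_on \<Omega>. \<epsilon> powr p x / p x)"
  define A where "A u = enn2real (rho (\<lambda>x. (\<epsilon>, weak_gradient \<Omega> u x)))" for u
  have S: "sobolev_zero u (weak_gradient \<Omega> u)" "AE x in lebesgue_on \<Omega>. 0 \<le> u x" "rho u = ennreal m" "rho u < \<infinity>"
    if "u \<in> S" for u
  proof -
    have u: "\<exists>g. sobolev_zero u g" "AE x in lebesgue_on \<Omega>. 0 \<le> u x" "rho u = ennreal m"
      using that M_plus_iff[of m u] m unfolding S_def by auto
    then show "sobolev_zero u (weak_gradient \<Omega> u)"
      using sobolev_zero_W1p0_var W1p0_var_sobolev_zero by blast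
    show "AE x in lebesgue_on \<Omega>. 0 \<le> u x" "rho u = ennreal m" "rho u < \<infinity>" using u by auto
  qed
  have S_meas: "u \<in> borel_measurable (lebesgue_on \<Omega>)" "weak_gradient \<Omega> u \<in> borel_measurable (lebesgue_on \<Omega>)" if "u \<in> S" for u
    using S(1)[OF that] by (auto simp: sobolev_zero_def)
  have A_rho: "rho (\<lambda>x. (\<epsilon>, weak_gradient \<Omega> u x)) = ennreal (A u)" "0 \<le> A u" if "u \<in> S" for u
    using rho_Pair_finite[OF S_meas(2)[OF that] sobolev_zero_finite(2)[OF S(1)[OF that]], of \<epsilon>]
    by (auto simp: A_def)
  have E_eq: "E_func \<Omega> p \<epsilon> u = A u - c0" if "u \<in> S" for u
    unfolding A_def c0_def using S_meas(2)[OF that] sobolev_zero_finite(2)[OF S(1)[OF that]] \<epsilon>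
    by (intro E_func_eq_rho) auto
  have I_eq: "I u = A u - c0 - \<mu> * H u" if "u \<in> S" for u
    using E_eq[OF that] by (simp add: I_def I_func_def H_def)
  obtain K where K: "0 < K" "\<And>f :: real ^ 'n \<Rightarrow> real. f \<in> borel_measurable (lebesgue_on \<Omega>) \<Longrightarrow> rho f \<le> ennreal m \<Longrightarrow>
    (\<integral>\<^sup>+ x. ennreal (norm (f x)) \<partial>lebesgue_on \<Omega>) \<le> ennreal K"
    using norm_integral_bounded[of m, where 'b = real] by blast
  define D where "D = C * (1 / \<delta>) * K"
  have H_le: "H u \<le> D" if u: "u \<in> S" for u
  proof -
    have "ennreal (norm (H u)) \<le> (\<integral>\<^sup>+ x. ennreal (C * (1 / \<delta>)) * ennreal (norm (u x)) \<partial>lebesgue_on \<Omega>)"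
    proof (cases "integrable (lebesgue_on \<Omega>) (\<lambda>x. h x * G_reg \<gamma> \<delta> x (u x))")
      case True
      have "ennreal (norm (H u)) \<le> (\<integral>\<^sup>+ x. ennreal (norm (h x * G_reg \<gamma> \<delta> x (u x))) \<partial>lebesgue_on \<Omega>)"
        unfolding H_def by (rule integral_norm_bound_ennreal[OF True])
      also have "\<dots> \<le> (\<integral>\<^sup>+ x. ennreal (C * (1 / \<delta>)) * ennreal (norm (u x)) \<partial>lebesgue_on \<Omega>)"
      proof (rule nn_integral_mono_AE)
        show "AE x in lebesgue_on \<Omega>. ennreal (norm (h x * G_reg \<gamma> \<delta> x (u x))) \<le> ennreal (C * (1 / \<delta>)) * ennreal (norm (u x))"
          using S(2)[OF u] h(2) AE_space
        proof eventually_elim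
          case (elim x)
          have "\<bar>G_reg \<gamma> \<delta> x (u x) - G_reg \<gamma> \<delta> x 0\<bar> \<le> (1 / \<delta>) * \<bar>u x - 0\<bar>"
            using elim \<gamma>(2)[of x] \<delta> by (intro G_reg_lipschitz) auto
          then have "\<bar>h x\<bar> * \<bar>G_reg \<gamma> \<delta> x (u x)\<bar> \<le> C * ((1 / \<delta>) * \<bar>u x\<bar>)"
            using elim h(3) by (intro mult_mono) (auto simp: G_reg_def)
          then show ?case using h(3) \<delta> by (simp add: abs_mult ennreal_leI flip: ennreal_mult)
        qed
      qed
      finally show ?thesis .
    qed (simp add: H_def not_integrable_integral_eq)
    also have "\<dots> = ennreal (C * (1 / \<delta>)) * (\<integral>\<^sup>+ x. ennreal (norm (u x)) \<partial>lebesgue_on \<Omega>)"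
      using S_meas(1)[OF u] by (intro nn_integral_cmult) measurable
    also have "\<dots> \<le> ennreal (C * (1 / \<delta>)) * ennreal K"
      using S(3)[OF u] S_meas(1)[OF u] by (intro mult_left_mono K(2)) auto
    also have "\<dots> = ennreal D" using h(3) \<delta> K(1) by (simp add: D_def flip: ennreal_mult)
    finally have "norm (H u) \<le> D" using h(3) \<delta> K(1) by (subst (asm) ennreal_le_iff) (auto simp: D_def)
    then show ?thesis by simp
  qed
  have I_lower: "- c0 - \<mu> * D \<le> I u" if "u \<in> S" for u
    using I_eq[OF that] A_rho(2)[OF that] mult_left_mono[OF H_le[OF that] \<mu>] by linarith
  then have bdd: "bdd_below (I ` S)" by (intro bdd_belowI2)
  have "S \<noteq> {}" using M_plus_nonempty[OF nonempty m] by (simp add: S_def)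
  define L where "L = Inf (I ` S)"
  have L_le: "L \<le> I u" if "u \<in> S" for u
    unfolding L_def using that bdd by (intro cInf_lower) auto
  have "\<exists>u. u \<in> S \<and> I u < L + 1 / Suc k" for k :: nat
  proof -
    have "Inf (I ` S) < L + 1 / Suc k" by (simp add: L_def)
    from cInf_lessD[OF _ this] \<open>S \<noteq> {}\<close> show ?thesis by auto
  qed
  then have "\<exists>u. \<forall>k::nat. u k \<in> S \<and> I (u k) < L + 1 / Suc k" by (intro choice) blast
  then obtain u where u: "\<And>k::nat. u k \<in> S" and I_u: "\<And>k. I (u k) < L + 1 / Suc k" by blast
  define B where "B = max m (L + 1 + c0 + \<mu> * D)"
  have A_le: "A (u k) \<le> B" for k
  proof -
    have "I (u k) < L + 1" using I_u[of k] by (rule less_le_trans) simp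
    then show ?thesis
      using I_eq[OF u[of k]] mult_left_mono[OF H_le[OF u[of k]] \<mu>] by (simp add: B_def)
  qed
  have rho_B: "rho (u k) \<le> ennreal B" for k
    unfolding S(3)[OF u] by (intro ennreal_leI) (simp add: B_def)
  obtain s v gv a where s: "strict_mono (s :: nat \<Rightarrow> nat)" and sob: "sobolev_zero v gv"
    and lim: "(\<lambda>k. rho (\<lambda>x. u (s k) x - v x)) \<longlonglongrightarrow> 0" and A_lim: "(\<lambda>k. A (u (s k))) \<longlonglongrightarrow> a"
    and gv_le: "rho (\<lambda>x. (\<epsilon>, gv x)) \<le> ennreal a"
    by (rule energy_bounded_compactness[of u "\<lambda>k. weak_gradient \<Omega> (u k)" \<epsilon> B "\<lambda>k. A (u k)"])
      (use S(1) u \<epsilon> rho_B A_rho A_le that in auto)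
  have v: "v \<in> borel_measurable (lebesgue_on \<Omega>)" "gv \<in> borel_measurable (lebesgue_on \<Omega>)"
    using sob by (auto simp: sobolev_zero_def)
  have v_nonneg: "AE x in lebesgue_on \<Omega>. 0 \<le> v x"
    by (rule rho_limit_nonneg[OF S_meas(1)[OF u] v(1) lim S(2)[OF u]])
  have "rho v = ennreal m"
    by (rule rho_limit_const[OF S_meas(1)[OF u] v(1) lim]) (use m S(3)[OF u] in auto)
  then have vS: "v \<in> S" unfolding S_def using sob v_nonneg m by (intro M_plus_iff[THEN iffD2]) auto
  have "rho (\<lambda>x. (\<epsilon>, weak_gradient \<Omega> v x)) = rho (\<lambda>x. (\<epsilon>, gv x))"
    using sobolev_zero_weak_gradient_eq(1)[OF sob] by (intro rho_cong_AE) (auto elim!: eventually_mono)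
  then have "ennreal (A v) \<le> ennreal a" using gv_le A_rho(1)[OF vS] by simp
  moreover have "0 \<le> a" using A_lim A_rho(2)[OF u] by (intro LIMSEQ_le_const) auto
  ultimately have A_v: "A v \<le> a" by (simp add: ennreal_le_iff)
  have H_lim: "(\<lambda>k. H (u (s k))) \<longlonglongrightarrow> H v"
    unfolding H_def
    by (rule G_reg_integral_continuous[OF h \<gamma> \<delta> S_meas(1)[OF u] v(1) S(4)[OF u] S(4)[OF vS] lim S(2)[OF u] v_nonneg])
  have "(\<lambda>k. A (u (s k)) - c0 - \<mu> * H (u (s k))) \<longlonglongrightarrow> a - c0 - \<mu> * H v"
    by (intro tendsto_intros A_lim H_lim)
  then have I_lim: "(\<lambda>k. I (u (s k))) \<longlonglongrightarrow> a - c0 - \<mu> * H v" by (simp add: I_eq[OF u])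
  have "(\<lambda>k. L + 1 / Suc (s k)) \<longlonglongrightarrow> L + 0"
    using LIMSEQ_subseq_LIMSEQ[OF LIMSEQ_Suc[OF lim_1_over_n] s] by (intro tendsto_add tendsto_const) (simp add: o_def)
  then have "a - c0 - \<mu> * H v \<le> L"
    using I_u by (intro LIMSEQ_le[OF I_lim]) (auto intro: less_imp_le)
  then have "I v \<le> L" using I_eq[OF vS] A_v by linarith
  then have "\<forall>w\<in>S. I v \<le> I w" using L_le by (blast intro: order_trans)
  then show ?thesis using vS unfolding S_def I_def by blast
qed

end

lemma log_holder_on_continuous:
  assumes "log_holder_on S p"
  shows "continuous_on S p"
proof -
  obtain C where C: "0 < C" "\<And>x y. x \<in> S \<Longrightarrow> y \<in> S \<Longrightarrow> x \<noteq> y \<Longrightarrow> \<bar>p x - p y\<bar> \<le> C / ln (exp 1 + 1 / dist x y)"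
    using assms unfolding log_holder_on_def by blast
  show ?thesis
    unfolding continuous_on_iff
  proof (intro ballI allI impI)
    fix x and e :: real assume x: "x \<in> S" and e: "0 < e"
    \<comment> \<open>\<open>ln (1 / d) = 2 * C / e\<close>\<close>
    define d where "d = exp (- (2 * C / e))"
    have "dist (p y) (p x) < e" if y: "y \<in> S" "dist y x < d" for y
    proof (cases "x = y")
      case False
      have "1 / d < 1 / dist x y"
        using that False by (intro divide_strict_left_mono) (auto simp: dist_commute d_def)
      then have "exp (2 * C / e) < exp 1 + 1 / dist x y"
        by (simp add: d_def exp_minus inverse_eq_divide add_strict_increasing2)
      then have big: "2 * C / e < ln (exp 1 + 1 / dist x y)"
        by (metis exp_gt_zero less_trans ln_exp ln_less_cancel_iff)
      have "\<bar>p x - p y\<bar> \<le> C / ln (exp 1 + 1 / dist x y)" using C(2)[OF x y(1) False] .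
      also have "\<dots> \<le> C / (2 * C / e)"
      proof (rule divide_left_mono)
        have "0 < 2 * C / e" using C(1) e by simp
        then show "0 < ln (exp 1 + 1 / dist x y) * (2 * C / e)" using big by (intro mult_pos_pos) linarith+
      qed (use big C(1) in auto)
      also have "\<dots> < e" using C(1) e by simp
      finally show ?thesis by (simp add: dist_real_def abs_minus_commute)
    qed (use e in simp)
    then show "\<exists>d>0. \<forall>y\<in>S. dist y x < d \<longrightarrow> dist (p y) (p x) < e"
      by (intro exI[of _ d]) (auto simp: d_def)
  qed
qed

theorem lemma2p9:
  fixes \<Omega> :: "(real ^ 'n) set"
    and p h \<gamma> :: "real ^ 'n \<Rightarrow> real"
    and \<epsilon> m \<gamma>min \<gamma>max :: real
  assumes "CARD('n) \<ge> 2"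
    and "bounded_lipschitz_domain \<Omega>"
    and "admissible_exponent \<Omega> p"
    and "essentially_bounded \<Omega> h"
    and "AE x in lebesgue_on \<Omega>. 0 \<le> h x"
    and "\<not> (AE x in lebesgue_on \<Omega>. h x = 0)"
    and "continuous_on (closure \<Omega>) \<gamma>"
    and "0 < \<gamma>min" and "\<And>x. x \<in> closure \<Omega> \<Longrightarrow> \<gamma>min \<le> \<gamma> x \<and> \<gamma> x \<le> \<gamma>max" and "\<gamma>max < 1"
    and "\<epsilon> > 0" and "m > 0"
  shows "\<forall>\<mu>\<ge>0. \<forall>\<delta>. 0 < \<delta> \<and> \<delta> \<le> 1 \<longrightarrow>
           (\<exists>u\<in>M_plus \<Omega> p m. \<forall>v\<in>M_plus \<Omega> p m. I_func \<Omega> p h \<gamma> \<epsilon> \<mu> \<delta> u \<le> I_func \<Omega> p h \<gamma> \<epsilon> \<mu> \<delta> v)"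
proof -
  have dom: "\<Omega> \<noteq> {}" "open \<Omega>" "bounded \<Omega>" using assms(2) by (auto simp: bounded_lipschitz_domain_def)
  obtain a b where ab: "1 < p a" "\<And>x. x \<in> closure \<Omega> \<Longrightarrow> p a \<le> p x \<and> p x \<le> p b"
    using assms(3) by (auto simp: admissible_exponent_def)
  have "continuous_on (closure \<Omega>) p"
    using assms(3) by (intro log_holder_on_continuous) (simp add: admissible_exponent_def)
  then interpret exponent_domain \<Omega> p "p a" "p b"
    using dom ab by unfold_locales auto
  obtain C where h: "h \<in> borel_measurable (lebesgue_on \<Omega>)" and C: "AE x in lebesgue_on \<Omega>. \<bar>h x\<bar> \<le> C"
    using assms(4) by (auto simp: essentially_bounded_def)
  have C': "AE x in lebesgue_on \<Omega>. \<bar>h x\<bar> \<le> \<bar>C\<bar>" using C by eventually_elim simp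
  have \<gamma>: "\<gamma> \<in> borel_measurable (lebesgue_on \<Omega>)"
    by (intro continuous_imp_measurable_on_sets_lebesgue continuous_on_subset[OF assms(7)] closure_subset) simp
  have \<gamma>01: "0 < \<gamma> x \<and> \<gamma> x < 1" if "x \<in> \<Omega>" for x
    using assms(8,9,10) that closure_subset[of \<Omega>] by force
  show ?thesis
    using I_func_attains_minimum[OF dom(1) assms(11,12) h C' abs_ge_zero \<gamma> \<gamma>01] by blast
qed

end
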